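(* Let $(\mathcal A,\mathcal T,\mathcal G)$ be a regularity structure with a model $(\Pi,\Gamma)$. Let $0<\gamma\le\bar\gamma$ with $\gamma,\bar\gamma\notin\mathcal A$, let $1\le q,\bar q,r\le\infty$ and $1\le p,\bar p<\infty$. Then the following (continuous) embeddings hold, where for $\gamma\le\bar\gamma$ a modelled distribution $f$ of order $\bar\gamma$ is regarded as one of order $\gamma$ via $f\mapsto\mathcal Q_{<\gamma}f$: i) $\mathcal F^{\bar\gamma}_{p,\bar q}\subset\mathcal F^\gamma_{p,q}$ if $q<\bar q$ and $\gamma<\bar\gamma$; ii) $\mathcal F^{\bar\gamma}_{\bar p,q}\subset\mathcal F^\gamma_{p,r}$ if $\bar p<p$ and $\gamma<\bar\gamma-|\mathfrak s|(1/\bar p-1/p)$; iii) $\mathcal F^{\bar\gamma}_{\bar p,q}\subset\mathcal B^\gamma_{p,\bar p}$ if $\bar p<p$ and $\gamma<\bar\gamma-|\mathfrak s|(1/\bar p-1/p)$.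
   Context: Basic notation. Fix $d\ge1$ and a scaling $\mathfrak s=(\mathfrak s_1,\dots,\mathfrak s_d)$ of positive integers; $|\mathfrak s|=\sum_i\mathfrak s_i$, $\|x\|_{\mathfrak s}=\max_i|x_i|^{1/\mathfrak s_i}$, $Q(x,R)=\{y\in\mathbf R^d:\|y-x\|_{\mathfrak s}\le R\}$, $|k|_{\mathfrak s}=\sum_ik_i\mathfrak s_i$ for $k\in\mathbf N_0^d$. $L^p=L^p(\mathbf R^d,dx)$, $L^q_\lambda=L^q((0,1],\lambda^{-1}d\lambda)$; $L^q$-type norms are replaced by suprema if $q=\infty$. $\eta^\lambda_x(z)=\lambda^{-|\mathfrak s|}\eta(\lambda^{-\mathfrak s_1}(z_1-x_1),\dots,\lambda^{-\mathfrak s_d}(z_d-x_d))$. For $R\in\mathbf N$, $\mathfrak B^R$ is the set of $\eta\in\mathcal C^\infty(\mathbf R^d)$ supported in $Q(0,1)$ whose derivatives $D^k\eta$, $|k|_{\mathfrak s}\le R$, have $\mathcal C^R$-norm at most $1$. (In the claim, $r$ is an integrability exponent.) Regularity structure. A triple $(\mathcal A,\mathcal T,\mathcal G)$: $\mathcal A\subset\mathbf R$ bounded below and locally finite; $\mathcal T=\bigoplus_{\zeta\in\mathcal A}\mathcal T_\zeta$ with Banach spaces $\mathcal T_\zeta$; $\mathcal G$ a group of linear maps on $\mathcal T$ with $\Gamma\tau-\tau\in\bigoplus_{\beta\in\mathcal A,\beta<\zeta}\mathcal T_\beta$ for $\tau\in\mathcal T_\zeta$, $\Gamma\in\mathcal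 G$. $\mathcal Q_\zeta$ is the projection onto $\mathcal T_\zeta$, $|\tau|_\zeta=\|\mathcal Q_\zeta\tau\|_{\mathcal T_\zeta}$, $\mathcal A_\gamma=\mathcal A\cap(-\infty,\gamma)$, $\mathcal T^-_\gamma=\bigoplus_{\beta\in\mathcal A_\gamma}\mathcal T_\beta$, and $\mathcal Q_{<\gamma}$ is the projection onto $\mathcal T^-_\gamma$. Model. A pair $(\Pi,\Gamma)$: continuous linear maps $\Pi_x:\mathcal T\to\mathcal D'(\mathbf R^d)$ and $\Gamma:\mathbf R^d\times\mathbf R^d\to\mathcal G$ with $\Gamma_{x,x}=1$, $\Gamma_{x,z}\Gamma_{z,y}=\Gamma_{x,y}$, $\Pi_y=\Pi_x\Gamma_{x,y}$, such that for every $\gamma>0$ (with $R$ the smallest positive integer larger than $|\min\mathcal A|\vee|\max\mathcal A_\gamma|$): $|\langle\Pi_x\tau,\eta^\lambda_x\rangle|\lesssim|\tau|_\zeta\lambda^\zeta$ and $|\Gamma_{x,y}\tau|_\beta\lesssim|\tau|_\zeta\|x-y\|_{\mathfrak s}^{\zeta-\beta}$, uniformly over $x\in\mathbf R^d$, $y\in Q(x,1)$, $\eta\in\mathfrak B^R$, $\lambda\in(0,1]$, $\zeta\in\mathcal A_\gamma$, $\tau\in\mathcal T_\zeta$, $\beta\in\mathcal A$ with $\beta\le\zeta$. Spaces. For $1\le p<\infty$, $1\le q\le\infty$, $\mathcal F^\gamma_{p,q}$ is the Banach space of $f:\mathbf R^d\to\mathcal T^-_\gamma$ with finite norm $$\sup_{\zeta\in\mathcal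 A_\gamma}\big\||f(x)|_\zeta\big\|_{L^p}+\sup_{\zeta\in\mathcal A_\gamma}\bigg\|\Big\|\frac1{|Q(0,4\lambda)|}\int_{Q(0,4\lambda)}\frac{|f(x+h)-\Gamma_{x+h,x}f(x)|_\zeta}{\lambda^{\gamma-\zeta}}\,dh\Big\|_{L^q_\lambda}\bigg\|_{L^p}.$$ For $1\le p,q\le\infty$, $\mathcal B^\gamma_{p,q}$ is the Banach space of $f:\mathbf R^d\to\mathcal T^-_\gamma$ with finite norm $$\sup_{\zeta\in\mathcal A_\gamma}\big\||f(x)|_\zeta\big\|_{L^p}+\sup_{\zeta\in\mathcal A_\gamma}\bigg(\int_{Q(0,1)}\bigg\|\frac{|f(x+h)-\Gamma_{x+h,x}f(x)|_\zeta}{\|h\|_{\mathfrak s}^{\gamma-\zeta}}\bigg\|^q_{L^p}\frac{dh}{\|h\|_{\mathfrak s}^{|\mathfrak s|}}\bigg)^{1/q}.$$ *)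

theory Defs
  imports "HOL-Analysis.Analysis" "HOL-Probability.Essential_Supremum"
begin

section \<open>Scalings\<close>

definition scaling :: "('d::finite \<Rightarrow> nat) \<Rightarrow> bool"
  where "scaling s \<longleftrightarrow> (\<forall>i. 0 < s i)"

definition scaling_size :: "('d::finite \<Rightarrow> nat) \<Rightarrow> nat"
  where "scaling_size s = (\<Sum>i\<in>UNIV. s i)"

definition scaled_norm :: "('d::finite \<Rightarrow> nat) \<Rightarrow> real^'d \<Rightarrow> real"
  where "scaled_norm s x = (MAX i. root (s i) \<bar>x $ i\<bar>)"

definition scaled_ball :: "('d::finite \<Rightarrow> nat) \<Rightarrow> real^'d \<Rightarrow> real \<Rightarrow> (real^'d) set"
  where "scaled_ball s x R = {y. scaled_norm s (y - x) \<le> R}"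

definition rescale :: "('d::finite \<Rightarrow> nat) \<Rightarrow> real \<Rightarrow> real^'d \<Rightarrow> (real^'d \<Rightarrow> real) \<Rightarrow> real^'d \<Rightarrow> real"
  where "rescale s l x \<eta> z = \<eta> (\<chi> i. (z $ i - x $ i) / l ^ s i) / l ^ scaling_size s"


section \<open>Test functions and distributions\<close>

definition partial_deriv :: "'d \<Rightarrow> (real^'d::finite \<Rightarrow> real) \<Rightarrow> real^'d \<Rightarrow> real"
  where "partial_deriv i f x = frechet_derivative f (at x) (axis i 1)"

text \<open>
  Iterated partial derivatives are indexed by the list of coordinates along which one
  differentiates. For smooth functions the order is immaterial, so a list \<open>ks\<close> stands for the
  multi-index \<open>k\<close> with \<open>k i = count_list ks i\<close>; its order is \<open>length ks\<close> and its scaled order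
  is \<open>scaled_order s ks\<close>.
\<close>

definition partial_derivs :: "'d list \<Rightarrow> (real^'d::finite \<Rightarrow> real) \<Rightarrow> real^'d \<Rightarrow> real"
  where "partial_derivs ks f = foldr partial_deriv ks f"

definition scaled_order :: "('d::finite \<Rightarrow> nat) \<Rightarrow> 'd list \<Rightarrow> nat"
  where "scaled_order s ks = (\<Sum>i\<in>UNIV. count_list ks i * s i)"

definition smooth :: "(real^'d::finite \<Rightarrow> real) \<Rightarrow> bool"
  where "smooth f \<longleftrightarrow> (\<forall>ks. partial_derivs ks f differentiable_on UNIV)"

definition C_norm :: "nat \<Rightarrow> (real^'d::finite \<Rightarrow> real) \<Rightarrow> ennreal"
  where "C_norm R f = (SUP ls\<in>{ls. length ls \<le> R}. SUP x. ennreal \<bar>partial_derivs ls f x\<bar>)"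

definition test_ball :: "('d::finite \<Rightarrow> nat) \<Rightarrow> nat \<Rightarrow> (real^'d \<Rightarrow> real) set"
  where "test_ball s R =
    {\<eta>. smooth \<eta> \<and> closure {x. \<eta> x \<noteq> 0} \<subseteq> scaled_ball s 0 1 \<and>
        (\<forall>ks. scaled_order s ks \<le> R \<longrightarrow> C_norm R (partial_derivs ks \<eta>) \<le> 1)}"

definition test_function :: "(real^'d::finite \<Rightarrow> real) \<Rightarrow> bool"
  where "test_function \<phi> \<longleftrightarrow> smooth \<phi> \<and> compact (closure {x. \<phi> x \<noteq> 0})"

text \<open>
  A distribution is a functional on all functions of which only the values on test functions
  are meaningful.
\<close>

definition distribution :: "((real^'d::finite \<Rightarrow> real) \<Rightarrow> real) \<Rightarrow> bool"
  where "distribution u \<longleftrightarrow>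
    (\<forall>\<phi> \<psi> a b. test_function \<phi> \<longrightarrow> test_function \<psi> \<longrightarrow>
       u (\<lambda>x. a * \<phi> x + b * \<psi> x) = a * u \<phi> + b * u \<psi>) \<and>
    (\<forall>K. compact K \<longrightarrow>
       (\<exists>(C::real) N. \<forall>\<phi>. test_function \<phi> \<longrightarrow> closure {x. \<phi> x \<noteq> 0} \<subseteq> K \<longrightarrow>
          ennreal \<bar>u \<phi>\<bar> \<le> ennreal C * C_norm N \<phi>))"


section \<open>Regularity structures\<close>

text \<open>
  The type \<open>'v\<close> is the space \<open>\<T>\<close>, the internal (algebraic) direct sum of the subspaces
  \<open>hspace RS \<zeta>\<close>, \<open>\<zeta> \<in> hom_set RS\<close>; the norm \<open>hnorm RS \<zeta>\<close> is only meaningful on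
  \<open>hspace RS \<zeta>\<close>.
\<close>

record 'v regularity_structure =
  hom_set :: "real set"
  hspace :: "real \<Rightarrow> 'v set"
  hnorm :: "real \<Rightarrow> 'v \<Rightarrow> real"
  structure_group :: "('v \<Rightarrow> 'v) set"

definition banach_subspace :: "'v::real_vector set \<Rightarrow> ('v \<Rightarrow> real) \<Rightarrow> bool"
  where "banach_subspace V N \<longleftrightarrow>
    subspace V \<and>
    (\<forall>v\<in>V. 0 \<le> N v \<and> (N v = 0 \<longleftrightarrow> v = 0)) \<and>
    (\<forall>v\<in>V. \<forall>a. N (a *\<^sub>R v) = \<bar>a\<bar> * N v) \<and>
    (\<forall>v\<in>V. \<forall>w\<in>V. N (v + w) \<le> N v + N w) \<and>
    (\<forall>\<sigma>::nat \<Rightarrow> 'v. (\<forall>n. \<sigma> n \<in> V) \<longrightarrow>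
       (\<forall>e>0. \<exists>n0. \<forall>m\<ge>n0. \<forall>n\<ge>n0. N (\<sigma> m - \<sigma> n) < e) \<longrightarrow>
       (\<exists>v\<in>V. (\<lambda>n. N (\<sigma> n - v)) \<longlonglongrightarrow> 0))"

definition decomposition :: "'v::real_vector regularity_structure \<Rightarrow> 'v \<Rightarrow> (real \<Rightarrow> 'v) \<Rightarrow> bool"
  where "decomposition RS \<tau> c \<longleftrightarrow>
    (\<forall>\<zeta>\<in>hom_set RS. c \<zeta> \<in> hspace RS \<zeta>) \<and> (\<forall>\<zeta>. \<zeta> \<notin> hom_set RS \<longrightarrow> c \<zeta> = 0) \<and>
    finite {\<zeta>. c \<zeta> \<noteq> 0} \<and> \<tau> = (\<Sum>\<zeta> | c \<zeta> \<noteq> 0. c \<zeta>)"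

definition hom_below :: "'v::real_vector regularity_structure \<Rightarrow> real \<Rightarrow> real set"
  where "hom_below RS \<gamma> = hom_set RS \<inter> {..<\<gamma>}"

definition hspace_below :: "'v::real_vector regularity_structure \<Rightarrow> real \<Rightarrow> 'v set"
  where "hspace_below RS \<gamma> = span (\<Union>\<beta>\<in>hom_below RS \<gamma>. hspace RS \<beta>)"

definition is_regularity_structure :: "'v::real_vector regularity_structure \<Rightarrow> bool"
  where "is_regularity_structure RS \<longleftrightarrow>
    bdd_below (hom_set RS) \<and> (\<forall>a b. finite (hom_set RS \<inter> {a..b})) \<and>
    (\<forall>\<zeta>\<in>hom_set RS. banach_subspace (hspace RS \<zeta>) (hnorm RS \<zeta>)) \<and>
    (\<forall>\<tau>. \<exists>!c. decomposition RS \<tau> c) \<and>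
    (\<forall>g\<in>structure_group RS. linear g) \<and>
    id \<in> structure_group RS \<and>
    (\<forall>g\<in>structure_group RS. \<forall>h\<in>structure_group RS. g \<circ> h \<in> structure_group RS) \<and>
    (\<forall>g\<in>structure_group RS. \<exists>h\<in>structure_group RS. g \<circ> h = id \<and> h \<circ> g = id) \<and>
    (\<forall>g\<in>structure_group RS. \<forall>\<zeta>\<in>hom_set RS. \<forall>\<tau>\<in>hspace RS \<zeta>.
       g \<tau> - \<tau> \<in> hspace_below RS \<zeta>)"

definition proj :: "'v::real_vector regularity_structure \<Rightarrow> real \<Rightarrow> 'v \<Rightarrow> 'v"
  where "proj RS \<zeta> \<tau> = (THE c. decomposition RS \<tau> c) \<zeta>"

definition comp_norm :: "'v::real_vector regularity_structure \<Rightarrow> real \<Rightarrow> 'v \<Rightarrow> real"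
  where "comp_norm RS \<zeta> \<tau> = hnorm RS \<zeta> (proj RS \<zeta> \<tau>)"

definition proj_below :: "'v::real_vector regularity_structure \<Rightarrow> real \<Rightarrow> 'v \<Rightarrow> 'v"
  where "proj_below RS \<gamma> \<tau> = (\<Sum>\<zeta>\<in>hom_below RS \<gamma>. proj RS \<zeta> \<tau>)"


section \<open>Models\<close>

record ('d, 'v) model =
  model_Pi :: "real^'d \<Rightarrow> 'v \<Rightarrow> (real^'d \<Rightarrow> real) \<Rightarrow> real"
  model_Gamma :: "real^'d \<Rightarrow> real^'d \<Rightarrow> 'v \<Rightarrow> 'v"

text \<open>
  The infimum below is the minimum of \<open>hom_set RS\<close>, which is bounded below and locally finite
  but possibly infinite.
\<close>

definition test_regularity :: "'v::real_vector regularity_structure \<Rightarrow> real \<Rightarrow> nat"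
  where "test_regularity RS \<gamma> =
    (LEAST R. 0 < R \<and> max \<bar>Inf (hom_set RS)\<bar> \<bar>Max (hom_below RS \<gamma>)\<bar> < real R)"

text \<open>
  A linear map from a direct sum of Banach spaces to distributions is continuous iff each of its
  restrictions to a summand is, and by the uniform boundedness principle the latter may be tested
  on one test function at a time; this is the third condition below.

  In the bound on \<open>\<Gamma>\<close> the point \<open>y = x\<close> is left out because \<open>0 powr 0 = 0\<close> in HOL. With
  \<open>0\<^sup>0 = 1\<close> the bound at \<open>y = x\<close> follows from \<open>\<Gamma>\<^sub>x\<^sub>x = 1\<close>.
\<close>

definition is_model ::
    "('d::finite \<Rightarrow> nat) \<Rightarrow> 'v::real_vector regularity_structure \<Rightarrow> ('d, 'v) model \<Rightarrow> bool"
  where "is_model s RS M \<longleftrightarrow>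
    (\<forall>x \<tau>. distribution (model_Pi M x \<tau>)) \<and>
    (\<forall>x \<phi>. test_function \<phi> \<longrightarrow> linear (\<lambda>\<tau>. model_Pi M x \<tau> \<phi>)) \<and>
    (\<forall>x \<phi>. test_function \<phi> \<longrightarrow>
       (\<forall>\<zeta>\<in>hom_set RS. \<exists>C. \<forall>\<tau>\<in>hspace RS \<zeta>. \<bar>model_Pi M x \<tau> \<phi>\<bar> \<le> C * hnorm RS \<zeta> \<tau>)) \<and>
    (\<forall>x y. model_Gamma M x y \<in> structure_group RS) \<and>
    (\<forall>x. model_Gamma M x x = id) \<and>
    (\<forall>x y z. model_Gamma M x z \<circ> model_Gamma M z y = model_Gamma M x y) \<and>
    (\<forall>x y \<tau> \<phi>. test_function \<phi> \<longrightarrow> model_Pi M y \<tau> \<phi> = model_Pi M x (model_Gamma M x y \<tau>) \<phi>) \<and>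
    (\<forall>\<gamma>>0. \<exists>C.
       (\<forall>x. \<forall>\<eta>\<in>test_ball s (test_regularity RS \<gamma>). \<forall>l\<in>{0<..1}.
          \<forall>\<zeta>\<in>hom_below RS \<gamma>. \<forall>\<tau>\<in>hspace RS \<zeta>.
            \<bar>model_Pi M x \<tau> (rescale s l x \<eta>)\<bar> \<le> C * hnorm RS \<zeta> \<tau> * l powr \<zeta>) \<and>
       (\<forall>x. \<forall>y\<in>scaled_ball s x 1 - {x}.
          \<forall>\<zeta>\<in>hom_below RS \<gamma>. \<forall>\<tau>\<in>hspace RS \<zeta>. \<forall>\<beta>\<in>hom_set RS. \<beta> \<le> \<zeta> \<longrightarrow>
            comp_norm RS \<beta> (model_Gamma M x y \<tau>)
              \<le> C * hnorm RS \<zeta> \<tau> * scaled_norm s (x - y) powr (\<zeta> - \<beta>)))"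


section \<open>Spaces of modelled distributions\<close>

definition enn_powr :: "ennreal \<Rightarrow> real \<Rightarrow> ennreal"
  where "enn_powr x a = (if x = \<infinity> then \<infinity> else ennreal (enn2real x powr a))"

text \<open>
  For \<open>p = \<infinity>\<close> this is the essential supremum. In \<open>F_norm\<close> below it is the supremum over
  \<open>0 < l \<le> 1\<close>, because the function of \<open>l\<close> to which \<open>Lp_norm log_measure\<close> is applied is
  left-continuous.
\<close>

definition Lp_norm :: "'a measure \<Rightarrow> ennreal \<Rightarrow> ('a \<Rightarrow> ennreal) \<Rightarrow> ennreal"
  where "Lp_norm M p g =
    (if p = \<infinity> then esssup M g
     else enn_powr (\<integral>\<^sup>+x. enn_powr (g x) (enn2real p) \<partial>M) (1 / enn2real p))"

definition log_measure :: "real measure"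
  where "log_measure = density (lebesgue_on {0<..1}) (\<lambda>l. ennreal (1 / l))"

definition scaled_measure :: "('d::finite \<Rightarrow> nat) \<Rightarrow> (real^'d) measure"
  where "scaled_measure s =
    density (lebesgue_on (scaled_ball s 0 1)) (\<lambda>h. ennreal (1 / scaled_norm s h ^ scaling_size s))"

text \<open>
  The norms of modelled distributions presuppose measurability. As the spaces \<open>hspace RS \<zeta>\<close> need
  not be separable, this is Bochner measurability of each component, with respect to its own norm.
\<close>

definition strongly_measurable ::
    "'v::real_vector regularity_structure \<Rightarrow> real \<Rightarrow> (real^'d::finite \<Rightarrow> 'v) \<Rightarrow> bool"
  where "strongly_measurable RS \<gamma> f \<longleftrightarrow>
    (\<forall>\<zeta>\<in>hom_below RS \<gamma>. \<exists>u::nat \<Rightarrow> real^'d \<Rightarrow> 'v.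
       (\<forall>n. simple_function lebesgue (u n) \<and> range (u n) \<subseteq> hspace RS \<zeta>) \<and>
       (AE x in lebesgue. (\<lambda>n. hnorm RS \<zeta> (u n x - proj RS \<zeta> (f x))) \<longlonglongrightarrow> 0))"

definition increment ::
    "'v::real_vector regularity_structure \<Rightarrow> ('d::finite, 'v) model \<Rightarrow> real \<Rightarrow>
     (real^'d \<Rightarrow> 'v) \<Rightarrow> real^'d \<Rightarrow> real^'d \<Rightarrow> real"
  where "increment RS M \<zeta> f x h = comp_norm RS \<zeta> (f (x + h) - model_Gamma M (x + h) x (f x))"

definition F_norm ::
    "('d::finite \<Rightarrow> nat) \<Rightarrow> 'v::real_vector regularity_structure \<Rightarrow> ('d, 'v) model \<Rightarrow>
     real \<Rightarrow> real \<Rightarrow> ennreal \<Rightarrow> (real^'d \<Rightarrow> 'v) \<Rightarrow> ennreal"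
  where "F_norm s RS M \<gamma> p q f =
    (SUP \<zeta>\<in>hom_below RS \<gamma>. Lp_norm lebesgue (ennreal p) (\<lambda>x. ennreal (comp_norm RS \<zeta> (f x)))) +
    (SUP \<zeta>\<in>hom_below RS \<gamma>. Lp_norm lebesgue (ennreal p) (\<lambda>x. Lp_norm log_measure q (\<lambda>l.
       (\<integral>\<^sup>+h\<in>scaled_ball s 0 (4 * l). ennreal (increment RS M \<zeta> f x h / l powr (\<gamma> - \<zeta>)) \<partial>lebesgue)
         / emeasure lebesgue (scaled_ball s (0::real^'d) (4 * l)))))"

definition B_norm ::
    "('d::finite \<Rightarrow> nat) \<Rightarrow> 'v::real_vector regularity_structure \<Rightarrow> ('d, 'v) model \<Rightarrow>
     real \<Rightarrow> ennreal \<Rightarrow> ennreal \<Rightarrow> (real^'d \<Rightarrow> 'v) \<Rightarrow> ennreal"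
  where "B_norm s RS M \<gamma> p q f =
    (SUP \<zeta>\<in>hom_below RS \<gamma>. Lp_norm lebesgue p (\<lambda>x. ennreal (comp_norm RS \<zeta> (f x)))) +
    (SUP \<zeta>\<in>hom_below RS \<gamma>. Lp_norm (scaled_measure s) q (\<lambda>h. Lp_norm lebesgue p (\<lambda>x.
       ennreal (increment RS M \<zeta> f x h / scaled_norm s h powr (\<gamma> - \<zeta>)))))"

text \<open>
  The spaces consist of functions, not of classes modulo almost everywhere equality, so the norms
  are only seminorms on them. The truncation to lower order is linear, hence an embedding estimate
  for it passes to the quotients.
\<close>

definition F_space ::
    "('d::finite \<Rightarrow> nat) \<Rightarrow> 'v::real_vector regularity_structure \<Rightarrow> ('d, 'v) model \<Rightarrow>
     real \<Rightarrow> real \<Rightarrow> ennreal \<Rightarrow> (real^'d \<Rightarrow> 'v) set"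
  where "F_space s RS M \<gamma> p q =
    {f. (\<forall>x. f x \<in> hspace_below RS \<gamma>) \<and> strongly_measurable RS \<gamma> f \<and> F_norm s RS M \<gamma> p q f < \<infinity>}"

definition B_space ::
    "('d::finite \<Rightarrow> nat) \<Rightarrow> 'v::real_vector regularity_structure \<Rightarrow> ('d, 'v) model \<Rightarrow>
     real \<Rightarrow> ennreal \<Rightarrow> ennreal \<Rightarrow> (real^'d \<Rightarrow> 'v) set"
  where "B_space s RS M \<gamma> p q =
    {f. (\<forall>x. f x \<in> hspace_below RS \<gamma>) \<and> strongly_measurable RS \<gamma> f \<and> B_norm s RS M \<gamma> p q f < \<infinity>}"

definition continuous_embedding ::
    "('f \<Rightarrow> 'g) \<Rightarrow> 'f set \<Rightarrow> ('f \<Rightarrow> ennreal) \<Rightarrow> 'g set \<Rightarrow> ('g \<Rightarrow> ennreal) \<Rightarrow> bool"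
  where "continuous_embedding J X NX Y NY \<longleftrightarrow>
    (\<exists>C::real. \<forall>f\<in>X. J f \<in> Y \<and> NY (J f) \<le> ennreal C * NX f)"

end

theory Submission
  imports Defs
begin

text \<open>
  The three embeddings rest on one pointwise estimate. Let \<open>f\<close> be a modelled distribution of
  order \<open>\<gamma>'\<close> in the Triebel-Lizorkin scale with integrability \<open>p'\<close>. Suppose
  first that \<open>p' < p\<close> and \<open>\<gamma> < \<gamma>' - |s| (1/p' - 1/p)\<close>, choose
  \<open>\<gamma>\<^sub>1\<close> strictly in between such that no homogeneity lies in \<open>[\<gamma>,
  \<gamma>\<^sub>1]\<close>, and write \<open>g\<close> for the truncation of \<open>f\<close> to order
  \<open>\<gamma>\<close>, which is also the one to order \<open>\<gamma>\<^sub>1\<close>. Then there is a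
  function \<open>H\<close> in \<open>L\<^sup>p\<close> with norm controlled by the norm of \<open>f\<close>
  such that, for almost all \<open>x\<close> and \<open>x + h\<close>,

    \<open>|g (x + h) - \<Gamma>\<^sub>x\<^sub>+\<^sub>h\<^sub>,\<^sub>x g x|\<^sub>\<zeta> \<le> \<parallel>h\<parallel> powr (\<gamma>\<^sub>1 - \<zeta>) (H x + H (x + h))\<close>  and  \<open>|g x|\<^sub>\<zeta> \<le> H x\<close>

  (\<open>F_space_hajlasz\<close>). As \<open>\<gamma>\<^sub>1 > \<gamma>\<close>, this leaves a positive
  power of the scale to spare, and both Sobolev embeddings follow by integration: for the Besov norm take the
  \<open>L\<^sup>p\<close> norm in \<open>x\<close> and integrate the surplus power over \<open>h\<close>
  (\<open>embedding_sobolev_B\<close>); for the Triebel-Lizorkin norm average over \<open>h\<close>, dominate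
  the averages of \<open>H\<close> at all scales by another function in \<open>L\<^sup>p\<close>, and use the
  surplus power to integrate over the scale with an arbitrary exponent (\<open>embedding_sobolev_F\<close>).

  The estimate is obtained as follows. Whatever the exponent \<open>q\<close>, the norm over the scale
  variable dominates the supremum over dyadic scales (\<open>osc_le_Lp_density\<close>); hence the sharp
  function \<open>D\<close>, the supremum over dyadic scales of normalised averaged increments of
  \<open>f\<close>, plus the size of \<open>f\<close>, is in \<open>L\<^bsup>p'\<^esup>\<close>. Comparing
  with an intermediate point and averaging over it bounds the increment between any two points by the sum of
  the values of \<open>D\<close> there (\<open>pointwise_increment_le_sharp\<close>). These values are only in
  \<open>L\<^bsup>p'\<^esup>\<close>, but near any \<open>x\<close>, at distance at most
  \<open>2\<^bsup>-m\<^esup>\<close>, there are points \<open>x\<^sub>m\<close> where \<open>D\<close> is no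
  larger than its \<open>L\<^bsup>p'\<^esup>\<close> average, and these averages at scale
  \<open>2\<^bsup>-m\<^esup>\<close> are bounded by \<open>2 powr (m (\<gamma>' - \<gamma>\<^sub>1)) H
  x\<close> with \<open>H\<close> in \<open>L\<^sup>p\<close>, because averaging on that scale from
  \<open>L\<^bsup>p'\<^esup>\<close> to \<open>L\<^sup>p\<close> costs only \<open>2 powr (m |s| (1/p' -
  1/p))\<close> (\<open>dyadic_average_majorant\<close>). Chaining along \<open>x\<^sub>1, x\<^sub>2,
  \<dots>\<close> therefore recovers \<open>g x\<close> with the rate of order \<open>\<gamma>\<^sub>1\<close>
  (\<open>chain_approximation\<close>), and comparing the chains at two points gives the estimate
  (\<open>hajlasz_estimate\<close>). The bookkeeping of homogeneities is done by norms in which component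
  \<open>\<beta>\<close> has weight \<open>l powr \<beta>\<close>; in them transports over distances up to
  \<open>l\<close> are uniformly bounded (\<open>wnorm_Gamma\<close>).

  The first embedding is more direct, as the integrability stays the same. Truncation adds to the increment at
  scale \<open>l\<close> only the transport of the removed components, which is of higher order in
  \<open>l\<close> (\<open>truncation_increment_le\<close>), and lowering the order gains a positive power of
  \<open>l\<close>, which pays for the smaller exponent in the scale variable
  (\<open>embedding_smaller_q\<close>).
\<close>

section \<open>Integrals and norms of functions with values in the extended half-line\<close>

lemma enn_powr_ennreal [simp]: "0 \<le> x \<Longrightarrow> enn_powr (ennreal x) a = ennreal (x powr a)"
  by (simp add: enn_powr_def)

lemma enn_powr_top [simp]: "enn_powr \<infinity> a = \<infinity>" "enn_powr top a = \<infinity>"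
  by (simp_all add: enn_powr_def)

lemma enn_powr_0 [simp]: "enn_powr 0 a = 0"
  by (simp add: enn_powr_def)

lemma enn_powr_1 [simp]: "enn_powr x 1 = x"
  by (cases x) auto

lemma enn_powr_mono: "0 \<le> a \<Longrightarrow> x \<le> y \<Longrightarrow> enn_powr x a \<le> enn_powr y a"
  by (cases x; cases y) (auto intro!: ennreal_leI powr_mono2 simp: top_unique)

lemma measurable_enn_powr [measurable]:
  "f \<in> borel_measurable M \<Longrightarrow> (\<lambda>x. enn_powr (f x) a) \<in> borel_measurable M"
proof -
  assume [measurable]: "f \<in> borel_measurable M"
  have "{x \<in> space M. f x = \<infinity>} = f -` {\<infinity>} \<inter> space M" by auto
  then have [measurable]: "{x \<in> space M. f x = \<infinity>} \<in> sets M" by simp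
  have [measurable]: "(\<lambda>x. enn2real (f x) powr a) \<in> borel_measurable M"
    by (rule powr_real_measurable) auto
  show ?thesis unfolding enn_powr_def by (rule measurable_If) auto
qed

lemma enn_powr_mult:
  assumes "0 < a" shows "enn_powr (x * y) a = enn_powr x a * enn_powr y a"
proof (cases "x = top \<or> y = top")
  case True
  then show ?thesis
    using assms by (cases x; cases y) (auto simp: enn_powr_def ennreal_top_mult ennreal_mult_top)
next
  case False
  then obtain u v where "x = ennreal u" "y = ennreal v" "0 \<le> u" "0 \<le> v"
    by (cases x; cases y) auto
  then show ?thesis
    by (simp add: ennreal_mult'[symmetric] powr_mult)
qed

lemma enn_powr_powr: "enn_powr (enn_powr x a) b = enn_powr x (a * b)"
  by (cases x) (auto simp: powr_powr)

lemma enn_powr_le_iff: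
  assumes "0 < a" shows "enn_powr x a \<le> y \<longleftrightarrow> x \<le> enn_powr y (1 / a)"
proof
  assume "enn_powr x a \<le> y"
  from enn_powr_mono[OF _ this, of "1 / a"] show "x \<le> enn_powr y (1 / a)"
    using assms by (simp add: enn_powr_powr)
next
  assume "x \<le> enn_powr y (1 / a)"
  from enn_powr_mono[OF _ this, of a] show "enn_powr x a \<le> y"
    using assms by (simp add: enn_powr_powr)
qed

lemma enn_powr_add_le:
  assumes "0 \<le> a"
  shows "enn_powr (x + y) a \<le> ennreal (2 powr a) * (enn_powr x a + enn_powr y a)"
proof -
  have *: "enn_powr (x + y) a \<le> ennreal (2 powr a) * enn_powr y a" if "x \<le> y" for x y
  proof (cases y)
    case (real v)
    with that obtain u where u: "x = ennreal u" "0 \<le> u" "u \<le> v"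
      by (cases x) (auto simp: top_unique)
    have "(u + v) powr a \<le> (2 * v) powr a"
      using u real assms by (intro powr_mono2) auto
    with u real show ?thesis
      by (simp add: ennreal_plus[symmetric] ennreal_mult'[symmetric] powr_mult del: ennreal_plus)
  next
    case top
    then show ?thesis by (simp add: ennreal_mult_top)
  qed
  show ?thesis
  proof (cases "x \<le> y")
    case True
    from *[OF this] show ?thesis
      by (rule order_trans) (auto intro!: mult_left_mono)
  next
    case False
    then have "y \<le> x" by simp
    from *[OF this] have "enn_powr (x + y) a \<le> ennreal (2 powr a) * enn_powr x a"
      by (simp add: add.commute)
    then show ?thesis
      by (rule order_trans) (auto intro!: mult_left_mono)
  qed
qed

text \<open>
  The inner norms of \<open>F_norm\<close> are integrated over the base point without being known to be
  measurable in it, so that \<open>nn_integral\<close> is a lower integral, the supremum over simple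
  minorants. It is homogeneous because multiplication by \<open>c\<close> maps the minorants of
  \<open>f\<close> onto those of \<open>c f\<close>.
\<close>

lemma nn_integral_cmult_real:
  fixes c :: real
  assumes "0 < c"
  shows "(\<integral>\<^sup>+x. ennreal c * f x \<partial>M) = ennreal c * (\<integral>\<^sup>+x. f x \<partial>M)"
proof -
  have *: "ennreal c * (\<integral>\<^sup>+x. f x \<partial>M) \<le> (\<integral>\<^sup>+x. ennreal c * f x \<partial>M)" if "0 < c" for c :: real and f
  proof -
    have "ennreal c * (\<integral>\<^sup>+x. f x \<partial>M) = (SUP g\<in>{g. simple_function M g \<and> g \<le> f}. ennreal c * integral\<^sup>S M g)"
      unfolding nn_integral_def by (rule SUP_mult_left_ennreal)
    also have "\<dots> \<le> (\<integral>\<^sup>+x. ennreal c * f x \<partial>M)"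
    proof (safe intro!: SUP_least)
      fix g assume g: "simple_function M g" "g \<le> f"
      have "ennreal c * integral\<^sup>S M g = (\<integral>\<^sup>+x. ennreal c * g x \<partial>M)"
        using g by (simp add: nn_integral_eq_simple_integral nn_integral_cmult borel_measurable_simple_function)
      also have "\<dots> \<le> (\<integral>\<^sup>+x. ennreal c * f x \<partial>M)"
        using g by (intro nn_integral_mono mult_left_mono) (auto simp: le_fun_def)
      finally show "ennreal c * integral\<^sup>S M g \<le> (\<integral>\<^sup>+x. ennreal c * f x \<partial>M)" .
    qed
    finally show ?thesis .
  qed
  have "(\<integral>\<^sup>+x. ennreal c * f x \<partial>M) = ennreal c * (ennreal (1 / c) * (\<integral>\<^sup>+x. ennreal c * f x \<partial>M))"
    using assms by (simp add: mult.assoc[symmetric] ennreal_mult'[symmetric])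
  also have "\<dots> \<le> ennreal c * (\<integral>\<^sup>+x. ennreal (1 / c) * (ennreal c * f x) \<partial>M)"
    using assms by (intro mult_left_mono *) auto
  also have "\<dots> = ennreal c * (\<integral>\<^sup>+x. f x \<partial>M)"
    using assms by (simp add: mult.assoc[symmetric] ennreal_mult'[symmetric])
  finally show ?thesis
    using *[OF assms] by (intro antisym)
qed

text \<open>
  Lower integrals are in general superadditive only. If one summand is measurable, then a finite simple
  minorant \<open>h\<close> of \<open>f + g\<close> splits into \<open>h - g\<close>, a measurable minorant of
  \<open>f\<close>, and \<open>g\<close>. All triangle inequalities below are arranged so that one side is
  measurable.
\<close>

lemma nn_integral_add_le:
  assumes [measurable]: "g \<in> borel_measurable M"
  shows "(\<integral>\<^sup>+x. f x + g x \<partial>M) \<le> (\<integral>\<^sup>+x. f x \<partial>M) + (\<integral>\<^sup>+x. g x \<partial>M)"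
  unfolding nn_integral_def_finite[of M "\<lambda>x. f x + g x"]
proof (safe intro!: SUP_least)
  fix h assume h: "simple_function M h" "h \<le> (\<lambda>x. f x + g x)" "\<forall>x. h x < top"
  have [measurable]: "h \<in> borel_measurable M"
    using h(1) by (rule borel_measurable_simple_function)
  have "integral\<^sup>S M h = (\<integral>\<^sup>+x. h x \<partial>M)"
    using h(1) by (rule nn_integral_eq_simple_integral[symmetric])
  also have "\<dots> \<le> (\<integral>\<^sup>+x. (h x - g x) + g x \<partial>M)"
  proof (intro nn_integral_mono)
    fix x show "h x \<le> (h x - g x) + g x"
      by (cases "g x \<le> h x") (auto simp: diff_add_cancel_ennreal not_le intro: add_increasing order.strict_implies_order)
  qed
  also have "\<dots> = (\<integral>\<^sup>+x. h x - g x \<partial>M) + (\<integral>\<^sup>+x. g x \<partial>M)"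
    by (intro nn_integral_add) auto
  also have "\<dots> \<le> (\<integral>\<^sup>+x. f x \<partial>M) + (\<integral>\<^sup>+x. g x \<partial>M)"
  proof (intro add_right_mono nn_integral_mono)
    fix x show "h x - g x \<le> f x"
    proof -
      have "h x \<le> f x + g x" "h x < top" using h(2,3) by (auto simp: le_fun_def)
      then show ?thesis
        by (cases "f x"; cases "g x"; cases "h x")
           (simp_all add: ennreal_minus ennreal_plus[symmetric] ennreal_minus_top del: ennreal_plus)
    qed
  qed
  finally show "integral\<^sup>S M h \<le> (\<integral>\<^sup>+x. f x \<partial>M) + (\<integral>\<^sup>+x. g x \<partial>M)" .
qed

lemma Lp_norm_real:
  "0 \<le> p \<Longrightarrow> Lp_norm M (ennreal p) g = enn_powr (\<integral>\<^sup>+x. enn_powr (g x) p \<partial>M) (1 / p)"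
  by (simp add: Lp_norm_def)

lemma Lp_norm_top [simp]: "Lp_norm M top g = esssup M g"
  by (simp add: Lp_norm_def)

lemma Lp_norm_powr:
  "0 < p \<Longrightarrow> enn_powr (Lp_norm M (ennreal p) g) p = (\<integral>\<^sup>+x. enn_powr (g x) p \<partial>M)"
  by (simp add: Lp_norm_real enn_powr_powr)

lemma Lp_norm_mono_AE:
  assumes "AE x in M. f x \<le> g x" "0 \<le> p"
  shows "Lp_norm M (ennreal p) f \<le> Lp_norm M (ennreal p) g"
  using assms(1) unfolding Lp_norm_real[OF assms(2)]
  by (intro enn_powr_mono nn_integral_mono_AE) (use assms(2) in \<open>auto elim!: eventually_mono intro: enn_powr_mono\<close>)

lemma Lp_norm_cmult:
  fixes c :: real
  assumes "0 < c" "0 < p"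
  shows "Lp_norm M (ennreal p) (\<lambda>x. ennreal c * f x) = ennreal c * Lp_norm M (ennreal p) f"
proof -
  have "(\<integral>\<^sup>+x. enn_powr (ennreal c * f x) p \<partial>M) = ennreal (c powr p) * (\<integral>\<^sup>+x. enn_powr (f x) p \<partial>M)"
    using assms by (simp add: enn_powr_mult nn_integral_cmult_real)
  then show ?thesis
    using assms by (simp add: Lp_norm_real enn_powr_mult powr_powr)
qed

text \<open>
  The triangle inequality up to the constant 4, which comes from \<open>(a + b)\<^sup>p \<le> 2\<^sup>p
  (a\<^sup>p + b\<^sup>p)\<close> for the exponents \<open>p\<close> and \<open>1 / p\<close>. This form only
  uses additivity of integrals with one measurable summand.
\<close>

lemma Lp_norm_add_le:
  assumes [measurable]: "g \<in> borel_measurable M" and p: "1 \<le> p"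
  shows "Lp_norm M (ennreal p) (\<lambda>x. f x + g x)
           \<le> 4 * (Lp_norm M (ennreal p) f + Lp_norm M (ennreal p) g)"
proof -
  let ?F = "\<integral>\<^sup>+x. enn_powr (f x) p \<partial>M" and ?G = "\<integral>\<^sup>+x. enn_powr (g x) p \<partial>M"
  have "(\<integral>\<^sup>+x. enn_powr (f x + g x) p \<partial>M)
          \<le> (\<integral>\<^sup>+x. ennreal (2 powr p) * (enn_powr (f x) p + enn_powr (g x) p) \<partial>M)"
    using p by (intro nn_integral_mono enn_powr_add_le) auto
  also have "\<dots> \<le> ennreal (2 powr p) * (?F + ?G)"
    by (subst nn_integral_cmult_real) (auto intro!: mult_left_mono nn_integral_add_le)
  finally have "Lp_norm M (ennreal p) (\<lambda>x. f x + g x) \<le> enn_powr (ennreal (2 powr p) * (?F + ?G)) (1 / p)"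
    using p by (simp add: Lp_norm_real enn_powr_mono)
  also have "\<dots> = 2 * enn_powr (?F + ?G) (1 / p)"
    using p by (simp add: enn_powr_mult powr_powr)
  also have "\<dots> \<le> 2 * (ennreal (2 powr (1 / p)) * (enn_powr ?F (1 / p) + enn_powr ?G (1 / p)))"
    using p by (intro mult_left_mono enn_powr_add_le) auto
  also have "\<dots> \<le> 2 * (2 * (enn_powr ?F (1 / p) + enn_powr ?G (1 / p)))"
  proof (intro mult_left_mono mult_right_mono)
    have "2 powr (1 / p) \<le> 2 powr (1::real)"
      using p by (intro powr_mono) auto
    then show "ennreal (2 powr (1 / p)) \<le> 2"
      by (simp add: ennreal_leI flip: ennreal_numeral)
  qed auto
  also have "\<dots> = 4 * (enn_powr ?F (1 / p) + enn_powr ?G (1 / p))"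
    by (simp only: mult.assoc[symmetric]) simp
  finally show ?thesis
    using p by (simp add: Lp_norm_real)
qed

lemma Lp_norm_sum_le:
  assumes "finite I" "1 \<le> p" "\<And>i. i \<in> I \<Longrightarrow> g i \<in> borel_measurable M"
  shows "Lp_norm M (ennreal p) (\<lambda>x. \<Sum>i\<in>I. g i x) \<le> 4 ^ card I * (\<Sum>i\<in>I. Lp_norm M (ennreal p) (g i))"
  using assms(1,3)
proof (induction I rule: finite_induct)
  case empty
  then show ?case using assms(2) by (simp add: Lp_norm_real)
next
  case (insert i I)
  have "Lp_norm M (ennreal p) (\<lambda>x. \<Sum>i\<in>insert i I. g i x) = Lp_norm M (ennreal p) (\<lambda>x. g i x + (\<Sum>i\<in>I. g i x))"
    using insert by simp
  also have "\<dots> \<le> 4 * (Lp_norm M (ennreal p) (g i) + Lp_norm M (ennreal p) (\<lambda>x. \<Sum>i\<in>I. g i x))"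
    using insert assms(2) by (intro Lp_norm_add_le borel_measurable_sum) auto
  also have "\<dots> \<le> 4 * (4 ^ card I * Lp_norm M (ennreal p) (g i) + 4 ^ card I * (\<Sum>i\<in>I. Lp_norm M (ennreal p) (g i)))"
  proof (intro mult_left_mono add_mono)
    have "1 * Lp_norm M (ennreal p) (g i) \<le> 4 ^ card I * Lp_norm M (ennreal p) (g i)"
      by (rule mult_right_mono) (rule one_le_power, simp_all)
    then show "Lp_norm M (ennreal p) (g i) \<le> 4 ^ card I * Lp_norm M (ennreal p) (g i)" by simp
  qed (use insert in auto)
  also have "\<dots> = 4 ^ card (insert i I) * (\<Sum>i\<in>insert i I. Lp_norm M (ennreal p) (g i))"
    using insert(1,2) by (simp add: distrib_left mult.assoc)
  finally show ?case .
qed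

text \<open>
  The constant 1/2 serves all exponents at once, since \<open>(1/2) powr (1/q) \<ge> 1/2\<close> for \<open>q
  \<ge> 1\<close>.
\<close>

lemma Lp_norm_ge_on_set:
  assumes A: "A \<in> sets M" "1 / 2 \<le> emeasure M A" and q: "1 \<le> q"
    and ge: "\<And>x. x \<in> A \<Longrightarrow> c \<le> g x"
  shows "ennreal (1 / 2) * c \<le> Lp_norm M q g"
proof (cases "q = \<infinity>")
  case True
  have "c \<le> esssup M g"
  proof (rule ccontr)
    assume "\<not> c \<le> esssup M g"
    then have "A \<subseteq> {x \<in> space M. g x > esssup M g}"
      using ge sets.sets_into_space[OF A(1)] by fastforce
    moreover have "{x \<in> space M. g x > esssup M g} \<in> sets M"
    proof (cases "g \<in> borel_measurable M")
      case False
      then show ?thesis by (simp add: esssup_non_measurable)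
    qed auto
    ultimately have "emeasure M A \<le> emeasure M {x \<in> space M. g x > esssup M g}"
      by (rule emeasure_mono)
    also have "\<dots> = 0" by (rule esssup_zero_measure)
    finally show False using A(2) by (simp add: ennreal_divide_eq_0_iff)
  qed
  moreover have "ennreal (1 / 2) * c \<le> ennreal 1 * c"
    by (intro mult_right_mono ennreal_leI) simp_all
  ultimately show ?thesis using True by (auto simp add: Lp_norm_def elim: order_trans)
next
  case False
  then obtain r where r: "q = ennreal r" "0 \<le> r" by (cases q) auto
  with q have r1: "1 \<le> r" by simp
  have "enn_powr c r * ennreal (1 / 2) \<le> enn_powr c r * emeasure M A"
  proof (intro mult_left_mono)
    show "ennreal (1 / 2) \<le> emeasure M A" 
      using A(2) by (simp add: divide_ennreal[of 1 2, simplified, symmetric])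
  qed auto
  also have "\<dots> = (\<integral>\<^sup>+x. enn_powr c r * indicator A x \<partial>M)"
    using A by (simp add: nn_integral_cmult_indicator)
  also have "\<dots> \<le> (\<integral>\<^sup>+x. enn_powr (g x) r \<partial>M)"
    using ge r1 by (intro nn_integral_mono) (auto simp: indicator_def intro!: enn_powr_mono)
  finally have "enn_powr (enn_powr c r * ennreal (1 / 2)) (1 / r) \<le> Lp_norm M q g"
    using r r1 by (simp add: Lp_norm_real enn_powr_mono)
  moreover have "enn_powr (enn_powr c r * ennreal (1 / 2)) (1 / r) = c * ennreal ((1 / 2) powr (1 / r))"
  proof -
    have r: "0 < 1 / r" "r * (1 / r) = 1" and half: "0 \<le> (1 / 2 :: real)" using r1 by auto
    show ?thesis
      unfolding enn_powr_mult[OF r(1)] enn_powr_powr r(2) enn_powr_1 enn_powr_ennreal[OF half] ..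
  qed
  moreover have "c * ennreal (1 / 2) \<le> c * ennreal ((1 / 2) powr (1 / r))"
  proof (intro mult_left_mono ennreal_leI)
    have "(1 / 2) powr 1 \<le> (1 / 2 :: real) powr (1 / r)"
      using r1 by (intro powr_mono') auto
    then show "1 / 2 \<le> (1 / 2 :: real) powr (1 / r)" by simp
  qed simp
  ultimately show ?thesis
    by (simp only: mult.commute[of "ennreal (1 / 2)"] order_trans)
qed

text \<open>
  Hoelder's inequality for the weight \<open>w\<close>, up to a constant. It comes from the pointwise bound
  \<open>t powr a \<le> 1 + t powr b\<close>, applied to \<open>t = g / K powr (1 / b)\<close> where
  \<open>K\<close> is the integral on the right, by integration against \<open>w \<le> 1\<close>.
\<close>

lemma weighted_power_mean:
  fixes w :: "'a \<Rightarrow> real"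
  assumes [measurable]: "w \<in> borel_measurable M" and w: "\<And>x. x \<in> space M \<Longrightarrow> 0 \<le> w x \<and> w x \<le> 1"
    and m: "(\<integral>\<^sup>+x. ennreal (w x) \<partial>M) \<le> ennreal m" "0 \<le> m" and ab: "0 < a" "a < b"
  shows "(\<integral>\<^sup>+x. ennreal (w x) * enn_powr (g x) a \<partial>M)
           \<le> ennreal (m + 1) * enn_powr (\<integral>\<^sup>+x. enn_powr (g x) b \<partial>M) (a / b)"
proof -
  define I where "I = (\<integral>\<^sup>+x. enn_powr (g x) b \<partial>M)"
  have main: "(\<integral>\<^sup>+x. ennreal (w x) * enn_powr (g x) a \<partial>M) \<le> ennreal (m + 1) * ennreal (K powr (a / b))"
    if K: "0 < K" "I \<le> ennreal K" for K
  proof -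
    have pt: "ennreal (w x) * enn_powr (g x) a
        \<le> ennreal (K powr (a / b)) * (ennreal (1 / K) * enn_powr (g x) b + ennreal (w x))"
      if "x \<in> space M" for x
    proof (cases "g x")
      case (real u)
      have "u powr a \<le> K powr (a / b) * (1 / K * u powr b + 1)"
      proof (cases "u \<le> K powr (1 / b)")
        case True
        then have "u powr a \<le> (K powr (1 / b)) powr a"
          using real ab by (intro powr_mono2) auto
        also have "\<dots> = K powr (a / b)" by (simp add: powr_powr)
        also have "\<dots> * 1 \<le> K powr (a / b) * (1 / K * u powr b + 1)"
          using K by (intro mult_left_mono) auto
        finally show ?thesis by simp
      next
        case False
        then have u: "0 < u" "K powr (1 / b) \<le> u" using real K
          by (auto simp: not_le intro: le_less_trans[OF powr_ge_zero])
        have "K powr ((b - a) / b) = (K powr (1 / b)) powr (b - a)"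
          by (simp add: powr_powr)
        also have "\<dots> \<le> u powr (b - a)" using u ab by (intro powr_mono2) auto
        finally have "u powr a * K powr ((b - a) / b) \<le> u powr a * u powr (b - a)"
          by (intro mult_left_mono) auto
        also have "\<dots> = u powr b" by (simp add: powr_add[symmetric])
        finally have "u powr a * K powr (1 - a / b) \<le> u powr b"
          using ab by (simp add: diff_divide_distrib)
        then have "u powr a * (K / K powr (a / b)) \<le> u powr b"
          using K by (simp add: powr_diff)
        then have "u powr a \<le> K powr (a / b) * (1 / K * u powr b)"
          using K by (simp add: field_simps)
        also have "\<dots> \<le> K powr (a / b) * (1 / K * u powr b + 1)"
          by (intro mult_left_mono) auto
        finally show ?thesis .
      qed
      then have "w x * u powr a \<le> w x * (K powr (a / b) * (1 / K * u powr b + 1))"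
        using w[OF that] by (intro mult_left_mono) auto
      also have "\<dots> = K powr (a / b) * (w x * (1 / K * u powr b) + w x)"
        by (simp add: algebra_simps)
      also have "\<dots> \<le> K powr (a / b) * (1 * (1 / K * u powr b) + w x)"
        using w[OF that] K by (intro mult_left_mono add_right_mono mult_right_mono) auto
      finally show ?thesis
        using real w[OF that] K
        by (simp add: ennreal_mult'[symmetric] ennreal_plus[symmetric] ennreal_leI del: ennreal_plus)
    next
      case top
      with K show ?thesis by (simp add: ennreal_mult_top)
    qed
    have "(\<integral>\<^sup>+x. ennreal (w x) * enn_powr (g x) a \<partial>M)
        \<le> (\<integral>\<^sup>+x. ennreal (K powr (a / b)) * (ennreal (1 / K) * enn_powr (g x) b + ennreal (w x)) \<partial>M)"
      by (intro nn_integral_mono pt)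
    also have "\<dots> \<le> ennreal (K powr (a / b)) * ((\<integral>\<^sup>+x. ennreal (1 / K) * enn_powr (g x) b \<partial>M) + (\<integral>\<^sup>+x. ennreal (w x) \<partial>M))"
      using K by (subst nn_integral_cmult_real) (auto intro!: mult_left_mono nn_integral_add_le)
    also have "\<dots> \<le> ennreal (K powr (a / b)) * (ennreal (1 / K) * ennreal K + ennreal m)"
      using K m unfolding I_def
      by (subst nn_integral_cmult_real) (auto intro!: mult_left_mono add_mono)
    also have "\<dots> = ennreal (m + 1) * ennreal (K powr (a / b))"
      using K m by (simp add: ennreal_mult'[symmetric] mult.commute add.commute)
    finally show ?thesis .
  qed
  show ?thesis
  proof (cases I)
    case top
    then show ?thesis using m by (simp add: I_def ennreal_mult_top)
  next
    case (real K)
    show ?thesis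
    proof (cases "K = 0")
      case False
      then show ?thesis using main[of K] real by (simp add: I_def[symmetric])
    next
      case True
      have "(\<integral>\<^sup>+x. ennreal (w x) * enn_powr (g x) a \<partial>M) \<le> 0"
      \<comment> \<open>If the right-hand side vanishes, let the normalising constant tend to zero.\<close>
      proof (rule ennreal_le_epsilon)
        fix e :: real assume e: "0 < e"
        define K' where "K' = (e / (m + 1)) powr (b / a)"
        have K': "0 < K'" "K' powr (a / b) = e / (m + 1)"
          using e m ab by (auto simp: K'_def powr_powr)
        show "(\<integral>\<^sup>+x. ennreal (w x) * enn_powr (g x) a \<partial>M) \<le> 0 + ennreal e"
          using main[OF K'(1)] real True m e unfolding K'(2)
          by (simp add: ennreal_mult'[symmetric] del: ennreal_plus)
      qed
      then show ?thesis by simp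
    qed
  qed
qed

lemma Lp_norm_weighted_le:
  fixes w :: "'a \<Rightarrow> real"
  assumes [measurable]: "w \<in> borel_measurable M" and w: "\<And>x. x \<in> space M \<Longrightarrow> 0 \<le> w x \<and> w x \<le> 1"
    and m: "(\<integral>\<^sup>+x. ennreal (w x powr q) \<partial>M) \<le> ennreal m" "0 \<le> m" and q: "1 \<le> q" "ennreal q < q'"
  shows "Lp_norm M (ennreal q) (\<lambda>x. ennreal (w x) * g x) \<le> ennreal ((m + 1) powr (1 / q)) * Lp_norm M q' g"
proof -
  let ?I = "\<integral>\<^sup>+x. ennreal (w x powr q) * enn_powr (g x) q \<partial>M"
  have eq: "Lp_norm M (ennreal q) (\<lambda>x. ennreal (w x) * g x) = enn_powr ?I (1 / q)"
    using q w by (auto simp: Lp_norm_real enn_powr_mult intro!: arg_cong2[where f=enn_powr] nn_integral_cong)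
  show ?thesis
  proof (cases "q' = \<infinity>")
    case True
    show ?thesis
    proof (cases "esssup M g = \<infinity>")
      case True
      with \<open>q' = \<infinity>\<close> m show ?thesis by (simp add: Lp_norm_def ennreal_mult_top)
    next
      case False
      have "g \<in> borel_measurable M"
        using False by (metis esssup_non_measurable infinity_ennreal_def)
      from esssup_AE[of g M] have ae: "AE x in M. g x \<le> esssup M g" .
      have "?I \<le> (\<integral>\<^sup>+x. enn_powr (esssup M g) q * ennreal (w x powr q) \<partial>M)"
        using ae by (intro nn_integral_mono_AE) (use q in \<open>auto elim!: eventually_mono simp: mult.commute[of "ennreal _"] intro!: mult_right_mono enn_powr_mono\<close>)
      also have "\<dots> = enn_powr (esssup M g) q * (\<integral>\<^sup>+x. ennreal (w x powr q) \<partial>M)"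
        by (intro nn_integral_cmult) auto
      also have "\<dots> \<le> enn_powr (esssup M g) q * ennreal (m + 1)"
        using m by (intro mult_left_mono order_trans[OF m(1)] ennreal_leI) auto
      finally have "enn_powr ?I (1 / q) \<le> enn_powr (enn_powr (esssup M g) q * ennreal (m + 1)) (1 / q)"
        using q by (intro enn_powr_mono) auto
      then show ?thesis
        unfolding eq using q m \<open>q' = \<infinity>\<close>
        by (simp add: enn_powr_mult enn_powr_powr mult.commute del: ennreal_plus)
    qed
  next
    case False
    then obtain b where b: "q' = ennreal b" "0 \<le> b" by (cases q') auto
    with q have qb: "q < b" by (simp add: ennreal_less_iff)
    have w': "0 \<le> w x powr q \<and> w x powr q \<le> 1" if "x \<in> space M" for x
      using w[OF that] q by (auto intro!: powr_le1)
    have "?I \<le> ennreal (m + 1) * enn_powr (\<integral>\<^sup>+x. enn_powr (g x) b \<partial>M) (q / b)"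
      using m q qb by (intro weighted_power_mean w') auto
    then have "enn_powr ?I (1 / q) \<le> enn_powr (ennreal (m + 1) * enn_powr (\<integral>\<^sup>+x. enn_powr (g x) b \<partial>M) (q / b)) (1 / q)"
      using q by (intro enn_powr_mono) auto
    then show ?thesis
      unfolding eq using q m qb b
      by (simp add: enn_powr_mult enn_powr_powr Lp_norm_real[of b] del: ennreal_plus)
  qed
qed

section \<open>Scaled boxes and dyadic scales\<close>

lemma scaled_norm_le_iff:
  assumes "scaling s" "0 \<le> R"
  shows "scaled_norm s x \<le> R \<longleftrightarrow> (\<forall>i. \<bar>x $ i\<bar> \<le> R ^ s i)"
proof -
  have "root (s i) \<bar>x $ i\<bar> \<le> R \<longleftrightarrow> \<bar>x $ i\<bar> \<le> R ^ s i" for i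
    using assms real_root_le_iff[of "s i" "\<bar>x $ i\<bar>" "R ^ s i"]
    by (simp add: scaling_def real_root_power_cancel)
  then show ?thesis
    unfolding scaled_norm_def by simp
qed

lemma scaled_norm_nonneg [simp]: "0 \<le> scaled_norm s x"
proof -
  have "0 \<le> root (s i) \<bar>x $ i\<bar>" for i
    by (cases "s i = 0") (auto simp: real_root_ge_zero)
  then show ?thesis
    unfolding scaled_norm_def
    by (rule order_trans[OF _ Max_ge[of _ "root (s undefined) \<bar>x $ undefined\<bar>"]]) auto
qed

lemma scaled_norm_uminus [simp]: "scaled_norm s (- x) = scaled_norm s x"
  by (simp add: scaled_norm_def)

lemma scaled_norm_minus_commute: "scaled_norm s (x - y) = scaled_norm s (y - x)"
  using scaled_norm_uminus[of s "x - y"] by simp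

lemma scaled_norm_0 [simp]: "scaling s \<Longrightarrow> scaled_norm s 0 = 0"
  using scaled_norm_le_iff[of s 0 0] by (intro antisym) auto

lemma scaled_norm_eq_0_iff: "scaling s \<Longrightarrow> scaled_norm s x = 0 \<longleftrightarrow> x = 0"
  using scaled_norm_le_iff[of s 0 x] scaled_norm_nonneg[of s x]
  by (auto simp: scaling_def vec_eq_iff zero_power)

lemma scaled_norm_pos: "scaling s \<Longrightarrow> x \<noteq> 0 \<Longrightarrow> 0 < scaled_norm s x"
  using scaled_norm_eq_0_iff[of s x] scaled_norm_nonneg[of s x] by linarith

text \<open>
  Coordinatewise this is \<open>a\<^sup>k + b\<^sup>k \<le> (a + b)\<^sup>k\<close> for \<open>a, b \<ge>
  0\<close> and \<open>k \<ge> 1\<close>, so the scaled norm is subadditive although it is not homogeneous.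
\<close>

lemma scaled_norm_triangle:
  assumes "scaling s" shows "scaled_norm s (x + y) \<le> scaled_norm s x + scaled_norm s y"
proof -
  let ?a = "scaled_norm s x" and ?b = "scaled_norm s y"
  have "\<bar>(x + y) $ i\<bar> \<le> (?a + ?b) ^ s i" for i
  proof -
    have "\<bar>x $ i\<bar> \<le> ?a ^ s i" "\<bar>y $ i\<bar> \<le> ?b ^ s i"
      using scaled_norm_le_iff[OF assms, of ?a x] scaled_norm_le_iff[OF assms, of ?b y] by auto
    moreover have "?a ^ s i + ?b ^ s i \<le> (?a + ?b) ^ s i"
    proof -
      obtain k where k: "s i = Suc k"
        using assms by (metis scaling_def gr0_implies_Suc)
      have "?a ^ k * ?a + ?b ^ k * ?b \<le> (?a + ?b) ^ k * ?a + (?a + ?b) ^ k * ?b"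
        by (intro add_mono mult_right_mono power_mono) auto
      then show ?thesis by (simp add: k algebra_simps)
    qed
    ultimately show ?thesis by auto
  qed
  then show ?thesis
    using scaled_norm_le_iff[OF assms, of "?a + ?b"] by simp
qed

lemma mem_scaled_ball: "y \<in> scaled_ball s x R \<longleftrightarrow> scaled_norm s (y - x) \<le> R"
  by (simp add: scaled_ball_def)

lemma scaled_ball_eq_cbox:
  assumes "scaling s" "0 \<le> R"
  shows "scaled_ball s x R = cbox (x - (\<chi> i. R ^ s i)) (x + (\<chi> i. R ^ s i))"
  using scaled_norm_le_iff[OF assms]
  unfolding set_eq_iff mem_scaled_ball mem_box_cart
  by (simp add: abs_le_iff algebra_simps) (metis add.commute minus_le_iff)

lemma scaled_ball_empty: "R < 0 \<Longrightarrow> scaled_ball s x R = {}"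
  using order_trans[OF scaled_norm_nonneg[of s]] by (fastforce simp: scaled_ball_def)

lemma closed_scaled_ball:
  assumes "scaling s" shows "closed (scaled_ball s x R)"
  using scaled_ball_eq_cbox[OF assms, of R x] by (cases "0 \<le> R") (auto simp: scaled_ball_empty)

lemma borel_scaled_ball [measurable]: "scaling s \<Longrightarrow> scaled_ball s x R \<in> sets borel"
  by (intro borel_closed closed_scaled_ball)

lemma borel_measurable_scaled_norm:
  assumes "scaling s" shows "scaled_norm s \<in> borel_measurable borel"
  unfolding borel_measurable_iff_le
proof
  fix R
  have "{x \<in> space borel. scaled_norm s x \<le> R} = scaled_ball s 0 R"
    by (auto simp: mem_scaled_ball)
  then show "{x \<in> space borel. scaled_norm s x \<le> R} \<in> sets borel"
    using assms by simp
qed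

lemma emeasure_scaled_ball:
  fixes x :: "real^'d::finite"
  assumes "scaling s" "0 \<le> R"
  shows "emeasure lborel (scaled_ball s x R) = ennreal (2 ^ CARD('d) * R ^ scaling_size s)"
proof -
  let ?u = "x - (\<chi> i. R ^ s i)" and ?v = "x + (\<chi> i. R ^ s i)"
  have ne: "cbox ?u ?v \<noteq> {}"
    using assms(2) by (auto simp: interval_ne_empty_cart)
  have "measure lborel (cbox ?u ?v) = (\<Prod>i\<in>UNIV. 2 * R ^ s i)"
    by (simp add: content_cbox_cart[OF ne])
  also have "\<dots> = 2 ^ CARD('d) * R ^ scaling_size s"
    by (simp add: prod.distrib power_sum scaling_size_def)
  finally show ?thesis
    using emeasure_lborel_cbox_finite[of ?u ?v]
    by (simp add: scaled_ball_eq_cbox[OF assms] emeasure_eq_ennreal_measure)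
qed

lemma scaled_norm_tendsto_0:
  assumes "scaling s" "(f \<longlongrightarrow> 0) F"
  shows "((\<lambda>x. scaled_norm s (f x)) \<longlongrightarrow> 0) F"
proof (rule tendstoI)
  fix e :: real assume e: "0 < e"
  have "\<forall>\<^sub>F x in F. \<forall>i. dist (f x $ i) 0 < (e / 2) ^ s i"
  proof (intro eventually_all_finite)
    fix i
    have "((\<lambda>x. f x $ i) \<longlongrightarrow> 0) F"
      using tendsto_vec_nth[OF assms(2), of i] by simp
    then show "\<forall>\<^sub>F x in F. dist (f x $ i) 0 < (e / 2) ^ s i"
      using e by (intro tendstoD) auto
  qed
  then show "\<forall>\<^sub>F x in F. dist (scaled_norm s (f x)) 0 < e"
  proof eventually_elim
    case (elim x)
    then have "scaled_norm s (f x) \<le> e / 2"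
      using e assms(1) by (subst scaled_norm_le_iff) (auto intro: less_imp_le)
    then show ?case using e by simp
  qed
qed

lemma scaling_size_pos: "scaling (s :: 'd::finite \<Rightarrow> nat) \<Longrightarrow> 0 < scaling_size s"
  by (simp add: scaling_def scaling_size_def sum_pos)

lemma space_log_measure [simp]: "space log_measure = {0<..1}"
  by (simp add: log_measure_def)

lemma nn_integral_log_measure:
  assumes "f \<in> borel_measurable borel"
  shows "(\<integral>\<^sup>+l. f l \<partial>log_measure) = (\<integral>\<^sup>+l. ennreal (1 / l) * f l * indicator {0<..1} l \<partial>lborel)"
proof -
  have [measurable]: "f \<in> borel_measurable (lebesgue_on {0<..1})"
    using assms by (intro measurable_restrict_space1 measurable_completion) auto
  have [measurable]: "(\<lambda>l::real. ennreal (1 / l)) \<in> borel_measurable (lebesgue_on {0<..1})"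
    by (intro measurable_restrict_space1 measurable_completion) auto
  show ?thesis
    unfolding log_measure_def
    by (subst nn_integral_density) (auto simp: nn_integral_restrict_space nn_integral_completion)
qed

lemma nn_integral_log_measure_powr:
  assumes "0 < a"
  shows "(\<integral>\<^sup>+l. ennreal (l powr a) \<partial>log_measure) \<le> ennreal (1 / a)"
proof -
  have "(\<integral>\<^sup>+l. ennreal (l powr a) \<partial>log_measure) = (\<integral>\<^sup>+l. ennreal (1 / l) * ennreal (l powr a) * indicator {0<..1} l \<partial>lborel)"
    by (intro nn_integral_log_measure) auto
  also have "\<dots> \<le> (\<integral>\<^sup>+l. ennreal (l powr (a - 1)) * indicator {0..1} l \<partial>lborel)"
    by (intro nn_integral_mono) (auto simp: indicator_def ennreal_mult'[symmetric] powr_diff)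
  also have "\<dots> = ennreal (1 / a)"
    using has_integral_powr_from_0[of "a - 1" 1] assms
    by (intro nn_integral_has_integral_lebesgue') auto
  finally show ?thesis .
qed

lemma emeasure_log_measure_dyadic:
  assumes "1 \<le> (n::nat)"
  shows "{1 / 2 ^ n..2 / 2 ^ n} \<in> sets log_measure"
    and "1 / 2 \<le> emeasure log_measure {1 / 2 ^ n..2 / 2 ^ n}"
proof -
  let ?A = "{1 / 2 ^ n..2 / 2 ^ n :: real}"
  have "(2::real) ^ 1 \<le> 2 ^ n" using assms by (intro power_increasing) auto
  then have sub: "?A \<subseteq> {0<..1}"
  proof -
    assume *: "(2::real) ^ 1 \<le> 2 ^ n"
    then have "0 < 1 / (2::real) ^ n" "2 / (2::real) ^ n \<le> 1" by auto
    then show ?thesis by (meson atLeastAtMost_iff greaterThanAtMost_iff less_le_trans order_trans subsetI)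
  qed
  show A: "?A \<in> sets log_measure"
    using sub by (auto simp: log_measure_def sets_restrict_space_iff)
  have "ennreal (1 / 2) = ennreal (2 ^ n / 2) * ennreal (1 / 2 ^ n)"
    by (simp add: ennreal_mult'[symmetric])
  also have "\<dots> = (\<integral>\<^sup>+l. ennreal (2 ^ n / 2) * indicator ?A l \<partial>lborel)"
    by (simp add: nn_integral_cmult_indicator divide_right_mono field_simps)
  also have "\<dots> \<le> (\<integral>\<^sup>+l. ennreal (1 / l) * indicator ?A l * indicator {0<..1} l \<partial>lborel)"
    using sub by (intro nn_integral_mono) (auto simp: indicator_def field_simps intro!: ennreal_leI)
  also have "\<dots> = (\<integral>\<^sup>+l. indicator ?A l \<partial>log_measure)"
    by (intro nn_integral_log_measure[symmetric]) auto
  also have "\<dots> = emeasure log_measure ?A"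
    using A by simp
  finally show "1 / 2 \<le> emeasure log_measure ?A"
    by (simp add: divide_ennreal[of 1 2, simplified, symmetric])
qed

lemma dyadic_bracket:
  assumes "0 < t" "t \<le> (1::real)"
  obtains n :: nat where "1 / 2 ^ Suc n < t" "t \<le> 1 / 2 ^ n"
proof -
  let ?P = "\<lambda>n. 1 / 2 ^ Suc n < t"
  obtain n where "(1 / 2) ^ n < t"
    using real_arch_pow_inv[of t "1 / 2"] assms by auto
  moreover have "(1 / 2 :: real) ^ Suc n \<le> (1 / 2) ^ n" by simp
  ultimately have ex: "?P n" by (simp add: power_one_over)
  define k where "k = (LEAST n. ?P n)"
  have "?P k" unfolding k_def using ex by (rule LeastI)
  moreover have "t \<le> 1 / 2 ^ k"
  proof (cases k)
    case 0
    then show ?thesis using assms by simp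
  next
    case (Suc j)
    have "\<not> ?P j"
      using not_less_Least[of j ?P] Suc by (simp add: k_def)
    then show ?thesis using Suc by simp
  qed
  ultimately show ?thesis by (rule that)
qed

lemma ennreal_le_suminf: "f n \<le> (\<Sum>n. f n :: ennreal)"
  using sum_le_suminf[of f "{n}"] by simp

lemma suminf_geometric_ennreal:
  assumes "0 \<le> x" "x < (1::real)"
  shows "(\<Sum>n. ennreal (x ^ n)) = ennreal (1 / (1 - x))"
  using assms by (subst suminf_ennreal2) (auto simp: suminf_geometric summable_geometric)

text \<open>
  The box of radius \<open>1 / 2\<^sup>n\<close> has volume proportional to \<open>1 / 2\<^sup>n\<close> to
  the power of the homogeneous dimension, so each dyadic shell has mass of order one under the scaled measure,
  and \<open>scaled_norm s h powr a\<close> sums over the shells as a geometric series.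
\<close>

lemma nn_integral_scaled_measure_powr:
  fixes s :: "'d::finite \<Rightarrow> nat"
  assumes s: "scaling s" and a: "0 < a"
  shows "\<exists>C\<ge>0. (\<integral>\<^sup>+h. ennreal (scaled_norm s h powr a) \<partial>scaled_measure s) \<le> ennreal C"
proof -
  let ?N = "scaling_size s" and ?d = "CARD('d)"
  let ?B = "\<lambda>r. scaled_ball s (0::real^'d) r"
  have [measurable]: "scaled_norm s \<in> borel_measurable borel"
    using s by (rule borel_measurable_scaled_norm)
  have [measurable]: "?B r \<in> sets borel" for r using s by simp
  have m1: "f \<in> borel_measurable (lebesgue_on (?B 1))" if "f \<in> borel_measurable borel" for f :: "real^'d \<Rightarrow> ennreal"
    using that by (intro measurable_restrict_space1 measurable_completion) auto
  have "(\<integral>\<^sup>+h. ennreal (scaled_norm s h powr a) \<partial>scaled_measure s)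
      = (\<integral>\<^sup>+h. ennreal (1 / scaled_norm s h ^ ?N) * ennreal (scaled_norm s h powr a) \<partial>lebesgue_on (?B 1))"
    unfolding scaled_measure_def by (intro nn_integral_density m1) auto
  also have "\<dots> = (\<integral>\<^sup>+h. ennreal (1 / scaled_norm s h ^ ?N) * ennreal (scaled_norm s h powr a) * indicator (?B 1) h \<partial>lborel)"
    by (subst nn_integral_restrict_space) (auto simp: nn_integral_completion)
  also have "\<dots> \<le> (\<integral>\<^sup>+h. (\<Sum>n. ennreal (2 ^ (Suc n * ?N) * (1 / 2 ^ n) powr a) * indicator (?B (1 / 2 ^ n)) h) \<partial>lborel)"
  proof (intro nn_integral_mono)
    fix h :: "real^'d"
    let ?R = "\<lambda>n. ennreal (2 ^ (Suc n * ?N) * (1 / 2 ^ n) powr a) * indicator (?B (1 / 2 ^ n)) h"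
    show "ennreal (1 / scaled_norm s h ^ ?N) * ennreal (scaled_norm s h powr a) * indicator (?B 1) h \<le> (\<Sum>n. ?R n)"
    proof (cases "h \<noteq> 0 \<and> h \<in> ?B 1")
      case False
      then show ?thesis using s scaling_size_pos[OF s] by (auto simp: indicator_def)
    next
      case True
      then have pos: "0 < scaled_norm s h" "scaled_norm s h \<le> 1"
        using scaled_norm_pos[OF s] by (auto simp: mem_scaled_ball)
      from dyadic_bracket[OF this] obtain n where n: "1 / 2 ^ Suc n < scaled_norm s h" "scaled_norm s h \<le> 1 / 2 ^ n" .
      have "1 / scaled_norm s h \<le> 2 ^ Suc n"
        using n(1) pos by (simp add: field_simps)
      then have "(1 / scaled_norm s h) ^ ?N \<le> (2 ^ Suc n) ^ ?N"
        using pos by (intro power_mono) auto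
      then have "1 / scaled_norm s h ^ ?N \<le> 2 ^ (Suc n * ?N)"
        unfolding power_mult[symmetric] power_one_over by (simp add: inverse_eq_divide)
      moreover have "scaled_norm s h powr a \<le> (1 / 2 ^ n) powr a"
        using n(2) a by (intro powr_mono2) auto
      ultimately have "1 / scaled_norm s h ^ ?N * scaled_norm s h powr a \<le> 2 ^ (Suc n * ?N) * (1 / 2 ^ n) powr a"
        by (intro mult_mono) auto
      then have "ennreal (1 / scaled_norm s h ^ ?N) * ennreal (scaled_norm s h powr a) * indicator (?B 1) h \<le> ?R n"
        using True n(2) pos by (simp add: mem_scaled_ball ennreal_mult'[symmetric] ennreal_leI)
      also have "\<dots> \<le> (\<Sum>n. ?R n)"
        by (rule ennreal_le_suminf)
      finally show ?thesis .
    qed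
  qed
  also have "\<dots> = (\<Sum>n. \<integral>\<^sup>+h. ennreal (2 ^ (Suc n * ?N) * (1 / 2 ^ n) powr a) * indicator (?B (1 / 2 ^ n)) h \<partial>lborel)"
    by (intro nn_integral_suminf) auto
  also have "\<dots> = (\<Sum>n. ennreal (2 ^ (?N + ?d)) * ennreal ((2 powr (- a)) ^ n))"
  proof (intro suminf_cong)
    fix n
    have "2 ^ (Suc n * ?N) * (1 / 2 ^ n) powr a * (2 ^ ?d * (1 / 2 ^ n) ^ ?N) = 2 ^ (?N + ?d) * (2 powr (- a)) ^ n"
    proof -
      have "(1 / 2 ^ n) powr a = (2 powr (- a)) ^ n"
        by (simp add: powr_realpow[symmetric] powr_divide powr_powr powr_minus_divide power_one_over mult.commute)
      moreover have "(2::real) ^ (Suc n * ?N) * (1 / 2 ^ n) ^ ?N = 2 ^ ?N"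
        by (simp add: power_add power_one_over power_mult)
      ultimately show ?thesis by (simp add: power_add mult_ac)
    qed
    then show "(\<integral>\<^sup>+h. ennreal (2 ^ (Suc n * ?N) * (1 / 2 ^ n) powr a) * indicator (?B (1 / 2 ^ n)) h \<partial>lborel)
        = ennreal (2 ^ (?N + ?d)) * ennreal ((2 powr (- a)) ^ n)"
      by (simp add: nn_integral_cmult_indicator emeasure_scaled_ball[OF s] ennreal_mult'[symmetric])
  qed
  also have "\<dots> = ennreal (2 ^ (?N + ?d)) * ennreal (1 / (1 - 2 powr (- a)))"
    using a by (subst ennreal_suminf_cmult, subst suminf_geometric_ennreal) (auto simp: powr_less_one)
  finally show ?thesis
    using a by (intro exI[of _ "2 ^ (?N + ?d) * (1 / (1 - 2 powr (- a)))"])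
       (auto simp: ennreal_mult'[symmetric] powr_less_one less_imp_le)
qed

section \<open>Local averages\<close>

lemma enn_powr_le_linear:
  assumes "x \<le> ennreal B" "0 \<le> B" "1 \<le> c"
  shows "enn_powr x c \<le> ennreal (B powr (c - 1)) * x"
proof -
  obtain u where u: "x = ennreal u" "0 \<le> u" "u \<le> B"
    using assms by (cases x) (auto simp: top_unique)
  have "u powr c \<le> B powr (c - 1) * u"
  proof (cases "u = 0")
    case False
    then have "u powr c = u powr (c - 1) * u"
      using u by (simp add: powr_diff)
    also have "\<dots> \<le> B powr (c - 1) * u"
      using u assms by (intro mult_right_mono powr_mono2) auto
    finally show ?thesis .
  qed simp
  then show ?thesis
    using u by (simp add: ennreal_mult'[symmetric] ennreal_leI)
qed

text \<open>
  Fubini: the point \<open>y\<close> lies in the box around \<open>x\<close> iff \<open>x\<close> lies in the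
  box around \<open>y\<close>.
\<close>

lemma nn_integral_local_average:
  fixes s :: "'d::finite \<Rightarrow> nat" and F :: "real^'d \<Rightarrow> ennreal"
  assumes s: "scaling s" and [measurable]: "F \<in> borel_measurable borel" and r: "0 \<le> r"
  shows "(\<integral>\<^sup>+x. \<integral>\<^sup>+y. F y * indicator (scaled_ball s x r) y \<partial>lborel \<partial>lborel)
    = ennreal (2 ^ CARD('d) * r ^ scaling_size s) * (\<integral>\<^sup>+y. F y \<partial>lborel)"
    and "(\<lambda>x. \<integral>\<^sup>+y. F y * indicator (scaled_ball s x r) y \<partial>lborel) \<in> borel_measurable borel"
proof -
  have [measurable]: "scaled_norm s \<in> borel_measurable borel"
    using s by (rule borel_measurable_scaled_norm)
  have ind: "indicator (scaled_ball s x r) y = (indicator {..r} (scaled_norm s (y - x)) :: ennreal)" for x y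
    by (simp add: mem_scaled_ball indicator_def)
  have sym: "indicator (scaled_ball s x r) y = (indicator (scaled_ball s y r) x :: ennreal)" for x y
    by (simp add: mem_scaled_ball indicator_def scaled_norm_minus_commute)
  have "(\<integral>\<^sup>+x. \<integral>\<^sup>+y. F y * indicator (scaled_ball s x r) y \<partial>lborel \<partial>lborel)
      = (\<integral>\<^sup>+y. \<integral>\<^sup>+x. F y * indicator (scaled_ball s x r) y \<partial>lborel \<partial>lborel)"
    unfolding ind by (intro lborel_pair.Fubini') measurable
  also have "\<dots> = (\<integral>\<^sup>+y. ennreal (2 ^ CARD('d) * r ^ scaling_size s) * F y \<partial>lborel)"
  proof (intro nn_integral_cong)
    fix y
    have "(\<integral>\<^sup>+x. F y * indicator (scaled_ball s x r) y \<partial>lborel)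
        = (\<integral>\<^sup>+x. F y * indicator (scaled_ball s y r) x \<partial>lborel)"
      by (intro nn_integral_cong arg_cong2[where f="(*)"] sym refl)
    then show "(\<integral>\<^sup>+x. F y * indicator (scaled_ball s x r) y \<partial>lborel)
        = ennreal (2 ^ CARD('d) * r ^ scaling_size s) * F y"
      using s r by (simp add: nn_integral_cmult_indicator emeasure_scaled_ball mult.commute)
  qed
  also have "\<dots> = ennreal (2 ^ CARD('d) * r ^ scaling_size s) * (\<integral>\<^sup>+y. F y \<partial>lborel)"
    by (intro nn_integral_cmult) auto
  finally show "(\<integral>\<^sup>+x. \<integral>\<^sup>+y. F y * indicator (scaled_ball s x r) y \<partial>lborel \<partial>lborel)
    = ennreal (2 ^ CARD('d) * r ^ scaling_size s) * (\<integral>\<^sup>+y. F y \<partial>lborel)" .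
  show "(\<lambda>x. \<integral>\<^sup>+y. F y * indicator (scaled_ball s x r) y \<partial>lborel) \<in> borel_measurable borel"
    unfolding ind by measurable
qed

text \<open>
  A Sobolev inequality for local averages. Let \<open>N\<close> be the homogeneous dimension and \<open>G m
  x\<close> the integral of \<open>D powr p'\<close> over the box of radius \<open>c / 2\<^sup>m\<close>
  around \<open>x\<close> times \<open>2 ^ (m * N)\<close>, an average up to a constant. Pointwise \<open>G
  m\<close> is at most \<open>2 ^ (m * N)\<close> times the integral of \<open>D powr p'\<close>, while its
  integral does not depend on \<open>m\<close>. Interpolating between the two, the norm of \<open>G m powr (1
  / p')\<close> in \<open>L\<^sup>p\<close> grows at most like \<open>2 powr (m * N * (1 / p' - 1 /
  p))\<close>. As \<open>a\<close> exceeds this rate, the weights \<open>2 powr (- m * a)\<close> make an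
  \<open>\<ell>\<^sup>p\<close> sum over all scales converge. The sum \<open>H\<close> controls the averages
  at all scales simultaneously, at the price of the factor \<open>2 powr (m * a)\<close>. Unlike an argument
  by maximal functions, this covers \<open>p' = 1\<close>.
\<close>

lemma dyadic_average_majorant:
  fixes s :: "'d::finite \<Rightarrow> nat"
  assumes s: "scaling s" and p: "1 \<le> p'" "p' \<le> p" and c: "0 < c"
    and a: "real (scaling_size s) * (1 / p' - 1 / p) < a"
  shows "\<exists>C>0. \<forall>D\<in>borel_measurable borel. \<exists>H\<in>borel_measurable borel.
     (\<forall>(x::real^'d) m. ennreal (2 ^ (m * scaling_size s)) *
         (\<integral>\<^sup>+y. enn_powr (D y) p' * indicator (scaled_ball s x (c / 2 ^ m)) y \<partial>lborel)
       \<le> enn_powr (ennreal (2 powr (real m * a)) * H x) p') \<and>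
     Lp_norm lborel (ennreal p) H \<le> ennreal C * Lp_norm lborel (ennreal p') D"
proof -
  define N where "N = scaling_size s"
  define V where "V = 2 ^ CARD('d) * c ^ N"
  define \<theta> where "\<theta> = a * p - real N * (p / p' - 1)"
  have p0: "0 < p" "0 < p'" using p by auto
  have "real N * (1 / p' - 1 / p) * p < a * p"
    using a p0 by (simp add: N_def)
  then have \<theta>: "0 < \<theta>"
    using p0 by (simp add: \<theta>_def right_diff_distrib left_diff_distrib)
  have V: "0 < V" using c by (simp add: V_def)
  define C where "C = (V * (1 / (1 - 2 powr (- \<theta>)))) powr (1 / p)"
  have geo: "0 < 1 - 2 powr (- \<theta>)" using \<theta> by (simp add: powr_less_one)
  have C: "0 < C" using V geo \<theta> by (simp add: C_def)
  have "\<exists>H\<in>borel_measurable borel.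
     (\<forall>(x::real^'d) m. ennreal (2 ^ (m * N)) *
         (\<integral>\<^sup>+y. enn_powr (D y) p' * indicator (scaled_ball s x (c / 2 ^ m)) y \<partial>lborel)
       \<le> enn_powr (ennreal (2 powr (real m * a)) * H x) p') \<and>
     Lp_norm lborel (ennreal p) H \<le> ennreal C * Lp_norm lborel (ennreal p') D"
    if [measurable]: "D \<in> borel_measurable borel" for D :: "real^'d \<Rightarrow> ennreal"
  proof (cases "(\<integral>\<^sup>+y. enn_powr (D y) p' \<partial>lborel) = \<infinity>")
    case True
    then have "Lp_norm lborel (ennreal p') D = \<infinity>"
      using p0 by (simp add: Lp_norm_real)
    then show ?thesis
      using C by (intro bexI[of _ "\<lambda>_. \<infinity>"]) (auto simp: ennreal_mult_top)
  next
    case False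
    then obtain K where K: "(\<integral>\<^sup>+y. enn_powr (D y) p' \<partial>lborel) = ennreal K" "0 \<le> K"
      by (cases "\<integral>\<^sup>+y. enn_powr (D y) p' \<partial>lborel") auto
    define G where "G m x = ennreal (2 ^ (m * N)) *
         (\<integral>\<^sup>+y. enn_powr (D y) p' * indicator (scaled_ball s x (c / 2 ^ m)) y \<partial>lborel)" for m x
    have [measurable]: "G m \<in> borel_measurable borel" for m
      unfolding G_def using c by (intro borel_measurable_times_ennreal nn_integral_local_average(2) s) auto
    have intG: "(\<integral>\<^sup>+x. G m x \<partial>lborel) = ennreal (V * K)" for m
    proof -
      have "(\<integral>\<^sup>+x. G m x \<partial>lborel) = ennreal (2 ^ (m * N)) * (ennreal (2 ^ CARD('d) * (c / 2 ^ m) ^ N) * ennreal K)"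
        unfolding G_def using c s
        by (subst nn_integral_cmult_real)
           (auto simp: nn_integral_local_average(1) K N_def)
      also have "2 ^ (m * N) * (2 ^ CARD('d) * (c / 2 ^ m) ^ N) = V"
        by (simp add: V_def power_divide power_mult)
      then have "ennreal (2 ^ (m * N)) * (ennreal (2 ^ CARD('d) * (c / 2 ^ m) ^ N) * ennreal K) = ennreal (V * K)"
        using K c by (simp add: ennreal_mult'[symmetric] mult.assoc[symmetric])
      finally show ?thesis .
    qed
    have G_le: "G m x \<le> ennreal (2 ^ (m * N) * K)" for m x
    proof -
      have "(\<integral>\<^sup>+y. enn_powr (D y) p' * indicator (scaled_ball s x (c / 2 ^ m)) y \<partial>lborel) \<le> ennreal K"
        unfolding K(1)[symmetric] by (intro nn_integral_mono) (auto simp: indicator_def)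
      then show ?thesis
        unfolding G_def using K by (simp add: ennreal_mult' mult_left_mono)
    qed
    define T where "T m x = ennreal (2 powr (- (real m * a * p))) * enn_powr (G m x) (p / p')" for m x
    have [measurable]: "T m \<in> borel_measurable borel" for m
      unfolding T_def by measurable
    define H where "H x = enn_powr (\<Sum>m. T m x) (1 / p)" for x
    have [measurable]: "H \<in> borel_measurable borel"
      unfolding H_def by measurable
    have intT: "(\<integral>\<^sup>+x. T m x \<partial>lborel) \<le> ennreal (V * K powr (p / p')) * ennreal ((2 powr (- \<theta>)) ^ m)" for m
    proof -
      let ?e = "p / p' - 1"
      have "(\<integral>\<^sup>+x. T m x \<partial>lborel)
          \<le> (\<integral>\<^sup>+x. ennreal (2 powr (- (real m * a * p))) * (ennreal ((2 ^ (m * N) * K) powr ?e) * G m x) \<partial>lborel)"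
        unfolding T_def using p0 p K
        by (intro nn_integral_mono mult_left_mono enn_powr_le_linear G_le) auto
      also have "\<dots> = ennreal (2 powr (- (real m * a * p))) * (ennreal ((2 ^ (m * N) * K) powr ?e) * ennreal (V * K))"
        by (simp add: nn_integral_cmult intG)
      also have "\<dots> = ennreal (2 powr (- (real m * a * p)) * (2 ^ (m * N) * K) powr ?e * (V * K))"
        using K V by (simp add: ennreal_mult'[symmetric] mult_ac)
      also have "2 powr (- (real m * a * p)) * (2 ^ (m * N) * K) powr ?e * (V * K)
          = V * K powr (p / p') * (2 powr (- \<theta>)) ^ m"
      proof -
        have "K powr ?e * K = K powr (p / p')"
          using K(2) by (cases "K = 0") (auto simp: powr_diff)
        moreover have "2 powr (- (real m * a * p)) * (2 ^ (m * N)) powr ?e = (2 powr (- \<theta>)) ^ m"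
          by (simp add: powr_realpow[symmetric] powr_powr powr_add[symmetric] \<theta>_def algebra_simps)
        ultimately show ?thesis
          using K by (simp add: powr_mult mult_ac)
      qed
      finally show ?thesis
        using V by (simp add: ennreal_mult')
    qed
    have "(\<integral>\<^sup>+x. enn_powr (H x) p \<partial>lborel) = (\<integral>\<^sup>+x. (\<Sum>m. T m x) \<partial>lborel)"
      using p0 by (simp add: H_def enn_powr_powr)
    also have "\<dots> = (\<Sum>m. \<integral>\<^sup>+x. T m x \<partial>lborel)"
      by (intro nn_integral_suminf) auto
    also have "\<dots> \<le> (\<Sum>m. ennreal (V * K powr (p / p')) * ennreal ((2 powr (- \<theta>)) ^ m))"
      by (intro suminf_le intT) auto
    also have "\<dots> = ennreal (V * K powr (p / p')) * ennreal (1 / (1 - 2 powr (- \<theta>)))"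
      using geo by (subst ennreal_suminf_cmult, subst suminf_geometric_ennreal) auto
    also have "\<dots> = ennreal (V * (1 / (1 - 2 powr (- \<theta>)))) * ennreal (K powr (p / p'))"
      using V geo by (simp add: ennreal_mult'[symmetric] mult_ac)
    finally have "Lp_norm lborel (ennreal p) H \<le> enn_powr (ennreal (V * (1 / (1 - 2 powr (- \<theta>)))) * ennreal (K powr (p / p'))) (1 / p)"
      using p0 by (simp add: Lp_norm_real enn_powr_mono)
    also have "\<dots> = ennreal C * ennreal (K powr (1 / p'))"
      using p0 V geo by (subst enn_powr_mult) (auto simp: C_def powr_powr)
    also have "ennreal (K powr (1 / p')) = Lp_norm lborel (ennreal p') D"
      using p0 K by (simp add: Lp_norm_real)
    finally have 1: "Lp_norm lborel (ennreal p) H \<le> ennreal C * Lp_norm lborel (ennreal p') D" .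
    have 2: "G m x \<le> enn_powr (ennreal (2 powr (real m * a)) * H x) p'" for x m
    proof -
      have "T m x \<le> (\<Sum>m. T m x)"
        by (rule ennreal_le_suminf)
      then have "enn_powr (T m x) (p' / p) \<le> enn_powr (\<Sum>m. T m x) (p' / p)"
        using p0 by (intro enn_powr_mono) auto
      also have "\<dots> = enn_powr (H x) p'"
        by (simp add: H_def enn_powr_powr)
      also have "enn_powr (T m x) (p' / p) = ennreal (2 powr (- (real m * a * p'))) * G m x"
        using p0 by (simp add: T_def enn_powr_mult enn_powr_powr powr_powr mult.assoc)
      finally have "ennreal (2 powr (real m * a * p')) * (ennreal (2 powr (- (real m * a * p'))) * G m x)
          \<le> ennreal (2 powr (real m * a * p')) * enn_powr (H x) p'"
        by (intro mult_left_mono) auto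
      then show ?thesis
        using p0 by (simp add: mult.assoc[symmetric] ennreal_mult'[symmetric] powr_add[symmetric] enn_powr_mult powr_powr)
    qed
    show ?thesis
      using 1 2 by (intro bexI[of _ H]) (auto simp: G_def)
  qed
  then show ?thesis
    using C unfolding N_def by blast
qed

section \<open>Graded components and weighted norms\<close>

locale reg_structure =
  fixes RS :: "'v::real_vector regularity_structure"
  assumes reg_structure: "is_regularity_structure RS"
begin

lemma finite_hom_below: "finite (hom_below RS g)"
proof -
  obtain b where "\<And>a. a \<in> hom_set RS \<Longrightarrow> b \<le> a"
    using reg_structure by (auto simp: is_regularity_structure_def bdd_below_def)
  then have "hom_below RS g \<subseteq> hom_set RS \<inter> {b..g}"
    by (auto simp: hom_below_def)
  moreover have "finite (hom_set RS \<inter> {b..g})"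
    using reg_structure by (simp add: is_regularity_structure_def)
  ultimately show ?thesis by (rule finite_subset)
qed

lemma hom_belowD: "\<zeta> \<in> hom_below RS g \<Longrightarrow> \<zeta> \<in> hom_set RS" "\<zeta> \<in> hom_below RS g \<Longrightarrow> \<zeta> < g"
  by (auto simp: hom_below_def)

lemma banach: "\<zeta> \<in> hom_set RS \<Longrightarrow> banach_subspace (hspace RS \<zeta>) (hnorm RS \<zeta>)"
  using reg_structure by (simp add: is_regularity_structure_def)

lemma subspace_hspace: "\<zeta> \<in> hom_set RS \<Longrightarrow> subspace (hspace RS \<zeta>)"
  using banach by (simp add: banach_subspace_def)

lemma decomposition_proj: "decomposition RS \<tau> (\<lambda>\<zeta>. proj RS \<zeta> \<tau>)"
proof -
  have "\<exists>!c. decomposition RS \<tau> c"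
    using reg_structure by (simp add: is_regularity_structure_def)
  from theI'[OF this] show ?thesis by (simp add: proj_def)
qed

lemma proj_eqI:
  assumes "decomposition RS \<tau> c" shows "proj RS \<zeta> \<tau> = c \<zeta>"
proof -
  have "\<exists>!c. decomposition RS \<tau> c"
    using reg_structure by (simp add: is_regularity_structure_def)
  then have "(\<lambda>\<zeta>. proj RS \<zeta> \<tau>) = c"
    using assms decomposition_proj by blast
  then show ?thesis by metis
qed

lemma decompositionI:
  assumes "finite S" "\<And>\<zeta>. \<zeta> \<notin> S \<Longrightarrow> c \<zeta> = 0" "\<And>\<zeta>. \<zeta> \<in> hom_set RS \<Longrightarrow> c \<zeta> \<in> hspace RS \<zeta>"
    "\<And>\<zeta>. \<zeta> \<notin> hom_set RS \<Longrightarrow> c \<zeta> = 0" "\<tau> = (\<Sum>\<zeta>\<in>S. c \<zeta>)"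
  shows "decomposition RS \<tau> c"
proof -
  have "{\<zeta>. c \<zeta> \<noteq> 0} \<subseteq> S" using assms(2) by auto
  then have "finite {\<zeta>. c \<zeta> \<noteq> 0}" "(\<Sum>\<zeta>\<in>S. c \<zeta>) = (\<Sum>\<zeta> | c \<zeta> \<noteq> 0. c \<zeta>)"
    using assms(1) by (auto intro: finite_subset sum.mono_neutral_right)
  then show ?thesis using assms by (simp add: decomposition_def)
qed

lemma proj_support:
  obtains S where "finite S" "\<And>\<zeta>. \<zeta> \<notin> S \<Longrightarrow> proj RS \<zeta> \<tau> = 0"
    "\<And>T. finite T \<Longrightarrow> S \<subseteq> T \<Longrightarrow> \<tau> = (\<Sum>\<zeta>\<in>T. proj RS \<zeta> \<tau>)"
proof (rule that[of "{\<zeta>. proj RS \<zeta> \<tau> \<noteq> 0}"])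
  have d: "finite {\<zeta>. proj RS \<zeta> \<tau> \<noteq> 0}" "\<tau> = (\<Sum>\<zeta> | proj RS \<zeta> \<tau> \<noteq> 0. proj RS \<zeta> \<tau>)"
    using decomposition_proj[of \<tau>] by (auto simp: decomposition_def)
  show "finite {\<zeta>. proj RS \<zeta> \<tau> \<noteq> 0}" by (rule d(1))
  fix T assume T: "finite T" "{\<zeta>. proj RS \<zeta> \<tau> \<noteq> 0} \<subseteq> T"
  have "(\<Sum>\<zeta> | proj RS \<zeta> \<tau> \<noteq> 0. proj RS \<zeta> \<tau>) = (\<Sum>\<zeta>\<in>T. proj RS \<zeta> \<tau>)"
    using T by (intro sum.mono_neutral_left) auto
  then show "\<tau> = (\<Sum>\<zeta>\<in>T. proj RS \<zeta> \<tau>)" using d(2) by simp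
qed auto

lemma proj_mem: "\<zeta> \<in> hom_set RS \<Longrightarrow> proj RS \<zeta> \<tau> \<in> hspace RS \<zeta>"
  and proj_not_hom: "\<zeta> \<notin> hom_set RS \<Longrightarrow> proj RS \<zeta> \<tau> = 0"
  using decomposition_proj[of \<tau>] by (auto simp: decomposition_def)

lemma linear_proj: "linear (proj RS \<zeta>)"
proof (rule linearI)
  fix a b :: 'v
  obtain S where S: "finite S" "\<And>\<zeta>. \<zeta> \<notin> S \<Longrightarrow> proj RS \<zeta> a = 0"
    "\<And>T. finite T \<Longrightarrow> S \<subseteq> T \<Longrightarrow> a = (\<Sum>\<zeta>\<in>T. proj RS \<zeta> a)" by (rule proj_support[of a]) blast
  obtain S' where S': "finite S'" "\<And>\<zeta>. \<zeta> \<notin> S' \<Longrightarrow> proj RS \<zeta> b = 0"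
    "\<And>T. finite T \<Longrightarrow> S' \<subseteq> T \<Longrightarrow> b = (\<Sum>\<zeta>\<in>T. proj RS \<zeta> b)" by (rule proj_support[of b]) blast
  have "a + b = (\<Sum>\<zeta>\<in>S \<union> S'. proj RS \<zeta> a) + (\<Sum>\<zeta>\<in>S \<union> S'. proj RS \<zeta> b)"
    using S(3)[of "S \<union> S'"] S'(3)[of "S \<union> S'"] S(1) S'(1) by simp
  then have "decomposition RS (a + b) (\<lambda>\<zeta>. proj RS \<zeta> a + proj RS \<zeta> b)"
    using S(1,2) S'(1,2) by (intro decompositionI[of "S \<union> S'"])
      (auto simp: sum.distrib proj_not_hom intro!: subspace_add[OF subspace_hspace] proj_mem)
  then show "proj RS \<zeta> (a + b) = proj RS \<zeta> a + proj RS \<zeta> b" by (rule proj_eqI)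
next
  fix r :: real and a :: 'v
  obtain S where S: "finite S" "\<And>\<zeta>. \<zeta> \<notin> S \<Longrightarrow> proj RS \<zeta> a = 0"
    "\<And>T. finite T \<Longrightarrow> S \<subseteq> T \<Longrightarrow> a = (\<Sum>\<zeta>\<in>T. proj RS \<zeta> a)" by (rule proj_support[of a]) blast
  have "r *\<^sub>R a = (\<Sum>\<zeta>\<in>S. r *\<^sub>R proj RS \<zeta> a)"
    using S(3)[of S] S(1) by (metis scaleR_sum_right order_refl)
  then have "decomposition RS (r *\<^sub>R a) (\<lambda>\<zeta>. r *\<^sub>R proj RS \<zeta> a)"
    using S(1,2) by (intro decompositionI[of S])
      (auto simp: scaleR_sum_right proj_not_hom intro!: subspace_scale[OF subspace_hspace] proj_mem)
  then show "proj RS \<zeta> (r *\<^sub>R a) = r *\<^sub>R proj RS \<zeta> a" by (rule proj_eqI)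
qed

lemmas proj_simps = linear_0[OF linear_proj] linear_add[OF linear_proj] linear_diff[OF linear_proj]
  linear_neg[OF linear_proj] linear_sum[OF linear_proj]

lemma proj_homogeneous:
  assumes "\<beta> \<in> hom_set RS" "\<tau> \<in> hspace RS \<beta>"
  shows "proj RS \<zeta> \<tau> = (if \<zeta> = \<beta> then \<tau> else 0)"
proof (rule proj_eqI)
  show "decomposition RS \<tau> (\<lambda>\<zeta>. if \<zeta> = \<beta> then \<tau> else 0)"
    using assms by (intro decompositionI[of "{\<beta>}"]) (auto intro: subspace_0[OF subspace_hspace])
qed

lemma subspace_hspace_below: "subspace (hspace_below RS g)"
  unfolding hspace_below_def by (rule subspace_span)

lemma hspace_subset_below: "\<beta> \<in> hom_below RS g \<Longrightarrow> hspace RS \<beta> \<subseteq> hspace_below RS g"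
  unfolding hspace_below_def by (intro subsetI span_base) auto

lemma hspace_below_mono: "g \<le> g' \<Longrightarrow> hspace_below RS g \<subseteq> hspace_below RS g'"
  unfolding hspace_below_def by (intro span_mono) (auto simp: hom_below_def)

lemma proj_hspace_below:
  assumes "\<tau> \<in> hspace_below RS g" "\<zeta> \<notin> hom_below RS g"
  shows "proj RS \<zeta> \<tau> = 0"
  using assms(1) unfolding hspace_below_def
proof (induction rule: span_induct)
  case base
  show ?case unfolding subspace_def by (simp add: proj_simps linear_scale[OF linear_proj])
next
  case (step x)
  then obtain \<beta> where "\<beta> \<in> hom_below RS g" "x \<in> hspace RS \<beta>" by auto
  moreover from this assms(2) have "\<zeta> \<noteq> \<beta>" by auto
  ultimately show ?case by (simp add: proj_homogeneous[OF hom_belowD(1)])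
qed

lemma proj_below_mem: "proj_below RS g \<tau> \<in> hspace_below RS g"
  unfolding proj_below_def
  using hspace_subset_below proj_mem hom_belowD(1)
  by (intro subspace_sum[OF subspace_hspace_below]) blast

lemma proj_proj_below:
  "proj RS \<zeta> (proj_below RS g \<tau>) = (if \<zeta> \<in> hom_below RS g then proj RS \<zeta> \<tau> else 0)"
proof -
  have "proj RS \<zeta> (proj_below RS g \<tau>) = (\<Sum>\<beta>\<in>hom_below RS g. if \<zeta> = \<beta> then proj RS \<beta> \<tau> else 0)"
    unfolding proj_below_def proj_simps
    by (intro sum.cong refl) (metis proj_homogeneous proj_mem hom_belowD(1))
  then show ?thesis by (simp add: finite_hom_below)
qed

lemma eq_sum_proj:
  assumes "\<tau> \<in> hspace_below RS g"
  shows "\<tau> = (\<Sum>\<zeta>\<in>hom_below RS g. proj RS \<zeta> \<tau>)"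
proof -
  obtain S where S: "finite S" "\<And>\<zeta>. \<zeta> \<notin> S \<Longrightarrow> proj RS \<zeta> \<tau> = 0"
    "\<And>T. finite T \<Longrightarrow> S \<subseteq> T \<Longrightarrow> \<tau> = (\<Sum>\<zeta>\<in>T. proj RS \<zeta> \<tau>)" by (rule proj_support[of \<tau>]) blast
  have "\<tau> = (\<Sum>\<zeta>\<in>S \<union> hom_below RS g. proj RS \<zeta> \<tau>)"
    using S(1) finite_hom_below by (intro S(3)) auto
  also have "\<dots> = (\<Sum>\<zeta>\<in>hom_below RS g. proj RS \<zeta> \<tau>)"
    using S(1) finite_hom_below proj_hspace_below[OF assms] by (intro sum.mono_neutral_right) auto
  finally show ?thesis .
qed

lemma hnorm_nonneg: "\<zeta> \<in> hom_set RS \<Longrightarrow> v \<in> hspace RS \<zeta> \<Longrightarrow> 0 \<le> hnorm RS \<zeta> v"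
  and hnorm_0: "\<zeta> \<in> hom_set RS \<Longrightarrow> hnorm RS \<zeta> 0 = 0"
  using banach[of \<zeta>] subspace_0[of "hspace RS \<zeta>"] by (auto simp: banach_subspace_def)

lemma comp_norm_nonneg: "\<zeta> \<in> hom_set RS \<Longrightarrow> 0 \<le> comp_norm RS \<zeta> \<tau>"
  unfolding comp_norm_def by (intro hnorm_nonneg proj_mem)

lemma comp_norm_proj_eq_0: "\<zeta> \<in> hom_set RS \<Longrightarrow> proj RS \<zeta> \<tau> = 0 \<Longrightarrow> comp_norm RS \<zeta> \<tau> = 0"
  by (simp add: comp_norm_def hnorm_0)

lemma comp_norm_0: "\<zeta> \<in> hom_set RS \<Longrightarrow> comp_norm RS \<zeta> 0 = 0"
  by (simp add: comp_norm_proj_eq_0 proj_simps)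

lemma comp_norm_add: "\<zeta> \<in> hom_set RS \<Longrightarrow> comp_norm RS \<zeta> (\<tau> + \<sigma>) \<le> comp_norm RS \<zeta> \<tau> + comp_norm RS \<zeta> \<sigma>"
  using banach[of \<zeta>] proj_mem[of \<zeta>] by (simp add: comp_norm_def proj_simps banach_subspace_def)

lemma comp_norm_uminus: "\<zeta> \<in> hom_set RS \<Longrightarrow> comp_norm RS \<zeta> (- \<tau>) = comp_norm RS \<zeta> \<tau>"
proof -
  assume \<zeta>: "\<zeta> \<in> hom_set RS"
  have "hnorm RS \<zeta> ((-1) *\<^sub>R proj RS \<zeta> \<tau>) = \<bar>-1\<bar> * hnorm RS \<zeta> (proj RS \<zeta> \<tau>)"
    using banach[OF \<zeta>] proj_mem[OF \<zeta>, of \<tau>] unfolding banach_subspace_def by blast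
  then show ?thesis by (simp add: comp_norm_def proj_simps)
qed

lemma comp_norm_minus_commute: "\<zeta> \<in> hom_set RS \<Longrightarrow> comp_norm RS \<zeta> (\<tau> - \<sigma>) = comp_norm RS \<zeta> (\<sigma> - \<tau>)"
  using comp_norm_uminus[of \<zeta> "\<tau> - \<sigma>"] by simp

lemma comp_norm_diff: "\<zeta> \<in> hom_set RS \<Longrightarrow> comp_norm RS \<zeta> (\<tau> - \<sigma>) \<le> comp_norm RS \<zeta> \<tau> + comp_norm RS \<zeta> \<sigma>"
  using comp_norm_add[of \<zeta> \<tau> "- \<sigma>"] by (simp add: comp_norm_uminus)

lemma comp_norm_sum:
  assumes "\<zeta> \<in> hom_set RS" "finite S"
  shows "comp_norm RS \<zeta> (\<Sum>i\<in>S. f i) \<le> (\<Sum>i\<in>S. comp_norm RS \<zeta> (f i))"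
  using assms(2)
proof (induction S rule: finite_induct)
  case empty
  show ?case by (simp add: comp_norm_0 assms(1))
next
  case (insert i S)
  then show ?case
    using comp_norm_add[OF assms(1), of "f i" "sum f S"] by simp
qed

lemma comp_norm_triangle_diff:
  assumes "\<zeta> \<in> hom_set RS"
  shows "\<bar>comp_norm RS \<zeta> \<tau> - comp_norm RS \<zeta> \<sigma>\<bar> \<le> comp_norm RS \<zeta> (\<tau> - \<sigma>)"
  using comp_norm_add[OF assms, of "\<tau> - \<sigma>" \<sigma>] comp_norm_add[OF assms, of "\<sigma> - \<tau>" \<tau>]
    comp_norm_minus_commute[OF assms, of \<tau> \<sigma>] by simp

lemma comp_norm_proj_below:
  "\<zeta> \<in> hom_below RS g \<Longrightarrow> comp_norm RS \<zeta> (proj_below RS g \<tau>) = comp_norm RS \<zeta> \<tau>"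
  by (simp add: comp_norm_def proj_proj_below)

text \<open>
  Component \<open>\<beta>\<close> is weighted by \<open>l powr \<beta>\<close>. With these weights the
  analytic bound on the transport maps says precisely that a transport over a distance at most
  \<open>l\<close> is bounded uniformly in \<open>l\<close>, and an estimate of order \<open>\<gamma>\<close>
  for all components becomes the single bound \<open>wnorm g l \<tau> \<le> C * l powr \<gamma>\<close>.
\<close>

definition wnorm :: "real \<Rightarrow> real \<Rightarrow> 'v \<Rightarrow> real"
  where "wnorm g l \<tau> = (\<Sum>\<beta>\<in>hom_below RS g. l powr \<beta> * comp_norm RS \<beta> \<tau>)"

lemma wnorm_nonneg: "0 \<le> wnorm g l \<tau>"
  unfolding wnorm_def using comp_norm_nonneg hom_belowD(1) by (intro sum_nonneg) auto

lemma wnorm_0: "wnorm g l 0 = 0"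
  unfolding wnorm_def using comp_norm_0 hom_belowD(1) by (intro sum.neutral) auto

lemma wnorm_add: "wnorm g l (\<tau> + \<sigma>) \<le> wnorm g l \<tau> + wnorm g l \<sigma>"
  unfolding wnorm_def sum.distrib[symmetric] distrib_left[symmetric]
  using comp_norm_add hom_belowD(1) by (intro sum_mono mult_left_mono) auto

lemma wnorm_diff: "wnorm g l (\<tau> - \<sigma>) \<le> wnorm g l \<tau> + wnorm g l \<sigma>"
  unfolding wnorm_def sum.distrib[symmetric] distrib_left[symmetric]
  using comp_norm_diff hom_belowD(1) by (intro sum_mono mult_left_mono) auto

lemma wnorm_minus_commute: "wnorm g l (\<tau> - \<sigma>) = wnorm g l (\<sigma> - \<tau>)"
  unfolding wnorm_def using comp_norm_minus_commute hom_belowD(1) by (intro sum.cong refl) auto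

lemma comp_norm_le_wnorm:
  assumes "\<zeta> \<in> hom_below RS g" "0 < l"
  shows "comp_norm RS \<zeta> \<tau> \<le> l powr (- \<zeta>) * wnorm g l \<tau>"
proof -
  have "l powr \<zeta> * comp_norm RS \<zeta> \<tau> \<le> wnorm g l \<tau>"
    unfolding wnorm_def using assms finite_hom_below comp_norm_nonneg hom_belowD(1)
    by (intro member_le_sum[of _ _ "\<lambda>\<beta>. l powr \<beta> * comp_norm RS \<beta> \<tau>"]) auto
  then have "l powr (- \<zeta>) * (l powr \<zeta> * comp_norm RS \<zeta> \<tau>) \<le> l powr (- \<zeta>) * wnorm g l \<tau>"
    by (intro mult_left_mono) auto
  then show ?thesis
    using assms(2) by (simp add: mult.assoc[symmetric] powr_add[symmetric])
qed

lemma wnorm_leI: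
  assumes "\<And>\<beta>. \<beta> \<in> hom_below RS g \<Longrightarrow> l powr \<beta> * comp_norm RS \<beta> \<tau> \<le> B"
  shows "wnorm g l \<tau> \<le> real (card (hom_below RS g)) * B"
  unfolding wnorm_def using sum_bounded_above[of "hom_below RS g" _ B] assms by simp

lemma group_linear: "G \<in> structure_group RS \<Longrightarrow> linear G"
  using reg_structure by (simp add: is_regularity_structure_def)

lemma group_triangular:
  "G \<in> structure_group RS \<Longrightarrow> \<zeta> \<in> hom_set RS \<Longrightarrow> \<tau> \<in> hspace RS \<zeta> \<Longrightarrow> G \<tau> - \<tau> \<in> hspace_below RS \<zeta>"
  using reg_structure unfolding is_regularity_structure_def by blast

lemma group_hspace_below:
  assumes G: "G \<in> structure_group RS" and "\<tau> \<in> hspace_below RS g"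
  shows "G \<tau> \<in> hspace_below RS g"
  using assms(2) unfolding hspace_below_def[of RS g]
proof (induction rule: span_induct)
  case base
  show ?case
    unfolding subspace_def using subspace_span
    by (auto simp: linear_0[OF group_linear[OF G]] linear_add[OF group_linear[OF G]]
        linear_scale[OF group_linear[OF G]] span_zero span_add span_scale)
next
  case (step x)
  then obtain \<beta> where \<beta>: "\<beta> \<in> hom_below RS g" "x \<in> hspace RS \<beta>" by auto
  then have "G x - x \<in> hspace_below RS \<beta>" using group_triangular[OF G] hom_belowD(1) by blast
  then have "G x - x \<in> hspace_below RS g"
    using hspace_below_mono[of \<beta> g] hom_belowD(2)[OF \<beta>(1)] by auto
  then have "(G x - x) + x \<in> hspace_below RS g"
    using hspace_subset_below \<beta> by (intro subspace_add[OF subspace_hspace_below]) auto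
  then show ?case by (simp add: hspace_below_def)
qed

end

section \<open>Transport maps of a model\<close>

locale reg_model = reg_structure RS for RS :: "'v::real_vector regularity_structure" +
  fixes s :: "'d::finite \<Rightarrow> nat" and M :: "('d, 'v) model"
  assumes scaling: "scaling s" and model: "is_model s RS M"
begin

abbreviation "\<Gamma> \<equiv> model_Gamma M"

lemma Gamma_group: "\<Gamma> x y \<in> structure_group RS"
  using model by (simp add: is_model_def)

lemma linear_Gamma: "linear (\<Gamma> x y)"
  by (rule group_linear[OF Gamma_group])

lemmas Gamma_simps = linear_0[OF linear_Gamma] linear_add[OF linear_Gamma] linear_diff[OF linear_Gamma]
  linear_sum[OF linear_Gamma]

lemma Gamma_refl [simp]: "\<Gamma> x x \<tau> = \<tau>"
  using model by (simp add: is_model_def)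

lemma Gamma_Gamma [simp]: "\<Gamma> x z (\<Gamma> z y \<tau>) = \<Gamma> x y \<tau>"
proof -
  have "\<Gamma> x z \<circ> \<Gamma> z y = \<Gamma> x y" using model by (simp add: is_model_def)
  then show ?thesis by (metis comp_apply)
qed

lemma Gamma_below: "\<tau> \<in> hspace_below RS g \<Longrightarrow> \<Gamma> x y \<tau> \<in> hspace_below RS g"
  by (rule group_hspace_below[OF Gamma_group])

text \<open>
  The structure group is triangular: \<open>\<Gamma> x y \<tau> - \<tau>\<close> receives in component
  \<open>\<beta>\<close> contributions only from the components of \<open>\<tau>\<close> of strictly larger
  homogeneity, and each of them carries a positive power of \<open>l\<close>.
\<close>

lemma Gamma_diff_component:
  assumes "0 < g"
  shows "\<exists>C\<ge>0. \<forall>x y l \<tau>. \<forall>\<beta>\<in>hom_set RS. 0 < l \<longrightarrow> l \<le> 1 \<longrightarrow> scaled_norm s (x - y) \<le> l \<longrightarrow>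
    \<tau> \<in> hspace_below RS g \<longrightarrow>
    comp_norm RS \<beta> (\<Gamma> x y \<tau> - \<tau>)
      \<le> C * (\<Sum>\<zeta>\<in>{\<zeta>\<in>hom_below RS g. \<beta> < \<zeta>}. l powr (\<zeta> - \<beta>) * comp_norm RS \<zeta> \<tau>)"
proof -
  from model assms obtain C0 where C0: "\<And>x y \<zeta> \<tau> \<beta>. y \<in> scaled_ball s x 1 - {x} \<Longrightarrow>
      \<zeta> \<in> hom_below RS g \<Longrightarrow> \<tau> \<in> hspace RS \<zeta> \<Longrightarrow> \<beta> \<in> hom_set RS \<Longrightarrow> \<beta> \<le> \<zeta> \<Longrightarrow>
      comp_norm RS \<beta> (\<Gamma> x y \<tau>) \<le> C0 * hnorm RS \<zeta> \<tau> * scaled_norm s (x - y) powr (\<zeta> - \<beta>)"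
  proof -
    assume a: "is_model s RS M" "0 < g"
    have "\<exists>C. (\<forall>x. \<forall>y\<in>scaled_ball s x 1 - {x}. \<forall>\<zeta>\<in>hom_below RS g. \<forall>\<tau>\<in>hspace RS \<zeta>.
        \<forall>\<beta>\<in>hom_set RS. \<beta> \<le> \<zeta> \<longrightarrow>
          comp_norm RS \<beta> (\<Gamma> x y \<tau>) \<le> C * hnorm RS \<zeta> \<tau> * scaled_norm s (x - y) powr (\<zeta> - \<beta>))"
      using a unfolding is_model_def by meson
    then show ?thesis using that by meson
  qed
  define C where "C = max C0 0"
  have hom: "comp_norm RS \<beta> (\<Gamma> x y \<tau> - \<tau>) \<le> (if \<beta> < \<zeta> then C * (l powr (\<zeta> - \<beta>) * hnorm RS \<zeta> \<tau>) else 0)"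
    if l: "0 < l" "l \<le> 1" "scaled_norm s (x - y) \<le> l"
      and \<zeta>: "\<zeta> \<in> hom_below RS g" "\<tau> \<in> hspace RS \<zeta>" and \<beta>: "\<beta> \<in> hom_set RS" for x y l \<zeta> \<tau> \<beta>
  proof -
    note \<zeta>' = hom_belowD(1)[OF \<zeta>(1)]
    have nn: "0 \<le> hnorm RS \<zeta> \<tau>" using \<zeta> \<zeta>' by (intro hnorm_nonneg)
    show ?thesis
    proof (cases "\<beta> < \<zeta>")
      case False
      have "\<Gamma> x y \<tau> - \<tau> \<in> hspace_below RS \<zeta>"
        using group_triangular[OF Gamma_group \<zeta>' \<zeta>(2)] .
      then have "proj RS \<beta> (\<Gamma> x y \<tau> - \<tau>) = 0"
        by (rule proj_hspace_below) (use False in \<open>auto simp: hom_below_def\<close>)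
      then show ?thesis using False \<beta> by (simp add: comp_norm_proj_eq_0)
    next
      case True
      show ?thesis
      proof (cases "x = y")
        case True
        then show ?thesis using nn \<beta> by (simp add: comp_norm_0 C_def)
      next
        case False
        have "y \<in> scaled_ball s x 1 - {x}"
          using l False by (simp add: mem_scaled_ball scaled_norm_minus_commute[of s y])
        have "proj RS \<beta> \<tau> = 0" using proj_homogeneous[OF \<zeta>' \<zeta>(2)] True by simp
        then have "comp_norm RS \<beta> (\<Gamma> x y \<tau> - \<tau>) = comp_norm RS \<beta> (\<Gamma> x y \<tau>)"
          by (simp add: comp_norm_def proj_simps)
        also have "\<dots> \<le> C0 * hnorm RS \<zeta> \<tau> * scaled_norm s (x - y) powr (\<zeta> - \<beta>)"
          using True by (intro C0 \<open>y \<in> _\<close> \<zeta> \<beta>) auto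
        also have "\<dots> \<le> C * hnorm RS \<zeta> \<tau> * l powr (\<zeta> - \<beta>)"
          using l True nn by (intro mult_mono powr_mono2) (auto simp: C_def)
        finally show ?thesis using True by (simp add: mult_ac)
      qed
    qed
  qed
  have "comp_norm RS \<beta> (\<Gamma> x y \<tau> - \<tau>)
      \<le> C * (\<Sum>\<zeta>\<in>{\<zeta>\<in>hom_below RS g. \<beta> < \<zeta>}. l powr (\<zeta> - \<beta>) * comp_norm RS \<zeta> \<tau>)"
    if l: "0 < l" "l \<le> 1" "scaled_norm s (x - y) \<le> l"
      and \<tau>: "\<tau> \<in> hspace_below RS g" and \<beta>: "\<beta> \<in> hom_set RS" for x y l \<tau> \<beta>
  proof -
    let ?A = "hom_below RS g"
    have "\<Gamma> x y \<tau> - \<tau> = (\<Sum>\<zeta>\<in>?A. \<Gamma> x y (proj RS \<zeta> \<tau>) - proj RS \<zeta> \<tau>)"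
      using eq_sum_proj[OF \<tau>] by (metis Gamma_simps(4) sum_subtractf)
    then have "comp_norm RS \<beta> (\<Gamma> x y \<tau> - \<tau>) \<le> (\<Sum>\<zeta>\<in>?A. comp_norm RS \<beta> (\<Gamma> x y (proj RS \<zeta> \<tau>) - proj RS \<zeta> \<tau>))"
      using \<beta> finite_hom_below by (simp add: comp_norm_sum)
    also have "\<dots> \<le> (\<Sum>\<zeta>\<in>?A. if \<beta> < \<zeta> then C * (l powr (\<zeta> - \<beta>) * hnorm RS \<zeta> (proj RS \<zeta> \<tau>)) else 0)"
      using proj_mem hom_belowD(1) by (intro sum_mono hom l \<beta>) auto
    also have "\<dots> = C * (\<Sum>\<zeta>\<in>{\<zeta>\<in>?A. \<beta> < \<zeta>}. l powr (\<zeta> - \<beta>) * comp_norm RS \<zeta> \<tau>)"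
      using finite_hom_below
      by (simp add: sum.inter_filter[symmetric] sum_distrib_left comp_norm_def)
    finally show ?thesis .
  qed
  then show ?thesis by (intro exI[of _ C]) (auto simp: C_def)
qed

lemma wnorm_Gamma_diff:
  assumes "0 < g"
  shows "\<exists>C\<ge>0. \<forall>x y l \<tau>. 0 < l \<longrightarrow> l \<le> 1 \<longrightarrow> scaled_norm s (x - y) \<le> l \<longrightarrow>
    \<tau> \<in> hspace_below RS g \<longrightarrow> wnorm g l (\<Gamma> x y \<tau> - \<tau>) \<le> C * wnorm g l \<tau>"
proof -
  obtain C where C: "0 \<le> C" "\<And>x y l \<tau> \<beta>. \<beta> \<in> hom_set RS \<Longrightarrow> 0 < l \<Longrightarrow> l \<le> 1 \<Longrightarrow> scaled_norm s (x - y) \<le> l \<Longrightarrow>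
    \<tau> \<in> hspace_below RS g \<Longrightarrow> comp_norm RS \<beta> (\<Gamma> x y \<tau> - \<tau>)
      \<le> C * (\<Sum>\<zeta>\<in>{\<zeta>\<in>hom_below RS g. \<beta> < \<zeta>}. l powr (\<zeta> - \<beta>) * comp_norm RS \<zeta> \<tau>)"
    using Gamma_diff_component[OF assms] by blast
  have "wnorm g l (\<Gamma> x y \<tau> - \<tau>) \<le> real (card (hom_below RS g)) * (C * wnorm g l \<tau>)"
    if l: "0 < l" "l \<le> 1" "scaled_norm s (x - y) \<le> l" and \<tau>: "\<tau> \<in> hspace_below RS g" for x y l \<tau>
  proof (rule wnorm_leI)
    fix \<beta> assume \<beta>: "\<beta> \<in> hom_below RS g"
    have "l powr \<beta> * comp_norm RS \<beta> (\<Gamma> x y \<tau> - \<tau>)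
        \<le> l powr \<beta> * (C * (\<Sum>\<zeta>\<in>{\<zeta>\<in>hom_below RS g. \<beta> < \<zeta>}. l powr (\<zeta> - \<beta>) * comp_norm RS \<zeta> \<tau>))"
      using hom_belowD(1)[OF \<beta>] l \<tau> by (intro mult_left_mono C) auto
    also have "\<dots> = C * (\<Sum>\<zeta>\<in>{\<zeta>\<in>hom_below RS g. \<beta> < \<zeta>}. l powr \<zeta> * comp_norm RS \<zeta> \<tau>)"
    proof -
      have "l powr \<beta> * (\<Sum>\<zeta>\<in>{\<zeta>\<in>hom_below RS g. \<beta> < \<zeta>}. l powr (\<zeta> - \<beta>) * comp_norm RS \<zeta> \<tau>)
          = (\<Sum>\<zeta>\<in>{\<zeta>\<in>hom_below RS g. \<beta> < \<zeta>}. l powr \<zeta> * comp_norm RS \<zeta> \<tau>)"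
        unfolding sum_distrib_left
        by (intro sum.cong refl) (simp add: mult.assoc[symmetric] powr_add[symmetric])
      then show ?thesis by (simp only: mult.left_commute[of "l powr \<beta>" C])
    qed
    also have "\<dots> \<le> C * wnorm g l \<tau>"
      unfolding wnorm_def using C(1) finite_hom_below comp_norm_nonneg hom_belowD(1)
      by (intro mult_left_mono sum_mono2) auto
    finally show "l powr \<beta> * comp_norm RS \<beta> (\<Gamma> x y \<tau> - \<tau>) \<le> C * wnorm g l \<tau>" .
  qed
  then show ?thesis
    using C(1) by (intro exI[of _ "real (card (hom_below RS g)) * C"]) (auto simp: mult.assoc)
qed

lemma wnorm_Gamma_small:
  assumes "0 < g"
  obtains C where "1 \<le> C" "\<And>x y l \<tau>. 0 < l \<Longrightarrow> l \<le> 1 \<Longrightarrow> scaled_norm s (x - y) \<le> l \<Longrightarrow>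
    \<tau> \<in> hspace_below RS g \<Longrightarrow> wnorm g l (\<Gamma> x y \<tau>) \<le> C * wnorm g l \<tau>"
proof -
  obtain C where C: "0 \<le> C" "\<And>x y l \<tau>. 0 < l \<Longrightarrow> l \<le> 1 \<Longrightarrow> scaled_norm s (x - y) \<le> l \<Longrightarrow>
    \<tau> \<in> hspace_below RS g \<Longrightarrow> wnorm g l (\<Gamma> x y \<tau> - \<tau>) \<le> C * wnorm g l \<tau>"
    using wnorm_Gamma_diff[OF assms] by blast
  have "wnorm g l (\<Gamma> x y \<tau>) \<le> (C + 1) * wnorm g l \<tau>"
    if "0 < l" "l \<le> 1" "scaled_norm s (x - y) \<le> l" "\<tau> \<in> hspace_below RS g" for x y l \<tau>
    using wnorm_add[of g l "\<Gamma> x y \<tau> - \<tau>" \<tau>] C(2)[OF that] by (simp add: algebra_simps)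
  then show ?thesis using C(1) by (intro that[of "C + 1"]) auto
qed

text \<open>
  The model bounds \<open>\<Gamma>\<close> over distances at most 1. For larger ones the segment from
  \<open>y\<close> to \<open>x\<close> is cut into \<open>N\<close> equal pieces; a piece has scaled norm at
  most 1 once \<open>N\<close> dominates every coordinate of \<open>x - y\<close>, and the transports over the
  pieces compose.
\<close>

lemma wnorm_Gamma_far:
  assumes "0 < g"
  shows "\<exists>C\<ge>1. \<forall>x y \<tau>. scaled_norm s (x - y) \<le> R \<longrightarrow> \<tau> \<in> hspace_below RS g \<longrightarrow>
    wnorm g 1 (\<Gamma> x y \<tau>) \<le> C * wnorm g 1 \<tau>"
proof -
  obtain C where C: "1 \<le> C" "\<And>x y l \<tau>. 0 < l \<Longrightarrow> l \<le> 1 \<Longrightarrow> scaled_norm s (x - y) \<le> l \<Longrightarrow>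
    \<tau> \<in> hspace_below RS g \<Longrightarrow> wnorm g l (\<Gamma> x y \<tau>) \<le> C * wnorm g l \<tau>"
    by (rule wnorm_Gamma_small[OF assms]) blast
  define R' where "R' = max 1 R"
  obtain N :: nat where "R' ^ scaling_size s < real N" using reals_Archimedean2 by blast
  moreover have "1 \<le> R' ^ scaling_size s" by (simp add: R'_def one_le_power)
  ultimately have N: "0 < real N" "R' ^ scaling_size s \<le> real N" by auto
  have "wnorm g 1 (\<Gamma> x y \<tau>) \<le> C ^ N * wnorm g 1 \<tau>"
    if xy: "scaled_norm s (x - y) \<le> R" and \<tau>: "\<tau> \<in> hspace_below RS g" for x y \<tau>
  proof -
    define z where "z k = y + (real k / real N) *\<^sub>R (x - y)" for k
    have step: "scaled_norm s (z (Suc k) - z k) \<le> 1" for k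
    proof -
      have "\<bar>(z (Suc k) - z k) $ i\<bar> \<le> 1 ^ s i" for i
      proof -
        have "scaled_norm s (x - y) \<le> R'" "0 \<le> R'" using xy by (auto simp: R'_def)
        then have "\<bar>(x - y) $ i\<bar> \<le> R' ^ s i" using scaled_norm_le_iff[OF scaling] by blast
        also have "\<dots> \<le> R' ^ scaling_size s"
          unfolding scaling_size_def by (intro power_increasing member_le_sum) (auto simp: R'_def)
        also note N(2)
        finally have "\<bar>(x - y) $ i\<bar> / real N \<le> 1" using N(1) by simp
        moreover have "z (Suc k) - z k = (1 / real N) *\<^sub>R (x - y)"
          by (simp add: z_def add_divide_distrib scaleR_left_distrib)
        ultimately show ?thesis using N(1) by (simp add: abs_mult)
      qed
      then show ?thesis by (simp add: scaled_norm_le_iff[OF scaling])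
    qed
    have "wnorm g 1 (\<Gamma> (z k) y \<tau>) \<le> C ^ k * wnorm g 1 \<tau>" for k
    proof (induction k)
      case 0
      then show ?case by (simp add: z_def)
    next
      case (Suc k)
      have "wnorm g 1 (\<Gamma> (z (Suc k)) (z k) (\<Gamma> (z k) y \<tau>)) \<le> C * wnorm g 1 (\<Gamma> (z k) y \<tau>)"
        by (intro C(2) step Gamma_below \<tau>) auto
      also have "\<dots> \<le> C * (C ^ k * wnorm g 1 \<tau>)"
        using C(1) by (intro mult_left_mono Suc) auto
      finally show ?case by (simp add: mult.assoc)
    qed
    from this[of N] show ?thesis using N(1) by (simp add: z_def)
  qed
  then show ?thesis using C(1) by (intro exI[of _ "C ^ N"]) (auto simp: one_le_power)
qed

text \<open>
  The radius 4 is the one of the averages in \<open>F_norm\<close> at scale 1. For \<open>l \<in>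
  {1..4}\<close> the norms \<open>wnorm g l\<close> and \<open>wnorm g 1\<close> are equivalent.
\<close>

lemma wnorm_Gamma:
  assumes "0 < g"
  obtains C where "1 \<le> C" "\<And>x y l \<tau>. 0 < l \<Longrightarrow> l \<le> 4 \<Longrightarrow> scaled_norm s (x - y) \<le> l \<Longrightarrow>
    \<tau> \<in> hspace_below RS g \<Longrightarrow> wnorm g l (\<Gamma> x y \<tau>) \<le> C * wnorm g l \<tau>"
proof -
  obtain C1 where C1: "1 \<le> C1" "\<And>x y l \<tau>. 0 < l \<Longrightarrow> l \<le> 1 \<Longrightarrow> scaled_norm s (x - y) \<le> l \<Longrightarrow>
    \<tau> \<in> hspace_below RS g \<Longrightarrow> wnorm g l (\<Gamma> x y \<tau>) \<le> C1 * wnorm g l \<tau>"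
    by (rule wnorm_Gamma_small[OF assms]) blast
  obtain C2 where C2: "1 \<le> C2" "\<And>x y \<tau>. scaled_norm s (x - y) \<le> 4 \<Longrightarrow> \<tau> \<in> hspace_below RS g \<Longrightarrow>
    wnorm g 1 (\<Gamma> x y \<tau>) \<le> C2 * wnorm g 1 \<tau>"
    using wnorm_Gamma_far[OF assms, of 4] by blast
  define B where "B = (\<Sum>\<beta>\<in>hom_below RS g. \<bar>\<beta>\<bar>)"
  have B: "\<bar>\<beta>\<bar> \<le> B" if "\<beta> \<in> hom_below RS g" for \<beta>
    unfolding B_def using that finite_hom_below by (intro member_le_sum) auto
  have pw: "l powr \<beta> \<le> 4 powr B" "1 \<le> 4 powr B * l powr \<beta>"
    if "1 \<le> l" "l \<le> 4" "\<beta> \<in> hom_below RS g" for l \<beta>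
  proof -
    have 1: "l powr b \<le> 4 powr B" if "b \<le> B" for b
    proof -
      have "l powr b \<le> l powr B" using \<open>1 \<le> l\<close> that by (intro powr_mono) auto
      also have "\<dots> \<le> 4 powr B" using \<open>1 \<le> l\<close> \<open>l \<le> 4\<close> B[OF \<open>\<beta> \<in> _\<close>] by (intro powr_mono2) auto
      finally show ?thesis .
    qed
    show "l powr \<beta> \<le> 4 powr B" using B[OF that(3)] by (intro 1) auto
    have "l powr (- \<beta>) * l powr \<beta> \<le> 4 powr B * l powr \<beta>"
      using B[OF that(3)] by (intro mult_right_mono 1) auto
    then show "1 \<le> 4 powr B * l powr \<beta>" using that by (simp add: powr_add[symmetric])
  qed
  have big: "wnorm g l (\<Gamma> x y \<tau>) \<le> (4 powr B * C2 * 4 powr B) * wnorm g l \<tau>"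
    if l: "1 \<le> l" "l \<le> 4" "scaled_norm s (x - y) \<le> l" and \<tau>: "\<tau> \<in> hspace_below RS g" for x y l \<tau>
  proof -
    have "wnorm g l (\<Gamma> x y \<tau>) \<le> 4 powr B * wnorm g 1 (\<Gamma> x y \<tau>)"
      unfolding wnorm_def sum_distrib_left using pw(1)[OF l(1,2)] comp_norm_nonneg hom_belowD(1)
      by (intro sum_mono) (auto intro!: mult_right_mono)
    also have "\<dots> \<le> 4 powr B * (C2 * wnorm g 1 \<tau>)"
      using l \<tau> by (intro mult_left_mono C2) auto
    also have "\<dots> \<le> 4 powr B * (C2 * (4 powr B * wnorm g l \<tau>))"
    proof (intro mult_left_mono)
      show "wnorm g 1 \<tau> \<le> 4 powr B * wnorm g l \<tau>"
        unfolding wnorm_def sum_distrib_left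
      proof (intro sum_mono)
        fix \<beta> assume \<beta>: "\<beta> \<in> hom_below RS g"
        have "1 * comp_norm RS \<beta> \<tau> \<le> (4 powr B * l powr \<beta>) * comp_norm RS \<beta> \<tau>"
          using pw(2)[OF l(1,2) \<beta>] comp_norm_nonneg[OF hom_belowD(1)[OF \<beta>]] by (intro mult_right_mono) auto
        then show "1 powr \<beta> * comp_norm RS \<beta> \<tau> \<le> 4 powr B * (l powr \<beta> * comp_norm RS \<beta> \<tau>)"
          by (simp add: mult.assoc)
      qed
    qed (use C2(1) in auto)
    finally show ?thesis by (simp add: mult.assoc)
  qed
  let ?C = "max C1 (4 powr B * C2 * 4 powr B)"
  have "wnorm g l (\<Gamma> x y \<tau>) \<le> ?C * wnorm g l \<tau>"
    if l: "0 < l" "l \<le> 4" "scaled_norm s (x - y) \<le> l" and \<tau>: "\<tau> \<in> hspace_below RS g" for x y l \<tau>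
  proof (cases "l \<le> 1")
    case True
    then have "wnorm g l (\<Gamma> x y \<tau>) \<le> C1 * wnorm g l \<tau>" using l \<tau> by (intro C1) auto
    also have "\<dots> \<le> ?C * wnorm g l \<tau>" by (intro mult_right_mono wnorm_nonneg) auto
    finally show ?thesis .
  next
    case False
    then have "wnorm g l (\<Gamma> x y \<tau>) \<le> (4 powr B * C2 * 4 powr B) * wnorm g l \<tau>" using l \<tau> by (intro big) auto
    also have "\<dots> \<le> ?C * wnorm g l \<tau>" by (intro mult_right_mono wnorm_nonneg) auto
    finally show ?thesis .
  qed
  then show ?thesis using C1(1) by (intro that[of ?C]) auto
qed

text \<open>
  Finitely many homogeneities lie below \<open>g\<close>, so their differences have a positive minimum
  \<open>\<delta>\<close>.
\<close>

lemma Gamma_modulus: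
  assumes "0 < g"
  obtains C \<delta> where "0 \<le> C" "0 < \<delta>" "\<And>x y \<tau>. scaled_norm s (x - y) \<le> 1 \<Longrightarrow> \<tau> \<in> hspace_below RS g \<Longrightarrow>
    wnorm g 1 (\<Gamma> x y \<tau> - \<tau>) \<le> C * scaled_norm s (x - y) powr \<delta> * wnorm g 1 \<tau>"
proof -
  let ?A = "hom_below RS g"
  obtain C where C: "0 \<le> C" "\<And>x y l \<tau> \<beta>. \<beta> \<in> hom_set RS \<Longrightarrow> 0 < l \<Longrightarrow> l \<le> 1 \<Longrightarrow> scaled_norm s (x - y) \<le> l \<Longrightarrow>
    \<tau> \<in> hspace_below RS g \<Longrightarrow> comp_norm RS \<beta> (\<Gamma> x y \<tau> - \<tau>)
      \<le> C * (\<Sum>\<zeta>\<in>{\<zeta>\<in>?A. \<beta> < \<zeta>}. l powr (\<zeta> - \<beta>) * comp_norm RS \<zeta> \<tau>)"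
    using Gamma_diff_component[OF assms] by blast
  define G where "G = insert 1 ((\<lambda>(\<zeta>, \<beta>). \<zeta> - \<beta>) ` {(\<zeta>, \<beta>) \<in> ?A \<times> ?A. \<beta> < \<zeta>})"
  have finG: "finite G" unfolding G_def using finite_hom_below by (auto intro: finite_subset[of _ "?A \<times> ?A"])
  define \<delta> where "\<delta> = Min G"
  have \<delta>: "0 < \<delta>" unfolding \<delta>_def using finG by (subst Min_gr_iff) (auto simp: G_def)
  have gap: "\<delta> \<le> \<zeta> - \<beta>" if "\<zeta> \<in> ?A" "\<beta> \<in> ?A" "\<beta> < \<zeta>" for \<zeta> \<beta>
    unfolding \<delta>_def using that by (intro Min_le finG) (auto simp: G_def)
  let ?K = "real (card ?A) * C"
  have "wnorm g 1 (\<Gamma> x y \<tau> - \<tau>) \<le> ?K * scaled_norm s (x - y) powr \<delta> * wnorm g 1 \<tau>"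
    if xy: "scaled_norm s (x - y) \<le> 1" and \<tau>: "\<tau> \<in> hspace_below RS g" for x y \<tau>
  proof (cases "x = y")
    case True
    then show ?thesis using C(1) by (simp add: wnorm_0 wnorm_nonneg)
  next
    case False
    let ?t = "scaled_norm s (x - y)"
    have t: "0 < ?t" using False by (simp add: scaled_norm_pos[OF scaling])
    have "wnorm g 1 (\<Gamma> x y \<tau> - \<tau>) \<le> real (card ?A) * (C * (?t powr \<delta> * wnorm g 1 \<tau>))"
    proof (rule wnorm_leI)
      fix \<beta> assume \<beta>: "\<beta> \<in> ?A"
      have "comp_norm RS \<beta> (\<Gamma> x y \<tau> - \<tau>) \<le> C * (\<Sum>\<zeta>\<in>{\<zeta>\<in>?A. \<beta> < \<zeta>}. ?t powr (\<zeta> - \<beta>) * comp_norm RS \<zeta> \<tau>)"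
        using hom_belowD(1)[OF \<beta>] t xy \<tau> by (intro C) auto
      also have "\<dots> \<le> C * (\<Sum>\<zeta>\<in>{\<zeta>\<in>?A. \<beta> < \<zeta>}. ?t powr \<delta> * comp_norm RS \<zeta> \<tau>)"
        using C(1) gap \<beta> t xy comp_norm_nonneg hom_belowD(1)
        by (intro mult_left_mono sum_mono mult_right_mono powr_mono') auto
      also have "\<dots> \<le> C * (\<Sum>\<zeta>\<in>?A. ?t powr \<delta> * comp_norm RS \<zeta> \<tau>)"
        using C(1) finite_hom_below comp_norm_nonneg hom_belowD(1)
        by (intro mult_left_mono sum_mono2) auto
      finally show "1 powr \<beta> * comp_norm RS \<beta> (\<Gamma> x y \<tau> - \<tau>) \<le> C * (?t powr \<delta> * wnorm g 1 \<tau>)"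
        by (simp add: wnorm_def sum_distrib_left)
    qed
    then show ?thesis by (simp add: mult.assoc)
  qed
  then show ?thesis using C(1) \<delta> by (intro that[of ?K \<delta>]) auto
qed

lemma comp_norm_le_wnorm1: "\<zeta> \<in> hom_below RS g \<Longrightarrow> comp_norm RS \<zeta> \<tau> \<le> wnorm g 1 \<tau>"
  using comp_norm_le_wnorm[of \<zeta> g 1 \<tau>] by simp

text \<open>
  The analytic bounds make \<open>\<Gamma>\<close> jointly continuous: both \<open>\<Gamma> a' b' = \<Gamma>
  a' a \<circ> \<Gamma> a b'\<close> and \<open>\<Gamma> a b' = \<Gamma> a b \<circ> \<Gamma> b b'\<close>
  contain one transport over a short distance, to which the modulus of continuity applies. This is the source
  of all measurability of increments.
\<close>

lemma continuous_Gamma: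
  assumes g: "0 < g" and w: "w \<in> hspace_below RS g" and \<zeta>: "\<zeta> \<in> hom_below RS g"
  shows "continuous_on UNIV (\<lambda>(a, b). comp_norm RS \<zeta> (v - \<Gamma> a b w))"
proof -
  obtain C \<delta> where C: "0 \<le> C" and \<delta>: "0 < \<delta>" and mod: "\<And>x y \<tau>. scaled_norm s (x - y) \<le> 1 \<Longrightarrow> \<tau> \<in> hspace_below RS g \<Longrightarrow>
    wnorm g 1 (\<Gamma> x y \<tau> - \<tau>) \<le> C * scaled_norm s (x - y) powr \<delta> * wnorm g 1 \<tau>"
    by (rule Gamma_modulus[OF g]) blast
  have "isCont (\<lambda>(a, b). comp_norm RS \<zeta> (v - \<Gamma> a b w)) (a, b)" for a b
  proof -
    obtain K where K: "1 \<le> K" "\<And>\<tau>. \<tau> \<in> hspace_below RS g \<Longrightarrow> wnorm g 1 (\<Gamma> a b \<tau>) \<le> K * wnorm g 1 \<tau>"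
      using wnorm_Gamma_far[OF g, of "scaled_norm s (a - b)"] by blast
    let ?W = "wnorm g 1 w"
    let ?F = "at (a, b)"
    let ?t = "\<lambda>z. scaled_norm s (fst z - a)" and ?u = "\<lambda>z. scaled_norm s (b - snd z)"
    have lim: "((\<lambda>z. ?t z) \<longlongrightarrow> 0) ?F" "((\<lambda>z. ?u z) \<longlongrightarrow> 0) ?F"
    proof -
      have 1: "((\<lambda>z. fst z) \<longlongrightarrow> a) ?F" and 2: "((\<lambda>z. snd z) \<longlongrightarrow> b) ?F"
        using tendsto_fst[OF tendsto_ident_at, of "(a, b)" UNIV] tendsto_snd[OF tendsto_ident_at, of "(a, b)" UNIV] by simp_all
      show "((\<lambda>z. ?t z) \<longlongrightarrow> 0) ?F"
        using tendsto_diff[OF 1 tendsto_const[of a]] by (intro scaled_norm_tendsto_0[OF scaling]) simp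
      show "((\<lambda>z. ?u z) \<longlongrightarrow> 0) ?F"
        using tendsto_diff[OF tendsto_const[of b] 2] by (intro scaled_norm_tendsto_0[OF scaling]) simp
    qed
    have pw: "((\<lambda>z. ?t z powr \<delta>) \<longlongrightarrow> 0) ?F" "((\<lambda>z. ?u z powr \<delta>) \<longlongrightarrow> 0) ?F"
      using lim \<delta> by (auto intro!: tendsto_zero_powrI[of _ _ _ \<delta>] always_eventually)
    have "((\<lambda>z. C * ?t z powr \<delta> * (K * (?W + C * ?u z powr \<delta> * ?W)) + K * (C * ?u z powr \<delta> * ?W)) \<longlongrightarrow>
        C * 0 * (K * (?W + C * 0 * ?W)) + K * (C * 0 * ?W)) ?F"
      by (intro tendsto_intros pw)
    then have lim0: "((\<lambda>z. C * ?t z powr \<delta> * (K * (?W + C * ?u z powr \<delta> * ?W)) + K * (C * ?u z powr \<delta> * ?W)) \<longlongrightarrow> 0) ?F"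
      by simp
    have ev: "\<forall>\<^sub>F z in ?F. ?t z < 1 \<and> ?u z < 1"
      using order_tendstoD(2)[OF lim(1), of 1] order_tendstoD(2)[OF lim(2), of 1] by (auto elim: eventually_conj)
    have "\<forall>\<^sub>F z in ?F. norm (comp_norm RS \<zeta> (v - \<Gamma> (fst z) (snd z) w) - comp_norm RS \<zeta> (v - \<Gamma> a b w))
        \<le> C * ?t z powr \<delta> * (K * (?W + C * ?u z powr \<delta> * ?W)) + K * (C * ?u z powr \<delta> * ?W)"
      using ev
    proof eventually_elim
      case (elim z)
      let ?a = "fst z" and ?b = "snd z"
      have h: "\<Gamma> b ?b w - w \<in> hspace_below RS g"
        by (intro subspace_diff[OF subspace_hspace_below] Gamma_below w)
      have m1: "wnorm g 1 (\<Gamma> b ?b w - w) \<le> C * ?u z powr \<delta> * ?W"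
        using elim by (intro mod w) auto
      have "wnorm g 1 (\<Gamma> a ?b w) = wnorm g 1 (\<Gamma> a b (\<Gamma> b ?b w))" by simp
      also have "\<dots> \<le> K * wnorm g 1 ((\<Gamma> b ?b w - w) + w)"
        using K(2)[of "\<Gamma> b ?b w"] Gamma_below[OF w] by simp
      also have "\<dots> \<le> K * (?W + C * ?u z powr \<delta> * ?W)"
        using K(1) m1 wnorm_add[of g 1 "\<Gamma> b ?b w - w" w] by (intro mult_left_mono) auto
      finally have m2: "wnorm g 1 (\<Gamma> a ?b w) \<le> K * (?W + C * ?u z powr \<delta> * ?W)" .
      have "wnorm g 1 (\<Gamma> ?a a (\<Gamma> a ?b w) - \<Gamma> a ?b w) \<le> C * ?t z powr \<delta> * wnorm g 1 (\<Gamma> a ?b w)"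
        using elim by (intro mod Gamma_below w) auto
      also have "\<dots> \<le> C * ?t z powr \<delta> * (K * (?W + C * ?u z powr \<delta> * ?W))"
        using C by (intro mult_left_mono m2) auto
      finally have m3: "wnorm g 1 (\<Gamma> ?a ?b w - \<Gamma> a ?b w) \<le> C * ?t z powr \<delta> * (K * (?W + C * ?u z powr \<delta> * ?W))"
        by simp
      have "wnorm g 1 (\<Gamma> a ?b w - \<Gamma> a b w) = wnorm g 1 (\<Gamma> a b (\<Gamma> b ?b w - w))"
        by (simp add: Gamma_simps)
      also have "\<dots> \<le> K * (C * ?u z powr \<delta> * ?W)"
        using K(1) m1 by (intro order_trans[OF K(2)[OF h]] mult_left_mono) auto
      finally have m4: "wnorm g 1 (\<Gamma> a ?b w - \<Gamma> a b w) \<le> K * (C * ?u z powr \<delta> * ?W)" .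
      have "norm (comp_norm RS \<zeta> (v - \<Gamma> ?a ?b w) - comp_norm RS \<zeta> (v - \<Gamma> a b w))
          \<le> comp_norm RS \<zeta> ((v - \<Gamma> ?a ?b w) - (v - \<Gamma> a b w))"
        unfolding real_norm_def by (rule comp_norm_triangle_diff[OF hom_belowD(1)[OF \<zeta>]])
      also have "\<dots> = comp_norm RS \<zeta> (\<Gamma> a b w - \<Gamma> ?a ?b w)" by simp
      also have "\<dots> \<le> wnorm g 1 (\<Gamma> a b w - \<Gamma> ?a ?b w)"
        by (intro comp_norm_le_wnorm1 \<zeta>)
      also have "\<dots> = wnorm g 1 ((\<Gamma> ?a ?b w - \<Gamma> a ?b w) + (\<Gamma> a ?b w - \<Gamma> a b w))"
        by (subst wnorm_minus_commute) simp
      also have "\<dots> \<le> wnorm g 1 (\<Gamma> ?a ?b w - \<Gamma> a ?b w) + wnorm g 1 (\<Gamma> a ?b w - \<Gamma> a b w)"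
        by (rule wnorm_add)
      finally show ?case using m3 m4 by linarith
    qed
    then have "((\<lambda>z. comp_norm RS \<zeta> (v - \<Gamma> (fst z) (snd z) w) - comp_norm RS \<zeta> (v - \<Gamma> a b w)) \<longlongrightarrow> 0) ?F"
      using lim0 by (rule Lim_null_comparison)
    then show ?thesis
      unfolding isCont_def case_prod_unfold by (simp add: LIM_zero_iff)
  qed
  then show ?thesis by (auto simp: continuous_on_eq_continuous_at)
qed

section \<open>Borel representatives\<close>

text \<open>
  Fields that are limits, at every point and in every component, of simple functions with Borel level sets.
  Working with Borel instead of Lebesgue measurability keeps the map \<open>(x, h) \<mapsto> F (x + h)\<close>
  within the product \<open>\<sigma>\<close>-algebra.
\<close>

definition borel_field :: "real \<Rightarrow> (real^'d \<Rightarrow> 'v) \<Rightarrow> bool"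
  where "borel_field g F \<longleftrightarrow> (\<forall>x. F x \<in> hspace_below RS g) \<and>
    (\<exists>U. (\<forall>n. simple_function lborel (U n)) \<and> (\<forall>n x. U n x \<in> hspace_below RS g) \<and>
         (\<forall>x. (\<lambda>n::nat. wnorm g 1 (U n x - F x)) \<longlonglongrightarrow> 0))"

lemma borel_representative:
  assumes sm: "strongly_measurable RS g f" and f: "\<And>x. f x \<in> hspace_below RS g"
  obtains N where "N \<in> null_sets lborel" "borel_field g (\<lambda>x. if x \<in> N then 0 else f x)"
proof -
  let ?A = "hom_below RS g"
  have "\<forall>\<zeta>\<in>?A. \<exists>v::nat \<Rightarrow> real^'d \<Rightarrow> 'v. (\<forall>n. simple_function lborel (v n)) \<and>
     (AE x in lborel. (\<forall>n. v n x \<in> hspace RS \<zeta>) \<and> (\<lambda>n. hnorm RS \<zeta> (v n x - proj RS \<zeta> (f x))) \<longlonglongrightarrow> 0)"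
  proof
    fix \<zeta> assume "\<zeta> \<in> ?A"
    with sm obtain u where u: "\<And>n. simple_function lebesgue (u n)" "\<And>n. range (u n) \<subseteq> hspace RS \<zeta>"
      "AE x in lebesgue. (\<lambda>n::nat. hnorm RS \<zeta> (u n x - proj RS \<zeta> (f x))) \<longlonglongrightarrow> 0"
      unfolding strongly_measurable_def by blast
    have "\<forall>n. \<exists>v. simple_function lborel v \<and> (AE x in lborel. u n x = v x)"
      using completion_ex_simple_function[OF u(1)] by blast
    then obtain v where v: "\<And>n. simple_function lborel (v n)" "\<And>n. AE x in lborel. u n x = v n x"
      by metis
    have "AE x in lborel. \<forall>n. u n x = v n x"
      using v(2) by (simp add: AE_all_countable)
    moreover have "AE x in lborel. (\<lambda>n. hnorm RS \<zeta> (u n x - proj RS \<zeta> (f x))) \<longlonglongrightarrow> 0"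
      using u(3) by (simp add: AE_completion_iff)
    ultimately have "AE x in lborel. (\<forall>n. v n x \<in> hspace RS \<zeta>) \<and> (\<lambda>n. hnorm RS \<zeta> (v n x - proj RS \<zeta> (f x))) \<longlonglongrightarrow> 0"
    proof eventually_elim
      case (elim x)
      then have "(\<lambda>n. u n x) = (\<lambda>n. v n x)" by auto
      then show ?case using elim u(2) by (metis rangeI subsetD)
    qed
    then show "\<exists>v::nat \<Rightarrow> real^'d \<Rightarrow> 'v. (\<forall>n. simple_function lborel (v n)) \<and>
     (AE x in lborel. (\<forall>n. v n x \<in> hspace RS \<zeta>) \<and> (\<lambda>n. hnorm RS \<zeta> (v n x - proj RS \<zeta> (f x))) \<longlonglongrightarrow> 0)"
      using v(1) by blast
  qed
  from bchoice[OF this] obtain v where v: "\<And>\<zeta> n. \<zeta> \<in> ?A \<Longrightarrow> simple_function lborel (v \<zeta> n)"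
    "\<And>\<zeta>. \<zeta> \<in> ?A \<Longrightarrow> AE x in lborel. (\<forall>n::nat. v \<zeta> n x \<in> hspace RS \<zeta>) \<and> (\<lambda>n. hnorm RS \<zeta> (v \<zeta> n x - proj RS \<zeta> (f x))) \<longlonglongrightarrow> 0"
    by blast
  have "AE x in lborel. \<forall>\<zeta>\<in>?A. (\<forall>n. v \<zeta> n x \<in> hspace RS \<zeta>) \<and> (\<lambda>n. hnorm RS \<zeta> (v \<zeta> n x - proj RS \<zeta> (f x))) \<longlonglongrightarrow> 0"
    using v(2) finite_hom_below by (intro AE_finite_allI) auto
  then obtain N where N: "\<And>x. x \<notin> N \<Longrightarrow> \<forall>\<zeta>\<in>?A. (\<forall>n. v \<zeta> n x \<in> hspace RS \<zeta>) \<and> (\<lambda>n. hnorm RS \<zeta> (v \<zeta> n x - proj RS \<zeta> (f x))) \<longlonglongrightarrow> 0"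
    and Nn: "N \<in> null_sets lborel"
    by (rule AE_E3) auto
  define U where "U n x = (if x \<in> N then 0 else \<Sum>\<zeta>\<in>?A. v \<zeta> n x)" for n x
  have sN: "simple_function lborel (\<lambda>x. x \<in> N)"
  proof -
    have "(\<lambda>x. x \<in> N) -` {b} \<in> sets borel" for b
      using Nn by (cases b) (auto simp: vimage_def Compl_eq[symmetric])
    moreover have "finite (range (\<lambda>x. x \<in> N))" by (rule finite_subset[of _ UNIV]) auto
    ultimately show ?thesis by (simp add: simple_function_def)
  qed
  have "simple_function lborel (U n)" for n
    unfolding U_def
    by (rule simple_function_compose2[OF sN, of "\<lambda>x. \<Sum>\<zeta>\<in>?A. v \<zeta> n x" "\<lambda>b w. if b then 0 else w"])
       (use v(1) in auto)
  moreover have "U n x \<in> hspace_below RS g" for n x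
  proof (cases "x \<in> N")
    case False
    then show ?thesis
      unfolding U_def if_not_P[OF False] using N[OF False]
      by (intro subspace_sum[OF subspace_hspace_below] subsetD[OF hspace_subset_below]) auto
  qed (simp add: U_def subspace_0[OF subspace_hspace_below])
  moreover have "(\<lambda>n. wnorm g 1 (U n x - (if x \<in> N then 0 else f x))) \<longlonglongrightarrow> 0" for x
  proof (cases "x \<in> N")
    case True
    then show ?thesis by (simp add: U_def wnorm_0)
  next
    case False
    have "wnorm g 1 (U n x - f x) = (\<Sum>\<beta>\<in>?A. hnorm RS \<beta> (v \<beta> n x - proj RS \<beta> (f x)))" for n
    proof -
      have "proj RS \<beta> (U n x) = v \<beta> n x" if \<beta>: "\<beta> \<in> ?A" for \<beta>
      proof -
        have "proj RS \<beta> (U n x) = (\<Sum>\<zeta>\<in>?A. if \<beta> = \<zeta> then v \<zeta> n x else 0)"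
          unfolding U_def if_not_P[OF False] proj_simps
          using N[OF False] hom_belowD(1) by (intro sum.cong refl proj_homogeneous) auto
        also have "\<dots> = v \<beta> n x" using \<beta> finite_hom_below by simp
        finally show ?thesis .
      qed
      then show ?thesis by (simp add: wnorm_def comp_norm_def proj_simps)
    qed
    moreover have "(\<lambda>n. \<Sum>\<beta>\<in>?A. hnorm RS \<beta> (v \<beta> n x - proj RS \<beta> (f x))) \<longlonglongrightarrow> (\<Sum>\<beta>\<in>?A. 0)"
      using N[OF False] by (intro tendsto_sum) auto
    ultimately show ?thesis using False by simp
  qed
  ultimately have "borel_field g (\<lambda>x. if x \<in> N then 0 else f x)"
    unfolding borel_field_def using f subspace_0[OF subspace_hspace_below]
    by (intro conjI allI exI[of _ U]) simp_all
  with Nn show ?thesis by (rule that)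
qed

lemma borel_field_below: "borel_field g F \<Longrightarrow> F x \<in> hspace_below RS g"
  by (simp add: borel_field_def)

lemma measurable_into_range:
  assumes "simple_function lborel U" "f \<in> measurable N lborel"
  shows "(\<lambda>z. U (f z)) \<in> measurable N (count_space (range U))"
proof -
  have "U \<in> measurable lborel (count_space (range U))"
    using simple_functionD(2)[OF assms(1)] by (auto simp: measurable_def)
  from measurable_compose[OF assms(2) this] show ?thesis .
qed

text \<open>
  If \<open>F\<close> is simple, its increment is pieced together from the finitely many continuous functions
  \<open>(x, h) \<mapsto> comp_norm RS \<zeta> (v - \<Gamma> (x + h) x w)\<close> with \<open>v\<close>,
  \<open>w\<close> in the range of \<open>F\<close>; the general case follows by a pointwise limit, since
  \<open>\<Gamma> (x + h) x\<close> is bounded for fixed \<open>x\<close> and \<open>h\<close>.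
\<close>

lemma measurable_increment:
  assumes F: "borel_field g F" and \<zeta>: "\<zeta> \<in> hom_below RS g" and g: "0 < g"
  shows "(\<lambda>(x, h). increment RS M \<zeta> F x h) \<in> borel_measurable (borel \<Otimes>\<^sub>M borel)"
proof -
  obtain U where U: "\<And>n. simple_function lborel (U n)" "\<And>n x. U n x \<in> hspace_below RS g"
    "\<And>x. (\<lambda>n::nat. wnorm g 1 (U n x - F x)) \<longlonglongrightarrow> 0"
    using F unfolding borel_field_def by blast
  have meas: "(\<lambda>z. comp_norm RS \<zeta> (U n (fst z + snd z) - \<Gamma> (fst z + snd z) (fst z) (U n (fst z))))
      \<in> borel_measurable (borel \<Otimes>\<^sub>M borel)" for n
  proof -
    have c: "(\<lambda>z. comp_norm RS \<zeta> (v - \<Gamma> (fst z + snd z) (fst z) w)) \<in> borel_measurable (borel \<Otimes>\<^sub>M borel)"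
      if "w \<in> range (U n)" for v w
    proof -
      have "(\<lambda>(a, b). comp_norm RS \<zeta> (v - \<Gamma> a b w)) \<in> borel_measurable borel"
        using that U(2) by (intro borel_measurable_continuous_onI continuous_Gamma[OF g _ \<zeta>]) auto
      then have m: "(\<lambda>(a, b). comp_norm RS \<zeta> (v - \<Gamma> a b w)) \<in> borel_measurable (borel \<Otimes>\<^sub>M borel)"
        by (simp add: borel_prod)
      have "(\<lambda>z. (fst z + snd z, fst z)) \<in> measurable (borel \<Otimes>\<^sub>M borel) (borel \<Otimes>\<^sub>M (borel :: (real^'d) measure))"
        by measurable
      from measurable_compose[OF this m] show ?thesis by simp
    qed
    have "(\<lambda>z. comp_norm RS \<zeta> (v - \<Gamma> (fst z + snd z) (fst z) (U n (fst z)))) \<in> borel_measurable (borel \<Otimes>\<^sub>M borel)" for v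
      by (rule measurable_compose_countable'[OF c measurable_into_range[OF U(1)]])
         (auto intro: countable_finite simple_functionD(1)[OF U(1), simplified])
    then show ?thesis
      by (rule measurable_compose_countable'[where f="\<lambda>v z. comp_norm RS \<zeta> (v - \<Gamma> (fst z + snd z) (fst z) (U n (fst z)))",
            OF _ measurable_into_range[OF U(1)]])
         (auto intro: countable_finite simple_functionD(1)[OF U(1), simplified])
  qed
  have lim: "(\<lambda>n. comp_norm RS \<zeta> (U n (x + h) - \<Gamma> (x + h) x (U n x))) \<longlonglongrightarrow> increment RS M \<zeta> F x h" for x h
  proof -
    obtain K where K: "1 \<le> K" "\<And>\<tau>. \<tau> \<in> hspace_below RS g \<Longrightarrow> wnorm g 1 (\<Gamma> (x + h) x \<tau>) \<le> K * wnorm g 1 \<tau>"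
      using wnorm_Gamma_far[OF g, of "scaled_norm s (x + h - x)"] by blast
    have bound: "norm (comp_norm RS \<zeta> (U n (x + h) - \<Gamma> (x + h) x (U n x)) - increment RS M \<zeta> F x h)
        \<le> wnorm g 1 (U n (x + h) - F (x + h)) + K * wnorm g 1 (U n x - F x)" for n
    proof -
      have "norm (comp_norm RS \<zeta> (U n (x + h) - \<Gamma> (x + h) x (U n x)) - increment RS M \<zeta> F x h)
          \<le> comp_norm RS \<zeta> ((U n (x + h) - \<Gamma> (x + h) x (U n x)) - (F (x + h) - \<Gamma> (x + h) x (F x)))"
        unfolding increment_def real_norm_def by (rule comp_norm_triangle_diff[OF hom_belowD(1)[OF \<zeta>]])
      also have "\<dots> \<le> wnorm g 1 ((U n (x + h) - \<Gamma> (x + h) x (U n x)) - (F (x + h) - \<Gamma> (x + h) x (F x)))"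
        by (intro comp_norm_le_wnorm1 \<zeta>)
      also have "(U n (x + h) - \<Gamma> (x + h) x (U n x)) - (F (x + h) - \<Gamma> (x + h) x (F x))
          = (U n (x + h) - F (x + h)) - \<Gamma> (x + h) x (U n x - F x)"
        by (simp add: Gamma_simps)
      also have "wnorm g 1 \<dots> \<le> wnorm g 1 (U n (x + h) - F (x + h)) + wnorm g 1 (\<Gamma> (x + h) x (U n x - F x))"
        by (rule wnorm_diff)
      also have "\<dots> \<le> wnorm g 1 (U n (x + h) - F (x + h)) + K * wnorm g 1 (U n x - F x)"
        using U(2) borel_field_below[OF F] by (intro add_left_mono K subspace_diff[OF subspace_hspace_below])
      finally show ?thesis .
    qed
    have "(\<lambda>n. wnorm g 1 (U n (x + h) - F (x + h)) + K * wnorm g 1 (U n x - F x)) \<longlonglongrightarrow> 0 + K * 0"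
      by (intro tendsto_intros U)
    then have "(\<lambda>n. wnorm g 1 (U n (x + h) - F (x + h)) + K * wnorm g 1 (U n x - F x)) \<longlonglongrightarrow> 0" by simp
    from Lim_null_comparison[OF always_eventually[OF allI[OF bound]] this]
    have "(\<lambda>n. comp_norm RS \<zeta> (U n (x + h) - \<Gamma> (x + h) x (U n x)) - increment RS M \<zeta> F x h) \<longlonglongrightarrow> 0" .
    then show ?thesis by (simp add: LIM_zero_iff)
  qed
  show ?thesis
    unfolding case_prod_unfold by (rule borel_measurable_LIMSEQ_real[OF lim meas])
qed

lemma measurable_comp_norm:
  assumes F: "borel_field g F" and \<zeta>: "\<zeta> \<in> hom_below RS g"
  shows "(\<lambda>x. comp_norm RS \<zeta> (F x)) \<in> borel_measurable borel"
proof -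
  obtain U where U: "\<And>n. simple_function lborel (U n)"
    "\<And>x. (\<lambda>n::nat. wnorm g 1 (U n x - F x)) \<longlonglongrightarrow> 0"
    using F unfolding borel_field_def by blast
  have meas: "(\<lambda>x. comp_norm RS \<zeta> (U n x)) \<in> borel_measurable borel" for n
    using borel_measurable_simple_function[OF simple_function_compose1[OF U(1), of "comp_norm RS \<zeta>"], of n] by simp
  have lim: "(\<lambda>n. comp_norm RS \<zeta> (U n x)) \<longlonglongrightarrow> comp_norm RS \<zeta> (F x)" for x
  proof -
    have bound: "norm (comp_norm RS \<zeta> (U n x) - comp_norm RS \<zeta> (F x)) \<le> wnorm g 1 (U n x - F x)" for n
      using comp_norm_triangle_diff[OF hom_belowD(1)[OF \<zeta>], of "U n x" "F x"]
        comp_norm_le_wnorm1[OF \<zeta>, of "U n x - F x"] by simp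
    from Lim_null_comparison[OF always_eventually[OF allI[OF bound]] U(2)]
    have "(\<lambda>n. comp_norm RS \<zeta> (U n x) - comp_norm RS \<zeta> (F x)) \<longlonglongrightarrow> 0" .
    then show ?thesis by (simp add: LIM_zero_iff)
  qed
  show ?thesis by (rule borel_measurable_LIMSEQ_real[OF lim meas])
qed

section \<open>A sharp maximal function\<close>

text \<open>
  A dyadic version of the supremum over \<open>l\<close> of the averaged increments at scale \<open>l\<close>,
  divided by \<open>l powr (g - \<zeta>)\<close>. Being a countable supremum it is a measurable function of
  \<open>x\<close>. It starts at \<open>n = 1\<close> because the comparison with \<open>F_norm\<close> at
  scale \<open>1 / 2\<^sup>n\<close> uses all scales up to \<open>2 / 2\<^sup>n\<close>.
\<close>

definition osc :: "real \<Rightarrow> (real^'d \<Rightarrow> 'v) \<Rightarrow> real \<Rightarrow> real^'d \<Rightarrow> ennreal"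
  where "osc g F \<zeta> x = (SUP n\<in>{1::nat..}. ennreal (2 ^ (n * scaling_size s) * 2 powr (real n * (g - \<zeta>))) *
    (\<integral>\<^sup>+h. ennreal (increment RS M \<zeta> F x h) * indicator (scaled_ball s 0 (4 / 2 ^ n)) h \<partial>lborel))"

text \<open>
  Including the size of \<open>F\<close> makes a point where the sharp function is small control the value of
  \<open>F\<close> there, which starts the chains below.
\<close>

definition sharp :: "real \<Rightarrow> (real^'d \<Rightarrow> 'v) \<Rightarrow> real^'d \<Rightarrow> ennreal"
  where "sharp g F x = (\<Sum>\<zeta>\<in>hom_below RS g. ennreal (comp_norm RS \<zeta> (F x)) + osc g F \<zeta> x)"

lemma measurable_osc:
  assumes F: "borel_field g F" and \<zeta>: "\<zeta> \<in> hom_below RS g" and g: "0 < g"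
  shows "osc g F \<zeta> \<in> borel_measurable borel"
proof -
  have m: "(\<lambda>x. \<integral>\<^sup>+h. ennreal (increment RS M \<zeta> F x h) * indicator (scaled_ball s 0 r) h \<partial>lborel) \<in> borel_measurable borel" for r
  proof -
    have [measurable]: "(\<lambda>(x, h). increment RS M \<zeta> F x h) \<in> borel_measurable (borel \<Otimes>\<^sub>M borel)"
      by (rule measurable_increment[OF assms])
    have [measurable]: "scaled_ball s (0 :: real^'d) r \<in> sets borel"
      using scaling by simp
    show ?thesis by measurable
  qed
  show ?thesis
    unfolding osc_def by (intro borel_measurable_SUP borel_measurable_times_ennreal m) auto
qed

lemma measurable_sharp:
  assumes "borel_field g F" "0 < g"
  shows "sharp g F \<in> borel_measurable borel"
  unfolding sharp_def
  using measurable_comp_norm[OF assms(1)] measurable_osc[OF assms(1) _ assms(2)]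
  by (intro borel_measurable_sum borel_measurable_add) auto

lemma comp_norm_le_sharp:
  assumes "\<zeta> \<in> hom_below RS g"
  shows "ennreal (comp_norm RS \<zeta> (F x)) \<le> sharp g F x"
proof -
  have "ennreal (comp_norm RS \<zeta> (F x)) + osc g F \<zeta> x \<le> sharp g F x"
    unfolding sharp_def using assms finite_hom_below
    by (intro member_le_sum[of _ _ "\<lambda>\<zeta>. ennreal (comp_norm RS \<zeta> (F x)) + osc g F \<zeta> x"]) auto
  then show ?thesis by (auto intro: order_trans[rotated])
qed

lemma nn_integral_wnorm_increment_le:
  assumes F: "borel_field g F" and g: "0 < g" and n: "1 \<le> n"
  defines "l \<equiv> 1 / 2 ^ n"
  shows "(\<integral>\<^sup>+z. ennreal (wnorm g l (F z - \<Gamma> z x (F x))) * indicator (scaled_ball s x (4 * l)) z \<partial>lborel)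
    \<le> ennreal (l powr g * l ^ scaling_size s) * sharp g F x"
    and "(\<lambda>z. wnorm g l (F z - \<Gamma> z x (F x))) \<in> borel_measurable borel"
proof -
  let ?A = "hom_below RS g" and ?N = "scaling_size s"
  have [measurable]: "scaled_ball s y r \<in> sets borel" for y :: "real^'d" and r
    using scaling by simp
  have incr: "increment RS M \<zeta> F x \<in> borel_measurable borel" if "\<zeta> \<in> ?A" for \<zeta>
  proof -
    have "(\<lambda>h. case_prod (increment RS M \<zeta> F) (x, h)) \<in> borel_measurable borel"
      using measurable_increment[OF F that g] by (intro measurable_compose[OF _ measurable_increment[OF F that g]]) auto
    then show ?thesis by simp
  qed
  have w_eq: "wnorm g l (F z - \<Gamma> z x (F x)) = (\<Sum>\<zeta>\<in>?A. l powr \<zeta> * increment RS M \<zeta> F x (z - x))" for z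
    by (simp add: wnorm_def increment_def)
  have incr': "(\<lambda>z. increment RS M \<zeta> F x (z - x)) \<in> borel_measurable borel" if "\<zeta> \<in> ?A" for \<zeta>
    by (rule measurable_compose[OF _ incr[OF that]]) auto
  show m: "(\<lambda>z. wnorm g l (F z - \<Gamma> z x (F x))) \<in> borel_measurable borel"
    unfolding w_eq using incr' by (intro borel_measurable_sum borel_measurable_times) auto
  have "(\<integral>\<^sup>+z. ennreal (wnorm g l (F z - \<Gamma> z x (F x))) * indicator (scaled_ball s x (4 * l)) z \<partial>lborel)
      = (\<integral>\<^sup>+z. ennreal (wnorm g l (F z - \<Gamma> z x (F x))) * indicator (scaled_ball s x (4 * l)) z \<partial>distr lborel borel ((+) x))"
    by (simp only: lborel_distr_plus)
  also have "\<dots> = (\<integral>\<^sup>+h. ennreal (wnorm g l (F (x + h) - \<Gamma> (x + h) x (F x))) * indicator (scaled_ball s x (4 * l)) (x + h) \<partial>lborel)"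
    using m by (intro nn_integral_distr) auto
  also have "\<dots> = (\<integral>\<^sup>+h. (\<Sum>\<zeta>\<in>?A. ennreal (l powr \<zeta>) * (ennreal (increment RS M \<zeta> F x h) * indicator (scaled_ball s 0 (4 / 2 ^ n)) h)) \<partial>lborel)"
  proof (intro nn_integral_cong)
    fix h
    have nn: "0 \<le> increment RS M \<zeta> F x h" if "\<zeta> \<in> ?A" for \<zeta>
      unfolding increment_def using comp_norm_nonneg hom_belowD(1)[OF that] by auto
    have "ennreal (wnorm g l (F (x + h) - \<Gamma> (x + h) x (F x))) = (\<Sum>\<zeta>\<in>?A. ennreal (l powr \<zeta>) * ennreal (increment RS M \<zeta> F x h))"
      unfolding w_eq using nn by (subst sum_ennreal[symmetric]) (auto simp: ennreal_mult')
    then show "ennreal (wnorm g l (F (x + h) - \<Gamma> (x + h) x (F x))) * indicator (scaled_ball s x (4 * l)) (x + h)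
      = (\<Sum>\<zeta>\<in>?A. ennreal (l powr \<zeta>) * (ennreal (increment RS M \<zeta> F x h) * indicator (scaled_ball s 0 (4 / 2 ^ n)) h))"
      by (simp add: l_def mem_scaled_ball sum_distrib_right mult.assoc indicator_def)
  qed
  also have "\<dots> = (\<Sum>\<zeta>\<in>?A. ennreal (l powr \<zeta>) * (\<integral>\<^sup>+h. ennreal (increment RS M \<zeta> F x h) * indicator (scaled_ball s 0 (4 / 2 ^ n)) h \<partial>lborel))"
    using incr by (simp add: nn_integral_sum nn_integral_cmult)
  also have "\<dots> \<le> (\<Sum>\<zeta>\<in>?A. ennreal (l powr g * l ^ ?N) * osc g F \<zeta> x)"
  proof (intro sum_mono)
    fix \<zeta> assume \<zeta>: "\<zeta> \<in> ?A"
    let ?I = "\<integral>\<^sup>+h. ennreal (increment RS M \<zeta> F x h) * indicator (scaled_ball s 0 (4 / 2 ^ n)) h \<partial>lborel"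
    have pw: "l powr \<zeta> = l powr g * l ^ ?N * (2 ^ (n * ?N) * 2 powr (real n * (g - \<zeta>)))"
    proof -
      have "l powr b = 2 powr (- (real n * b))" for b
        by (simp add: l_def powr_divide powr_powr powr_minus_divide flip: powr_realpow)
      moreover have "l ^ ?N * 2 ^ (n * ?N) = 1"
        by (simp add: l_def power_mult power_one_over)
      ultimately show ?thesis
        by (simp add: powr_add[symmetric] algebra_simps)
    qed
    have "ennreal (l powr \<zeta>) * ?I = ennreal (l powr g * l ^ ?N) * (ennreal (2 ^ (n * ?N) * 2 powr (real n * (g - \<zeta>))) * ?I)"
      unfolding pw by (simp add: l_def ennreal_mult' mult.assoc)
    also have "\<dots> \<le> ennreal (l powr g * l ^ ?N) * osc g F \<zeta> x"
      unfolding osc_def using n by (intro mult_left_mono SUP_upper) auto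
    finally show "ennreal (l powr \<zeta>) * ?I \<le> ennreal (l powr g * l ^ ?N) * osc g F \<zeta> x" .
  qed
  also have "\<dots> \<le> ennreal (l powr g * l ^ ?N) * sharp g F x"
    unfolding sharp_def sum_distrib_left[symmetric] by (intro mult_left_mono sum_mono) auto
  finally show "(\<integral>\<^sup>+z. ennreal (wnorm g l (F z - \<Gamma> z x (F x))) * indicator (scaled_ball s x (4 * l)) z \<partial>lborel)
    \<le> ennreal (l powr g * l ^ ?N) * sharp g F x" .
qed

text \<open>
  Averages control values: for \<open>z\<close> close to \<open>x\<close> and \<open>y\<close>, both \<open>F
  x\<close> and \<open>F y\<close> can be compared with \<open>F z\<close>, \<open>F x - \<Gamma> x y (F y) =
  \<Gamma> x z (F z - \<Gamma> z y (F y)) - \<Gamma> x z (F z - \<Gamma> z x (F x))\<close>, and averaging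
  over \<open>z\<close> in the box of radius \<open>l = 1 / 2\<^sup>n\<close> around \<open>x\<close> replaces
  the two terms by sharp functions. That box is contained in the boxes of radius \<open>4 * l\<close> around
  \<open>x\<close> and around \<open>y\<close> as soon as \<open>x\<close> and \<open>y\<close> are at
  distance at most \<open>3 * l\<close>.
\<close>

lemma pointwise_increment_le_sharp:
  assumes g: "0 < g"
  obtains C where "0 < C" "\<And>F n x y. borel_field g F \<Longrightarrow> 1 \<le> n \<Longrightarrow> scaled_norm s (x - y) \<le> 3 / 2 ^ n \<Longrightarrow>
    ennreal (wnorm g (1 / 2 ^ n) (F x - \<Gamma> x y (F y))) \<le> ennreal (C * (1 / 2 ^ n) powr g) * (sharp g F x + sharp g F y)"
proof -
  obtain C where C: "1 \<le> C" "\<And>x y l \<tau>. 0 < l \<Longrightarrow> l \<le> 4 \<Longrightarrow> scaled_norm s (x - y) \<le> l \<Longrightarrow>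
    \<tau> \<in> hspace_below RS g \<Longrightarrow> wnorm g l (\<Gamma> x y \<tau>) \<le> C * wnorm g l \<tau>"
    by (rule wnorm_Gamma[OF g]) blast
  have "ennreal (wnorm g (1 / 2 ^ n) (F x - \<Gamma> x y (F y))) \<le> ennreal (C * (1 / 2 ^ n) powr g) * (sharp g F x + sharp g F y)"
    if F: "borel_field g F" and n: "1 \<le> n" and xy: "scaled_norm s (x - y) \<le> 3 / 2 ^ n" for F n x y
  proof -
    define l where "l = 1 / (2::real) ^ n"
    let ?N = "scaling_size s"
    have "(1::real) \<le> 2 ^ n" by simp
    then have "(1::real) \<le> 4 * 2 ^ n" by linarith
    then have l: "0 < l" "l \<le> 4" by (simp_all add: l_def divide_le_eq)
    let ?\<phi> = "\<lambda>x z. wnorm g l (F z - \<Gamma> z x (F x))"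
    let ?W = "wnorm g l (F x - \<Gamma> x y (F y))"
    have bal[measurable]: "scaled_ball s y r \<in> sets borel" for y :: "real^'d" and r
      using scaling by simp
    have [measurable]: "?\<phi> x \<in> borel_measurable borel" for x
      unfolding l_def by (rule nn_integral_wnorm_increment_le(2)[OF F g n])
    have pt: "?W \<le> C * (?\<phi> x z + ?\<phi> y z)" if z: "z \<in> scaled_ball s x l" for z
    proof -
      have xz: "scaled_norm s (x - z) \<le> l"
        using z by (simp add: mem_scaled_ball scaled_norm_minus_commute)
      have mem: "F a - \<Gamma> a b (F b) \<in> hspace_below RS g" for a b
        using borel_field_below[OF F] by (intro subspace_diff[OF subspace_hspace_below] Gamma_below)
      have "F x - \<Gamma> x y (F y) = \<Gamma> x z (F z - \<Gamma> z y (F y)) - \<Gamma> x z (F z - \<Gamma> z x (F x))"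
        by (simp add: Gamma_simps)
      then have "?W \<le> wnorm g l (\<Gamma> x z (F z - \<Gamma> z y (F y))) + wnorm g l (\<Gamma> x z (F z - \<Gamma> z x (F x)))"
        using wnorm_diff by metis
      also have "\<dots> \<le> C * ?\<phi> y z + C * ?\<phi> x z"
        by (intro add_mono C l xz mem)
      finally show ?thesis by (simp add: algebra_simps)
    qed
    have sub: "scaled_ball s x l \<subseteq> scaled_ball s x (4 * l)" "scaled_ball s x l \<subseteq> scaled_ball s y (4 * l)"
    proof -
      show "scaled_ball s x l \<subseteq> scaled_ball s x (4 * l)" using l by (auto simp: mem_scaled_ball)
      show "scaled_ball s x l \<subseteq> scaled_ball s y (4 * l)"
      proof
        fix z assume "z \<in> scaled_ball s x l"
        then have "scaled_norm s (z - x) \<le> l" by (simp add: mem_scaled_ball)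
        then have "scaled_norm s ((z - x) + (x - y)) \<le> l + 3 * l"
          using xy scaled_norm_triangle[OF scaling, of "z - x" "x - y"] by (simp add: l_def)
        then show "z \<in> scaled_ball s y (4 * l)" by (simp add: mem_scaled_ball)
      qed
    qed
    have "ennreal (l ^ ?N) * ennreal ?W \<le> emeasure lborel (scaled_ball s x l) * ennreal ?W"
    proof (intro mult_right_mono)
      have "1 * l ^ ?N \<le> 2 ^ CARD('d) * l ^ ?N"
        using l by (intro mult_right_mono) (auto simp: one_le_power)
      then show "ennreal (l ^ ?N) \<le> emeasure lborel (scaled_ball s x l)"
        using l by (simp add: emeasure_scaled_ball[OF scaling] ennreal_leI)
    qed auto
    also have "\<dots> = (\<integral>\<^sup>+z. ennreal ?W * indicator (scaled_ball s x l) z \<partial>lborel)"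
      by (subst nn_integral_cmult_indicator) (auto simp: mult.commute)
    also have "\<dots> \<le> (\<integral>\<^sup>+z. ennreal C * (ennreal (?\<phi> x z) * indicator (scaled_ball s x (4 * l)) z
                      + ennreal (?\<phi> y z) * indicator (scaled_ball s y (4 * l)) z) \<partial>lborel)"
    proof (intro nn_integral_mono)
      fix z show "ennreal ?W * indicator (scaled_ball s x l) z \<le> ennreal C * (ennreal (?\<phi> x z) * indicator (scaled_ball s x (4 * l)) z
                      + ennreal (?\<phi> y z) * indicator (scaled_ball s y (4 * l)) z)"
      proof (cases "z \<in> scaled_ball s x l")
        case True
        then have "ennreal ?W \<le> ennreal (C * (?\<phi> x z + ?\<phi> y z))" by (intro ennreal_leI pt)
        moreover have "z \<in> scaled_ball s x (4 * l)" "z \<in> scaled_ball s y (4 * l)"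
          using True sub by auto
        ultimately show ?thesis using True C(1)
          by (simp add: ennreal_mult' ennreal_plus wnorm_nonneg)
      qed simp
    qed
    also have "\<dots> = ennreal C * ((\<integral>\<^sup>+z. ennreal (?\<phi> x z) * indicator (scaled_ball s x (4 * l)) z \<partial>lborel)
                      + (\<integral>\<^sup>+z. ennreal (?\<phi> y z) * indicator (scaled_ball s y (4 * l)) z \<partial>lborel))"
      by (simp add: nn_integral_cmult nn_integral_add)
    also have "\<dots> \<le> ennreal C * (ennreal (l powr g * l ^ ?N) * sharp g F x + ennreal (l powr g * l ^ ?N) * sharp g F y)"
      unfolding l_def by (intro mult_left_mono add_mono nn_integral_wnorm_increment_le(1)[OF F g n]) auto
    also have "\<dots> = ennreal (l ^ ?N) * (ennreal (C * l powr g) * (sharp g F x + sharp g F y))"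
      using C(1) l by (simp add: ennreal_mult' distrib_left mult_ac)
    finally show ?thesis
      using l ennreal_mult_le_mult_iff[of "ennreal (l ^ ?N)"] by (simp add: l_def[symmetric])
  qed
  then show ?thesis using C(1) by (intro that[of C]) auto
qed

end

section \<open>Chaining through good points\<close>

lemma telescope_tail_le:
  fixes b :: "nat \<Rightarrow> real"
  assumes step: "\<And>n. n0 \<le> n \<Longrightarrow> b n \<le> b (Suc n) + K * \<rho> ^ n" and lim: "b \<longlonglongrightarrow> 0"
    and \<rho>: "0 < \<rho>" "\<rho> < 1" and n: "n0 \<le> n"
  shows "b n \<le> K * \<rho> ^ n / (1 - \<rho>)"
proof -
  define c where "c n = b n - K * \<rho> ^ n / (1 - \<rho>)" for n
  have "c n \<le> c (n + k)" for k
  proof (induction k)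
    case (Suc k)
    have "K * \<rho> ^ (n + k) / (1 - \<rho>) - K * \<rho> ^ Suc (n + k) / (1 - \<rho>) = (K * \<rho> ^ (n + k) * (1 - \<rho>)) / (1 - \<rho>)"
      unfolding diff_divide_distrib[symmetric] by (simp add: algebra_simps)
    also have "\<dots> = K * \<rho> ^ (n + k)" using \<rho> by simp
    finally have "K * \<rho> ^ (n + k) / (1 - \<rho>) - K * \<rho> ^ Suc (n + k) / (1 - \<rho>) = K * \<rho> ^ (n + k)" .
    then show ?case using Suc step[of "n + k"] n by (simp add: c_def)
  qed simp
  then have "\<And>k. n \<le> k \<Longrightarrow> c n \<le> c k" by (metis le_Suc_ex)
  moreover have "c \<longlonglongrightarrow> 0 - K * 0 / (1 - \<rho>)"
    unfolding c_def using \<rho> by (intro tendsto_intros lim LIMSEQ_realpow_zero) auto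
  ultimately have "c n \<le> 0"
    by (intro LIMSEQ_le_const[of c 0 "c n"]) auto
  then show ?thesis by (simp add: c_def)
qed

lemma telescope_growth_le:
  fixes b :: "nat \<Rightarrow> real"
  assumes step: "\<And>n. 1 \<le> n \<Longrightarrow> b (Suc n) \<le> b n + K * \<rho> ^ n" and start: "b 1 \<le> B * \<rho>"
    and \<rho>: "1 < \<rho>" and K: "0 \<le> K" "0 \<le> B" and n: "1 \<le> n"
  shows "b n \<le> (B + K / (\<rho> - 1)) * \<rho> ^ n"
  using n
proof (induction n rule: dec_induct)
  case base
  have "0 \<le> K / (\<rho> - 1) * \<rho>" using K \<rho> by simp
  then show ?case using start by (simp add: distrib_right)
next
  case (step m)
  have "b (Suc m) \<le> (B + K / (\<rho> - 1)) * \<rho> ^ m + K * \<rho> ^ m"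
    using step assms(1)[of m] by simp
  also have "\<dots> = (B + K / (\<rho> - 1) + K) * \<rho> ^ m"
    by (simp add: distrib_right)
  also have "\<dots> \<le> ((B + K / (\<rho> - 1)) * \<rho>) * \<rho> ^ m"
  proof (intro mult_right_mono)
    have "(B + K / (\<rho> - 1)) * \<rho> = B + K / (\<rho> - 1) + B * (\<rho> - 1) + K"
      using \<rho> by (simp add: field_simps)
    moreover have "0 \<le> B * (\<rho> - 1)" using K \<rho> by simp
    ultimately show "B + K / (\<rho> - 1) + K \<le> (B + K / (\<rho> - 1)) * \<rho>" by linarith
  qed (use \<rho> in simp)
  finally show ?case by (simp add: mult.assoc)
qed

lemma ennreal_mult_add:
  "0 \<le> c \<Longrightarrow> 0 \<le> x \<Longrightarrow> 0 \<le> y \<Longrightarrow> ennreal c * (ennreal x + ennreal y) = ennreal (c * (x + y))"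
  by (simp add: ennreal_mult)

lemma half_power_powr: "(1 / 2 ^ n) powr x = (2 powr (- x) :: real) ^ n"
  by (simp add: powr_divide powr_powr powr_minus_divide mult.commute flip: powr_realpow)

lemma half_power_powr_eq_powr: "(1 / 2 ^ n) powr x = (2 powr (- (real n * x)) :: real)"
  unfolding half_power_powr by (subst powr_realpow[symmetric]) (simp_all add: powr_powr mult.commute)

text \<open>
  Otherwise \<open>f\<close> would exceed its mean everywhere on \<open>A\<close>, and its integral over this
  set of positive measure would be larger than itself.
\<close>

lemma exists_le_average:
  assumes A: "A \<in> sets M" "emeasure M A = ennreal V" "0 < V" and [measurable]: "f \<in> borel_measurable M"
  shows "\<exists>z\<in>A. f z * ennreal V \<le> (\<integral>\<^sup>+x. f x * indicator A x \<partial>M)"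
proof (rule ccontr)
  let ?I = "\<integral>\<^sup>+x. f x * indicator A x \<partial>M"
  assume "\<not> ?thesis"
  then have less: "?I < f z * ennreal V" if "z \<in> A" for z using that by (auto simp: not_le)
  have ne: "A \<noteq> {}" using A by auto
  then have "?I < top" using less by (metis ex_in_conv less_top order_less_le_trans top_greatest)
  then obtain i where i: "?I = ennreal i" "0 \<le> i" by (cases ?I) auto
  have cz: "ennreal (i / V) < f z" if "z \<in> A" for z
  proof (cases "f z")
    case (real u)
    then have "ennreal i < ennreal (u * V)"
      using less[OF that] A(3) i by (simp add: ennreal_mult)
    then have "i / V < u" using A(3) i by (simp add: ennreal_less_iff field_simps)
    then show ?thesis using real i A(3) by (simp add: ennreal_less_iff)
  qed simp
  have cI: "(\<integral>\<^sup>+x. ennreal (i / V) * indicator A x \<partial>M) = ?I"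
    using A i by (simp add: nn_integral_cmult_indicator ennreal_mult'[symmetric])
  have "(\<integral>\<^sup>+x. ennreal (i / V) * indicator A x \<partial>M) < ?I"
  proof (rule nn_integral_less)
    show "(\<integral>\<^sup>+x. ennreal (i / V) * indicator A x \<partial>M) \<noteq> \<infinity>" unfolding cI i by simp
    show "AE x in M. ennreal (i / V) * indicator A x \<le> f x * indicator A x"
      using cz by (auto simp: indicator_def less_imp_le)
    show "\<not> (AE x in M. f x * indicator A x \<le> ennreal (i / V) * indicator A x)"
    proof
      assume "AE x in M. f x * indicator A x \<le> ennreal (i / V) * indicator A x"
      then have "AE x in M. x \<notin> A"
        by eventually_elim (use cz in \<open>auto simp: indicator_def not_le[symmetric] split: if_splits\<close>)
      then have "emeasure M A = 0"
        using A(1) by (subst (asm) AE_iff_null_sets[symmetric]) auto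
      then show False using A by simp
    qed
  qed (use A in auto)
  then show False using cI by simp
qed

context reg_model
begin

text \<open>
  What \<open>dyadic_average_majorant\<close> with radius constant 1 provides for \<open>D\<close> and its
  majorant \<open>H\<close>.
\<close>

definition averages_dominated :: "real \<Rightarrow> real \<Rightarrow> (real^'d \<Rightarrow> ennreal) \<Rightarrow> (real^'d \<Rightarrow> ennreal) \<Rightarrow> bool"
  where "averages_dominated p a D H \<longleftrightarrow> (\<forall>x m. ennreal (2 ^ (m * scaling_size s)) *
      (\<integral>\<^sup>+y. enn_powr (D y) p * indicator (scaled_ball s x (1 / 2 ^ m)) y \<partial>lborel)
    \<le> enn_powr (ennreal (2 powr (real m * a)) * H x) p)"

lemma good_point_exists:
  assumes dom: "averages_dominated p a D H" and [measurable]: "D \<in> borel_measurable borel" and p: "0 < p"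
  shows "\<exists>z. scaled_norm s (z - x) \<le> 1 / 2 ^ m \<and> D z \<le> ennreal (2 powr (real m * a)) * H x"
proof -
  let ?N = "scaling_size s" and ?B = "scaled_ball s x (1 / 2 ^ m)"
  let ?V = "2 ^ CARD('d) * (1 / 2 ^ m) ^ ?N :: real"
  have "\<exists>z\<in>?B. enn_powr (D z) p * ennreal ?V \<le> (\<integral>\<^sup>+y. enn_powr (D y) p * indicator ?B y \<partial>lborel)"
    using scaling by (intro exists_le_average) (auto simp: emeasure_scaled_ball)
  then obtain z where z: "z \<in> ?B" "enn_powr (D z) p * ennreal ?V \<le> (\<integral>\<^sup>+y. enn_powr (D y) p * indicator ?B y \<partial>lborel)"
    by blast
  have V: "1 \<le> 2 ^ (m * ?N) * ?V"
    by (simp add: power_mult power_one_over)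
  have "enn_powr (D z) p = ennreal 1 * enn_powr (D z) p" by simp
  also have "\<dots> \<le> ennreal (2 ^ (m * ?N) * ?V) * enn_powr (D z) p"
    using V by (intro mult_right_mono ennreal_leI) auto
  also have "\<dots> = ennreal (2 ^ (m * ?N)) * (enn_powr (D z) p * ennreal ?V)"
    by (simp add: ennreal_mult' mult_ac)
  also have "\<dots> \<le> ennreal (2 ^ (m * ?N)) * (\<integral>\<^sup>+y. enn_powr (D y) p * indicator ?B y \<partial>lborel)"
    by (intro mult_left_mono z(2)) auto
  also have "\<dots> \<le> enn_powr (ennreal (2 powr (real m * a)) * H x) p"
    using dom by (simp add: averages_dominated_def)
  finally have "D z \<le> ennreal (2 powr (real m * a)) * H x"
    unfolding enn_powr_le_iff[OF p] using p by (simp add: enn_powr_powr)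
  then show ?thesis using z(1) by (auto simp: mem_scaled_ball)
qed

text \<open>
  The points \<open>X m\<close> approach \<open>x\<close> and the sharp function at \<open>X m\<close> is at
  most \<open>2 powr (m * (g - g1)) * h\<close>. Put \<open>v m = \<Gamma> x (X m) (F (X m))\<close>. By
  \<open>pointwise_increment_le_sharp\<close>, the difference of \<open>v m\<close> and \<open>v (m +
  1)\<close> has weighted norm of order \<open>(1 / 2\<^sup>m) powr g * 2 powr (m * (g - g1)) * h = (1 /
  2\<^sup>m) powr g1 * h\<close>: the growth of the sharp function costs exactly the difference of the orders.
  Component \<open>\<beta>\<close> of the increments of \<open>v\<close> is thus of order \<open>2 powr (m *
  (\<beta> - g1)) * h\<close>. For \<open>\<beta> < g1\<close> these are summable, and summing from
  \<open>n\<close> to infinity, where \<open>v\<close> tends to \<open>F x\<close>, estimates \<open>F x - v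
  n\<close>. For \<open>\<beta> > g1\<close> the component is not present in the truncation, and \<open>v
  n\<close> itself is estimated by summing from 1 to \<open>n\<close>.
\<close>

lemma chain_approximation:
  assumes g: "0 < g1" "g1 < g" and ng: "g1 \<notin> hom_set RS"
  obtains K where "0 < K" "\<And>F X x h n. borel_field g F \<Longrightarrow>
    (\<And>m. 1 \<le> m \<Longrightarrow> scaled_norm s (X m - x) \<le> 1 / 2 ^ m) \<Longrightarrow>
    (\<And>m. 1 \<le> m \<Longrightarrow> sharp g F (X m) \<le> ennreal (2 powr (real m * (g - g1)) * h)) \<Longrightarrow>
    0 \<le> h \<Longrightarrow> sharp g F x < top \<Longrightarrow> 1 \<le> n \<Longrightarrow>
    wnorm g (1 / 2 ^ n) (proj_below RS g1 (F x) - \<Gamma> x (X n) (F (X n))) \<le> K * (1 / 2 ^ n) powr g1 * h"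
proof -
  have g0: "0 < g" using g by simp
  let ?A = "hom_below RS g"
  define a where "a = g - g1"
  obtain C1 where C1: "1 \<le> C1" "\<And>x y l \<tau>. 0 < l \<Longrightarrow> l \<le> 4 \<Longrightarrow> scaled_norm s (x - y) \<le> l \<Longrightarrow>
    \<tau> \<in> hspace_below RS g \<Longrightarrow> wnorm g l (\<Gamma> x y \<tau>) \<le> C1 * wnorm g l \<tau>"
    by (rule wnorm_Gamma[OF g0]) blast
  obtain C2 where C2: "0 < C2" "\<And>F n x y. borel_field g F \<Longrightarrow> 1 \<le> n \<Longrightarrow> scaled_norm s (x - y) \<le> 3 / 2 ^ n \<Longrightarrow>
    ennreal (wnorm g (1 / 2 ^ n) (F x - \<Gamma> x y (F y))) \<le> ennreal (C2 * (1 / 2 ^ n) powr g) * (sharp g F x + sharp g F y)"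
    by (rule pointwise_increment_le_sharp[OF g0]) blast
  define K1 where "K1 = C1 * C2 * (1 + 2 powr a)"
  define S where "S = (\<Sum>\<beta>\<in>?A. (1 / 2) powr \<beta>)"
  define \<kappa> where "\<kappa> \<beta> = (if \<beta> < g1 then K1 / (1 - 2 powr (- (g1 - \<beta>)))
    else 2 powr \<beta> * (C1 * (S * 2 powr a)) + K1 / (2 powr (\<beta> - g1) - 1))" for \<beta>
  have K1: "0 < K1" using C1 C2 by (simp add: K1_def add_pos_pos)
  have S: "0 \<le> S" by (simp add: S_def sum_nonneg)
  have ne: "\<beta> \<noteq> g1" if "\<beta> \<in> ?A" for \<beta> using that ng hom_belowD(1) by auto
  \<comment> \<open>The constants of the two summations: a decreasing geometric series for \<open>\<beta> < g1\<close>, and an increasing one, with its initial term at scale 1/2, for \<open>\<beta> > g1\<close>.\<close>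
  have \<kappa>: "0 \<le> \<kappa> \<beta>" if "\<beta> \<in> ?A" for \<beta>
  proof (cases "\<beta> < g1")
    case True
    then have "2 powr (- (g1 - \<beta>)) < (1::real)" by (simp add: powr_less_one)
    then show ?thesis using True K1 by (simp add: \<kappa>_def)
  next
    case False
    then have "1 < 2 powr (\<beta> - g1)" using ne[OF that] by (simp add: gr_one_powr)
    then show ?thesis using False K1 S C1 by (simp add: \<kappa>_def)
  qed
  define K where "K = (\<Sum>\<beta>\<in>?A. \<kappa> \<beta>) + 1"
  have "wnorm g (1 / 2 ^ n) (proj_below RS g1 (F x) - \<Gamma> x (X n) (F (X n))) \<le> K * (1 / 2 ^ n) powr g1 * h"
    if F: "borel_field g F" and X: "\<And>m. 1 \<le> m \<Longrightarrow> scaled_norm s (X m - x) \<le> 1 / 2 ^ m"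
      and X': "\<And>m. 1 \<le> m \<Longrightarrow> sharp g F (X m) \<le> ennreal (2 powr (real m * (g - g1)) * h)"
      and h: "0 \<le> h" and Dx: "sharp g F x < top" and n: "1 \<le> n" for F X x h n
  proof -
    define v where "v m = \<Gamma> x (X m) (F (X m))" for m
    let ?L = "\<lambda>m. 1 / (2::real) ^ m"
    have Lle: "?L m \<le> 4" "0 < ?L m" for m
    proof -
      have "?L m \<le> 1" by simp
      then show "?L m \<le> 4" by linarith
    qed simp
    obtain d where d: "sharp g F x = ennreal d" "0 \<le> d" using Dx by (cases "sharp g F x") auto
    have mem: "F y \<in> hspace_below RS g" for y using borel_field_below[OF F] .
    have xX: "scaled_norm s (x - X m) \<le> ?L m" if "1 \<le> m" for m
      using X[OF that] by (simp add: scaled_norm_minus_commute)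
    have sm: "?L m powr g * 2 powr (real m * a) = ?L m powr g1" for m
      unfolding half_power_powr_eq_powr powr_add[symmetric] by (simp add: a_def algebra_simps)
    have step: "wnorm g (?L m) (v m - v (Suc m)) \<le> K1 * ?L m powr g1 * h" if m: "1 \<le> m" for m
    proof -
      have XX: "scaled_norm s (X m - X (Suc m)) \<le> 3 / 2 ^ m"
      proof -
        have "scaled_norm s (X m - X (Suc m)) \<le> scaled_norm s (X m - x) + scaled_norm s (x - X (Suc m))"
          using scaled_norm_triangle[OF scaling, of "X m - x" "x - X (Suc m)"] by simp
        also have "\<dots> \<le> ?L m + ?L (Suc m)"
          using X[OF m] xX[of "Suc m"] by (intro add_mono) auto
        also have "\<dots> \<le> ?L m + 2 * ?L m"
          by (intro add_left_mono) (simp add: field_simps)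
        finally show ?thesis by simp
      qed
      have "ennreal (wnorm g (?L m) (F (X m) - \<Gamma> (X m) (X (Suc m)) (F (X (Suc m)))))
          \<le> ennreal (C2 * ?L m powr g) * (ennreal (2 powr (real m * a) * h) + ennreal (2 powr (real (Suc m) * a) * h))"
        using m unfolding a_def by (intro order_trans[OF C2(2)[OF F m XX]] mult_left_mono add_mono X') auto
      also have "\<dots> = ennreal (C2 * ?L m powr g * (2 powr (real m * a) * h + 2 powr (real (Suc m) * a) * h))"
        using C2(1) h by (intro ennreal_mult_add) auto
      also have "2 powr (real (Suc m) * a) = 2 powr (real m * a) * 2 powr a"
        by (simp add: powr_add[symmetric] algebra_simps)
      also have "C2 * ?L m powr g * (2 powr (real m * a) * h + 2 powr (real m * a) * 2 powr a * h)
          = C2 * (1 + 2 powr a) * (?L m powr g * 2 powr (real m * a)) * h"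
        by (simp add: algebra_simps)
      finally have "wnorm g (?L m) (F (X m) - \<Gamma> (X m) (X (Suc m)) (F (X (Suc m)))) \<le> C2 * (1 + 2 powr a) * ?L m powr g1 * h"
        unfolding sm using C2(1) h by (subst (asm) ennreal_le_iff) auto
      then have "C1 * wnorm g (?L m) (F (X m) - \<Gamma> (X m) (X (Suc m)) (F (X (Suc m)))) \<le> C1 * (C2 * (1 + 2 powr a) * ?L m powr g1 * h)"
        using C1(1) by (intro mult_left_mono) auto
      moreover have "v m - v (Suc m) = \<Gamma> x (X m) (F (X m) - \<Gamma> (X m) (X (Suc m)) (F (X (Suc m))))"
        by (simp add: v_def Gamma_simps)
      moreover have "wnorm g (?L m) (\<Gamma> x (X m) (F (X m) - \<Gamma> (X m) (X (Suc m)) (F (X (Suc m)))))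
          \<le> C1 * wnorm g (?L m) (F (X m) - \<Gamma> (X m) (X (Suc m)) (F (X (Suc m))))"
        using mem Lle xX[OF m] by (intro C1 subspace_diff[OF subspace_hspace_below] Gamma_below) auto
      ultimately show ?thesis by (simp add: K1_def mult.assoc)
    qed
    have step_comp: "comp_norm RS \<beta> (v m - v (Suc m)) \<le> K1 * h * (2 powr (\<beta> - g1)) ^ m"
      if m: "1 \<le> m" and \<beta>: "\<beta> \<in> ?A" for m \<beta>
    proof -
      have "comp_norm RS \<beta> (v m - v (Suc m)) \<le> ?L m powr (- \<beta>) * wnorm g (?L m) (v m - v (Suc m))"
        by (intro comp_norm_le_wnorm \<beta> Lle)
      also have "\<dots> \<le> ?L m powr (- \<beta>) * (K1 * ?L m powr g1 * h)"
        by (intro mult_left_mono step m) auto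
      also have "\<dots> = K1 * h * (?L m powr (- \<beta>) * ?L m powr g1)" by (simp add: mult_ac)
      also have "?L m powr (- \<beta>) * ?L m powr g1 = (2 powr (\<beta> - g1)) ^ m"
        by (subst powr_add[symmetric]) (simp add: half_power_powr)
      finally show ?thesis .
    qed
    have comp: "comp_norm RS \<beta> (proj_below RS g1 (F x) - v n) \<le> \<kappa> \<beta> * h * (2 powr (\<beta> - g1)) ^ n" if \<beta>: "\<beta> \<in> ?A" for \<beta>
    proof (cases "\<beta> < g1")
      case True
      then have \<beta>1: "\<beta> \<in> hom_below RS g1" using hom_belowD(1)[OF \<beta>] by (simp add: hom_below_def)
      let ?\<rho> = "2 powr (\<beta> - g1) :: real"
      have \<rho>: "0 < ?\<rho>" "?\<rho> < 1" using True by (auto simp: powr_less_one)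
      define b where "b m = comp_norm RS \<beta> (F x - v m)" for m
      have "b m \<le> b (Suc m) + (K1 * h) * ?\<rho> ^ m" if "1 \<le> m" for m
        using comp_norm_add[OF hom_belowD(1)[OF \<beta>], of "F x - v (Suc m)" "- (v m - v (Suc m))"] step_comp[OF that \<beta>]
        by (simp add: b_def comp_norm_uminus[OF hom_belowD(1)[OF \<beta>]] comp_norm_minus_commute[OF hom_belowD(1)[OF \<beta>], of "v (Suc m)"])
      moreover have "b \<longlonglongrightarrow> 0"
      proof -
        have bound: "norm (b m) \<le> C2 * d * (2 powr (\<beta> - g)) ^ m + C2 * h * ?\<rho> ^ m" if m: "1 \<le> m" for m
        proof -
          have "ennreal (wnorm g (?L m) (F x - v m)) \<le> ennreal (C2 * ?L m powr g) * (ennreal d + ennreal (2 powr (real m * a) * h))"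
            unfolding v_def d(1)[symmetric] using X'[OF m] xX[OF m] unfolding a_def
            by (intro order_trans[OF C2(2)[OF F m]] mult_left_mono add_mono order_trans[OF xX[OF m]]) (auto simp: divide_right_mono)
          also have "\<dots> = ennreal (C2 * ?L m powr g * (d + 2 powr (real m * a) * h))"
            using C2(1) h d by (intro ennreal_mult_add) auto
          finally have "wnorm g (?L m) (F x - v m) \<le> C2 * ?L m powr g * (d + 2 powr (real m * a) * h)"
            using C2(1) h d by (subst (asm) ennreal_le_iff) auto
          also have "\<dots> = C2 * d * ?L m powr g + C2 * h * (?L m powr g * 2 powr (real m * a))"
            by (simp add: algebra_simps)
          finally have "?L m powr (- \<beta>) * wnorm g (?L m) (F x - v m) \<le> ?L m powr (- \<beta>) * (C2 * d * ?L m powr g + C2 * h * ?L m powr g1)"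
            unfolding sm by (intro mult_left_mono) auto
          moreover have "\<bar>b m\<bar> \<le> ?L m powr (- \<beta>) * wnorm g (?L m) (F x - v m)"
            using comp_norm_le_wnorm[OF \<beta> Lle(2)[of m], of "F x - v m"] comp_norm_nonneg[OF hom_belowD(1)[OF \<beta>]]
            by (simp add: b_def)
          moreover have "?L m powr (- \<beta>) * ?L m powr g1 = ?\<rho> ^ m" "?L m powr (- \<beta>) * ?L m powr g = (2 powr (\<beta> - g)) ^ m"
            by (subst powr_add[symmetric], simp add: half_power_powr)+
          ultimately show ?thesis by (simp add: distrib_left mult_ac)
        qed
        have "(\<lambda>m. C2 * d * (2 powr (\<beta> - g)) ^ m + C2 * h * ?\<rho> ^ m) \<longlonglongrightarrow> C2 * d * 0 + C2 * h * 0"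
          using \<rho> hom_belowD(2)[OF \<beta>] by (intro tendsto_intros LIMSEQ_realpow_zero) (auto simp: powr_less_one)
        then have "(\<lambda>m. C2 * d * (2 powr (\<beta> - g)) ^ m + C2 * h * ?\<rho> ^ m) \<longlonglongrightarrow> 0" by simp
        then show ?thesis
          using bound by (rule_tac Lim_null_comparison[OF eventually_sequentiallyI[of 1]]) auto
      qed
      ultimately have "b n \<le> (K1 * h) * ?\<rho> ^ n / (1 - ?\<rho>)"
        using \<rho> n by (intro telescope_tail_le[of 1]) auto
      moreover have "comp_norm RS \<beta> (proj_below RS g1 (F x) - v n) = b n"
        using \<beta>1 by (simp add: b_def comp_norm_def proj_simps proj_proj_below)
      ultimately show ?thesis using True by (simp add: \<kappa>_def)
    next
      case False
      then have \<beta>1: "\<beta> \<notin> hom_below RS g1" by (simp add: hom_below_def)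
      let ?\<rho> = "2 powr (\<beta> - g1) :: real"
      have \<rho>: "1 < ?\<rho>" using False ne[OF \<beta>] by (simp add: gr_one_powr)
      define b where "b m = comp_norm RS \<beta> (v m)" for m
      have "b (Suc m) \<le> b m + (K1 * h) * ?\<rho> ^ m" if "1 \<le> m" for m
        using comp_norm_add[OF hom_belowD(1)[OF \<beta>], of "v m" "- (v m - v (Suc m))"] step_comp[OF that \<beta>]
        by (simp add: b_def comp_norm_minus_commute[OF hom_belowD(1)[OF \<beta>], of "v (Suc m)"])
      moreover have "b 1 \<le> 2 powr \<beta> * (C1 * (S * 2 powr a)) * h * ?\<rho>"
      proof -
        have cn: "comp_norm RS \<zeta> (F (X 1)) \<le> 2 powr a * h" if "\<zeta> \<in> ?A" for \<zeta>
        proof -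
          have "ennreal (comp_norm RS \<zeta> (F (X 1))) \<le> ennreal (2 powr a * h)"
            using comp_norm_le_sharp[OF that, of F "X 1"] X'[of 1] by (simp add: a_def)
          then show ?thesis using h by (subst (asm) ennreal_le_iff) auto
        qed
        have "wnorm g (1 / 2) (F (X 1)) \<le> S * (2 powr a * h)"
          unfolding wnorm_def S_def sum_distrib_right using cn by (intro sum_mono mult_left_mono) auto
        then have "C1 * wnorm g (1 / 2) (F (X 1)) \<le> C1 * (S * (2 powr a * h))"
          using C1(1) by (intro mult_left_mono) auto
        moreover have "wnorm g (1 / 2) (v 1) \<le> C1 * wnorm g (1 / 2) (F (X 1))"
          unfolding v_def using xX[of 1] mem by (intro C1) auto
        ultimately have w: "wnorm g (1 / 2) (v 1) \<le> C1 * (S * (2 powr a * h))" by linarith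
        have e: "(1 / 2) powr (- \<beta>) = (2 powr \<beta> :: real)"
          using half_power_powr[of 1 "- \<beta>"] by simp
        have "b 1 \<le> 2 powr \<beta> * wnorm g (1 / 2) (v 1)"
          unfolding b_def e[symmetric] by (intro comp_norm_le_wnorm \<beta>) auto
        also have "\<dots> \<le> 2 powr \<beta> * (C1 * (S * (2 powr a * h)))"
          by (intro mult_left_mono w) auto
        also have "\<dots> = 2 powr \<beta> * (C1 * (S * 2 powr a)) * h * 1" by (simp add: mult_ac)
        also have "\<dots> \<le> 2 powr \<beta> * (C1 * (S * 2 powr a)) * h * ?\<rho>"
          using \<rho> h S C1(1) by (intro mult_left_mono) auto
        finally show ?thesis .
      qed
      ultimately have "b n \<le> (2 powr \<beta> * (C1 * (S * 2 powr a)) * h + (K1 * h) / (?\<rho> - 1)) * ?\<rho> ^ n"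
        using \<rho> n K1 h S C1(1) by (intro telescope_growth_le) auto
      moreover have "comp_norm RS \<beta> (proj_below RS g1 (F x) - v n) = b n"
      proof -
        have "comp_norm RS \<beta> (proj_below RS g1 (F x) - v n) = comp_norm RS \<beta> (- v n)"
          using \<beta>1 by (simp add: comp_norm_def proj_simps proj_proj_below)
        then show ?thesis by (simp add: b_def comp_norm_uminus[OF hom_belowD(1)[OF \<beta>]])
      qed
      ultimately show ?thesis using False by (simp add: \<kappa>_def distrib_right)
    qed
    have "wnorm g (?L n) (proj_below RS g1 (F x) - v n) \<le> (\<Sum>\<beta>\<in>?A. \<kappa> \<beta> * (?L n powr g1 * h))"
      unfolding wnorm_def
    proof (intro sum_mono)
      fix \<beta> assume \<beta>: "\<beta> \<in> ?A"
      have "?L n powr \<beta> * comp_norm RS \<beta> (proj_below RS g1 (F x) - v n) \<le> ?L n powr \<beta> * (\<kappa> \<beta> * h * (2 powr (\<beta> - g1)) ^ n)"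
        by (intro mult_left_mono comp \<beta>) auto
      also have "\<dots> = \<kappa> \<beta> * ((?L n powr \<beta> * ?L n powr (g1 - \<beta>)) * h)"
        unfolding half_power_powr[of n "g1 - \<beta>"] by (simp add: mult_ac)
      also have "?L n powr \<beta> * ?L n powr (g1 - \<beta>) = ?L n powr g1"
        by (simp add: powr_add[symmetric])
      finally show "?L n powr \<beta> * comp_norm RS \<beta> (proj_below RS g1 (F x) - v n) \<le> \<kappa> \<beta> * (?L n powr g1 * h)" .
    qed
    also have "\<dots> \<le> K * (?L n powr g1 * h)"
      unfolding K_def sum_distrib_right[symmetric] using h by (intro mult_right_mono) auto
    finally show ?thesis by (simp add: v_def mult.assoc)
  qed
  moreover have "0 < K" unfolding K_def using \<kappa> by (simp add: add_nonneg_pos sum_nonneg)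
  ultimately show ?thesis by (intro that) auto
qed

end

section \<open>A pointwise estimate of Hajlasz type\<close>

lemma divide_ennreal_real: "0 < c \<Longrightarrow> x / ennreal c = ennreal (1 / c) * x"
  by (simp add: divide_ennreal_def inverse_ennreal mult.commute inverse_eq_divide)

lemma Lp_norm_lebesgue: "0 \<le> p \<Longrightarrow> Lp_norm lebesgue (ennreal p) g = Lp_norm lborel (ennreal p) g"
  by (simp add: Lp_norm_real nn_integral_completion)

lemma AE_translate_not_in:
  fixes x :: "'a::euclidean_space"
  assumes "N \<in> null_sets lborel"
  shows "AE h in lborel. x + h \<notin> N"
proof -
  have "AE z in distr lborel borel ((+) x). z \<notin> N"
    unfolding lborel_distr_plus using assms by (rule AE_not_in)
  then show ?thesis by (subst (asm) AE_distr_iff) (use assms in auto)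
qed

context reg_model
begin

text \<open>
  From averages to values at almost all pairs of points. Let \<open>l\<close> be comparable with \<open>1 /
  2\<^sup>n\<close>. Around \<open>x\<close> and \<open>y\<close> choose good points \<open>X n\<close> and
  \<open>Y n\<close> at distance at most \<open>1 / 2\<^sup>n\<close>, where the sharp function is dominated
  by \<open>H x\<close> and \<open>H y\<close>. They are at distance at most \<open>3 / 2\<^sup>n\<close> from
  each other, so \<open>pointwise_increment_le_sharp\<close> compares the field at \<open>X n\<close> and
  \<open>Y n\<close>, and \<open>chain_approximation\<close> compares it with its truncations at
  \<open>x\<close> and at \<open>y\<close>. For \<open>l > 1 / 2\<close> it suffices to bound the two
  truncations separately by \<open>H x\<close> and \<open>H y\<close>.
\<close>

lemma hajlasz_estimate:
  assumes g: "0 < g1" "g1 < g" and ng: "g1 \<notin> hom_set RS" and p: "1 \<le> p"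
  obtains K where "0 < K"
    "\<And>F H. borel_field g F \<Longrightarrow> averages_dominated p (g - g1) (sharp g F) H \<Longrightarrow>
      \<forall>\<zeta>\<in>hom_below RS g1. \<forall>x. sharp g F x < top \<longrightarrow> ennreal (comp_norm RS \<zeta> (F x)) \<le> ennreal K * H x \<and>
        (\<forall>y l. sharp g F y < top \<longrightarrow> 0 < l \<longrightarrow> l \<le> 4 \<longrightarrow> scaled_norm s (x - y) \<le> l \<longrightarrow>
          ennreal (comp_norm RS \<zeta> (proj_below RS g1 (F x) - \<Gamma> x y (proj_below RS g1 (F y))))
            \<le> ennreal (K * l powr (g1 - \<zeta>)) * (H x + H y))"
proof -
  have g0: "0 < g" using g by simp
  let ?A = "hom_below RS g"
  have sub: "hom_below RS g1 \<subseteq> ?A" using g by (auto simp: hom_below_def)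
  define a where "a = g - g1"
  obtain C1 where C1: "1 \<le> C1" "\<And>x y l \<tau>. 0 < l \<Longrightarrow> l \<le> 4 \<Longrightarrow> scaled_norm s (x - y) \<le> l \<Longrightarrow>
    \<tau> \<in> hspace_below RS g \<Longrightarrow> wnorm g l (\<Gamma> x y \<tau>) \<le> C1 * wnorm g l \<tau>"
    by (rule wnorm_Gamma[OF g0]) blast
  obtain C2 where C2: "0 < C2" "\<And>F n x y. borel_field g F \<Longrightarrow> 1 \<le> n \<Longrightarrow> scaled_norm s (x - y) \<le> 3 / 2 ^ n \<Longrightarrow>
    ennreal (wnorm g (1 / 2 ^ n) (F x - \<Gamma> x y (F y))) \<le> ennreal (C2 * (1 / 2 ^ n) powr g) * (sharp g F x + sharp g F y)"
    by (rule pointwise_increment_le_sharp[OF g0]) blast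
  obtain K1 where K1: "0 < K1" "\<And>F X x h n. borel_field g F \<Longrightarrow>
    (\<And>m. 1 \<le> m \<Longrightarrow> scaled_norm s (X m - x) \<le> 1 / 2 ^ m) \<Longrightarrow>
    (\<And>m. 1 \<le> m \<Longrightarrow> sharp g F (X m) \<le> ennreal (2 powr (real m * (g - g1)) * h)) \<Longrightarrow>
    0 \<le> h \<Longrightarrow> sharp g F x < top \<Longrightarrow> 1 \<le> n \<Longrightarrow>
    wnorm g (1 / 2 ^ n) (proj_below RS g1 (F x) - \<Gamma> x (X n) (F (X n))) \<le> K1 * (1 / 2 ^ n) powr g1 * h"
    by (rule chain_approximation[OF g ng]) blast
  define S where "S = (\<Sum>\<beta>\<in>?A. (1 / 2) powr \<beta>)"
  define B where "B = (\<Sum>\<beta>\<in>?A. \<bar>\<beta>\<bar>)"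
  define K2 where "K2 = K1 + C1 * C2 + C1 * K1"
  define K3 where "K3 = K1 * (1 / 2) powr g1 + C1 * (S * 2 powr a)"
  have S: "0 \<le> S" by (simp add: S_def sum_nonneg)
  have B: "\<bar>\<beta>\<bar> \<le> B" if "\<beta> \<in> ?A" for \<beta>
    unfolding B_def using that finite_hom_below by (intro member_le_sum) auto
  have B0: "0 \<le> B" by (simp add: B_def sum_nonneg)
  have K2: "0 < K2" and K3: "0 < K3" using K1 C1 C2 S by (simp_all add: K2_def K3_def add_pos_nonneg add_pos_pos)
  \<comment> \<open>The three entries serve the bound on the values and the estimate of increments for \<open>l \<le> 1 / 2\<close> and \<open>l > 1 / 2\<close>.\<close>
  define K where "K = max (2 powr B * K3) (max (2 powr (g1 + B) * K2) (2 powr g1 * (8 powr B * (K3 + C1 * K3))))"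
  have K: "0 < K" "2 powr B * K3 \<le> K" "2 powr (g1 + B) * K2 \<le> K" "2 powr g1 * (8 powr B * (K3 + C1 * K3)) \<le> K"
    using K3 by (auto simp: K_def less_max_iff_disj)
  define good where "good F H x X h \<longleftrightarrow> sharp g F x < top \<and> 0 \<le> h \<and> H x = ennreal h \<and>
      (\<forall>m\<ge>1. scaled_norm s (X m - x) \<le> 1 / 2 ^ m \<and> sharp g F (X m) \<le> ennreal (2 powr (real m * (g - g1)) * h))"
    for F and H :: "real^'d \<Rightarrow> ennreal" and x and X :: "nat \<Rightarrow> real^'d" and h
  have good_ex: "\<exists>X h. good F H x X h" if F: "borel_field g F" and dom: "averages_dominated p (g - g1) (sharp g F) H"
    and x: "sharp g F x < top" "H x \<noteq> top" for F H x
  proof -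
    obtain h where h: "H x = ennreal h" "0 \<le> h" using x(2) by (cases "H x") auto
    have "\<exists>z. scaled_norm s (z - x) \<le> 1 / 2 ^ m \<and> sharp g F z \<le> ennreal (2 powr (real m * (g - g1)) * h)" for m
    proof -
      have "\<exists>z. scaled_norm s (z - x) \<le> 1 / 2 ^ m \<and> sharp g F z \<le> ennreal (2 powr (real m * (g - g1))) * H x"
        using p by (intro good_point_exists[OF dom measurable_sharp[OF F g0]]) auto
      then show ?thesis using h by (simp add: ennreal_mult')
    qed
    then obtain X where "\<And>m. scaled_norm s (X m - x) \<le> 1 / 2 ^ m \<and> sharp g F (X m) \<le> ennreal (2 powr (real m * (g - g1)) * h)"
      by metis
    then show ?thesis using h x by (auto simp: good_def)
  qed
  have chain: "wnorm g (1 / 2 ^ n) (proj_below RS g1 (F x) - \<Gamma> x (X n) (F (X n))) \<le> K1 * (1 / 2 ^ n) powr g1 * h"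
    if "borel_field g F" "good F H x X h" "1 \<le> n" for F H x X h n
    using that by (intro K1(2)) (auto simp: good_def)
  have half: "(1 / 2) powr (- \<beta>) = (2 powr \<beta> :: real)" for \<beta>
    using half_power_powr[of 1 "- \<beta>"] by simp
  have size: "wnorm g (1 / 2) (proj_below RS g1 (F x)) \<le> K3 * h"
    if F: "borel_field g F" and G: "good F H x X h" for F H x X h
  proof -
    let ?v = "\<Gamma> x (X 1) (F (X 1))"
    have X1: "scaled_norm s (X 1 - x) \<le> 1 / 2" "sharp g F (X 1) \<le> ennreal (2 powr a * h)" "0 \<le> h"
      using G by (auto simp: good_def a_def)
    have cn: "comp_norm RS \<zeta> (F (X 1)) \<le> 2 powr a * h" if "\<zeta> \<in> ?A" for \<zeta>
    proof -
      have "ennreal (comp_norm RS \<zeta> (F (X 1))) \<le> ennreal (2 powr a * h)"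
        using comp_norm_le_sharp[OF that, of F "X 1"] X1(2) by (rule order_trans)
      then show ?thesis using X1(3) by (subst (asm) ennreal_le_iff) auto
    qed
    have "wnorm g (1 / 2) (F (X 1)) \<le> S * (2 powr a * h)"
      unfolding wnorm_def S_def sum_distrib_right using cn by (intro sum_mono mult_left_mono) auto
    then have "C1 * wnorm g (1 / 2) (F (X 1)) \<le> C1 * (S * (2 powr a * h))"
      using C1(1) by (intro mult_left_mono) auto
    moreover have "wnorm g (1 / 2) ?v \<le> C1 * wnorm g (1 / 2) (F (X 1))"
      using X1(1) borel_field_below[OF F] by (intro C1) (auto simp: scaled_norm_minus_commute)
    moreover have "wnorm g (1 / 2) (proj_below RS g1 (F x)) \<le> wnorm g (1 / 2) (proj_below RS g1 (F x) - ?v) + wnorm g (1 / 2) ?v"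
      using wnorm_add[of g "1 / 2" "proj_below RS g1 (F x) - ?v" ?v] by simp
    moreover have "wnorm g (1 / 2) (proj_below RS g1 (F x) - ?v) \<le> K1 * (1 / 2) powr g1 * h"
      using chain[OF F G, of 1] by simp
    ultimately have "wnorm g (1 / 2) (proj_below RS g1 (F x)) \<le> K1 * (1 / 2) powr g1 * h + C1 * (S * (2 powr a * h))"
      by linarith
    then show ?thesis by (simp add: K3_def algebra_simps)
  qed
  have pmem: "proj_below RS g1 \<tau> \<in> hspace_below RS g" for \<tau>
    using proj_below_mem[of g1 \<tau>] hspace_below_mono[of g1 g] g by auto
  have 1: "ennreal (comp_norm RS \<zeta> (F x)) \<le> ennreal K * H x"
    if F: "borel_field g F" and dom: "averages_dominated p (g - g1) (sharp g F) H"
      and x: "sharp g F x < top" and \<zeta>: "\<zeta> \<in> hom_below RS g1" for F H x \<zeta>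
  proof (cases "H x = top")
    case True
    then show ?thesis using K(1) by (simp add: ennreal_mult_top)
  next
    case False
    then obtain X h where G: "good F H x X h" using good_ex[OF F dom x] by blast
    then have h: "0 \<le> h" "H x = ennreal h" by (auto simp: good_def)
    have \<zeta>': "\<zeta> \<in> ?A" using \<zeta> sub by auto
    have "comp_norm RS \<zeta> (F x) = comp_norm RS \<zeta> (proj_below RS g1 (F x))"
      using \<zeta> by (simp add: comp_norm_proj_below)
    also have "\<dots> \<le> 2 powr \<zeta> * wnorm g (1 / 2) (proj_below RS g1 (F x))"
      unfolding half[symmetric] by (intro comp_norm_le_wnorm \<zeta>') auto
    also have "\<dots> \<le> 2 powr B * (K3 * h)"
      using B[OF \<zeta>'] wnorm_nonneg by (intro mult_mono size[OF F G] powr_mono) auto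
    also have "\<dots> \<le> K * h" using K(2) h by (simp add: mult.assoc[symmetric] mult_right_mono)
    finally show ?thesis using K(1) h by (simp add: ennreal_mult'[symmetric] ennreal_leI)
  qed
  have 2: "ennreal (comp_norm RS \<zeta> (proj_below RS g1 (F x) - \<Gamma> x y (proj_below RS g1 (F y))))
        \<le> ennreal (K * l powr (g1 - \<zeta>)) * (H x + H y)"
    if F: "borel_field g F" and dom: "averages_dominated p (g - g1) (sharp g F) H"
      and x: "sharp g F x < top" and y: "sharp g F y < top" and \<zeta>: "\<zeta> \<in> hom_below RS g1"
      and l: "0 < l" "l \<le> 4" and xy: "scaled_norm s (x - y) \<le> l" for F H x y l \<zeta>
  proof (cases "H x = top \<or> H y = top")
    case True
    then show ?thesis using K(1) l by (auto simp: ennreal_mult_top)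
  next
    case False
    obtain X hx where GX: "good F H x X hx" using good_ex[OF F dom x] False by blast
    obtain Y hy where GY: "good F H y Y hy" using good_ex[OF F dom y] False by blast
    have h: "0 \<le> hx" "H x = ennreal hx" "0 \<le> hy" "H y = ennreal hy" using GX GY by (auto simp: good_def)
    have \<zeta>': "\<zeta> \<in> ?A" "\<zeta> < g1" using \<zeta> sub hom_belowD(2) by auto
    let ?P = "proj_below RS g1"
    let ?w = "?P (F x) - \<Gamma> x y (?P (F y))"
    have "comp_norm RS \<zeta> ?w \<le> K * l powr (g1 - \<zeta>) * (hx + hy)"
    proof (cases "l \<le> 1 / 2")
      case True
      obtain n where n: "1 / 2 ^ Suc n < l" "l \<le> 1 / 2 ^ n"
        using dyadic_bracket[of l] l True by auto
      have n1: "1 \<le> n"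
      proof (rule ccontr)
        assume "\<not> 1 \<le> n"
        then have "n = 0" by simp
        then show False using n(1) True by simp
      qed
      let ?l = "1 / (2::real) ^ n"
      have l4: "0 < ?l" "?l \<le> 4"
      proof -
        have "?l \<le> 1" by simp
        then show "?l \<le> 4" by linarith
      qed simp
      have Xn: "scaled_norm s (X n - x) \<le> ?l" "sharp g F (X n) \<le> ennreal (2 powr (real n * a) * hx)"
        and Yn: "scaled_norm s (Y n - y) \<le> ?l" "sharp g F (Y n) \<le> ennreal (2 powr (real n * a) * hy)"
        using GX GY n1 by (auto simp: good_def a_def)
      have xy': "scaled_norm s (x - y) \<le> ?l" using xy n(2) by simp
      have XY: "scaled_norm s (X n - Y n) \<le> 3 / 2 ^ n"
      proof -
        have "scaled_norm s (((X n - x) + (x - y)) + (y - Y n)) \<le> (?l + ?l) + ?l"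
          using Xn(1) Yn(1) xy'
          by (intro order_trans[OF scaled_norm_triangle[OF scaling]] add_mono)
             (auto simp: scaled_norm_minus_commute)
        then show ?thesis by simp
      qed
      have "ennreal (wnorm g ?l (F (X n) - \<Gamma> (X n) (Y n) (F (Y n))))
          \<le> ennreal (C2 * ?l powr g) * (ennreal (2 powr (real n * a) * hx) + ennreal (2 powr (real n * a) * hy))"
        by (intro order_trans[OF C2(2)[OF F n1 XY]] mult_left_mono add_mono Xn Yn) auto
      also have "\<dots> = ennreal (C2 * ?l powr g * (2 powr (real n * a) * hx + 2 powr (real n * a) * hy))"
        using C2(1) h by (intro ennreal_mult_add) auto
      finally have "wnorm g ?l (F (X n) - \<Gamma> (X n) (Y n) (F (Y n)))
          \<le> C2 * ?l powr g * (2 powr (real n * a) * hx + 2 powr (real n * a) * hy)"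
        using C2(1) h by (subst (asm) ennreal_le_iff) auto
      also have "\<dots> = C2 * (?l powr g * 2 powr (real n * a)) * (hx + hy)" by (simp add: algebra_simps)
      also have "?l powr g * 2 powr (real n * a) = ?l powr g1"
        unfolding half_power_powr_eq_powr powr_add[symmetric] by (simp add: a_def algebra_simps)
      finally have mid: "wnorm g ?l (F (X n) - \<Gamma> (X n) (Y n) (F (Y n))) \<le> C2 * ?l powr g1 * (hx + hy)" .
      note mem = borel_field_below[OF F]
      have "?w = (?P (F x) - \<Gamma> x (X n) (F (X n))) + \<Gamma> x (X n) (F (X n) - \<Gamma> (X n) (Y n) (F (Y n)))
          - \<Gamma> x y (?P (F y) - \<Gamma> y (Y n) (F (Y n)))"
        by (simp add: Gamma_simps)
      then have "wnorm g ?l ?w \<le> wnorm g ?l (?P (F x) - \<Gamma> x (X n) (F (X n)))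
          + wnorm g ?l (\<Gamma> x (X n) (F (X n) - \<Gamma> (X n) (Y n) (F (Y n))))
          + wnorm g ?l (\<Gamma> x y (?P (F y) - \<Gamma> y (Y n) (F (Y n))))"
        by (simp only:) (intro order_trans[OF wnorm_diff] add_right_mono wnorm_add)
      also have "\<dots> \<le> K1 * ?l powr g1 * hx + C1 * (C2 * ?l powr g1 * (hx + hy)) + C1 * (K1 * ?l powr g1 * hy)"
      proof (intro add_mono chain[OF F GX n1])
        have "wnorm g ?l (\<Gamma> x (X n) (F (X n) - \<Gamma> (X n) (Y n) (F (Y n)))) \<le> C1 * wnorm g ?l (F (X n) - \<Gamma> (X n) (Y n) (F (Y n)))"
          using Xn(1) mem by (intro C1 l4 subspace_diff[OF subspace_hspace_below] Gamma_below) (auto simp: scaled_norm_minus_commute)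
        also have "\<dots> \<le> C1 * (C2 * ?l powr g1 * (hx + hy))"
          using C1(1) by (intro mult_left_mono mid) auto
        finally show "wnorm g ?l (\<Gamma> x (X n) (F (X n) - \<Gamma> (X n) (Y n) (F (Y n)))) \<le> C1 * (C2 * ?l powr g1 * (hx + hy))" .
        have "wnorm g ?l (\<Gamma> x y (?P (F y) - \<Gamma> y (Y n) (F (Y n)))) \<le> C1 * wnorm g ?l (?P (F y) - \<Gamma> y (Y n) (F (Y n)))"
          using xy' mem pmem by (intro C1 l4 subspace_diff[OF subspace_hspace_below] Gamma_below) auto
        also have "\<dots> \<le> C1 * (K1 * ?l powr g1 * hy)"
          using C1(1) by (intro mult_left_mono chain[OF F GY n1]) auto
        finally show "wnorm g ?l (\<Gamma> x y (?P (F y) - \<Gamma> y (Y n) (F (Y n)))) \<le> C1 * (K1 * ?l powr g1 * hy)" .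
      qed
      also have "\<dots> \<le> K2 * ?l powr g1 * (hx + hy)"
      proof -
        have "K1 * ?l powr g1 * hx \<le> K1 * ?l powr g1 * (hx + hy)" "C1 * (K1 * ?l powr g1 * hy) \<le> C1 * (K1 * ?l powr g1 * (hx + hy))"
          using K1(1) C1(1) h by (auto intro!: mult_left_mono)
        then show ?thesis by (simp add: K2_def algebra_simps)
      qed
      finally have "?l powr (- \<zeta>) * wnorm g ?l ?w \<le> ?l powr (- \<zeta>) * (K2 * ?l powr g1 * (hx + hy))"
        by (intro mult_left_mono) auto
      then have "comp_norm RS \<zeta> ?w \<le> ?l powr (- \<zeta>) * (K2 * ?l powr g1 * (hx + hy))"
        using comp_norm_le_wnorm[OF \<zeta>'(1) l4(1), of ?w] by linarith
      also have "\<dots> = K2 * (hx + hy) * ?l powr (g1 - \<zeta>)"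
        using powr_add[of ?l "- \<zeta>" g1] by (simp add: mult_ac)
      also have "\<dots> \<le> K2 * (hx + hy) * (2 * l) powr (g1 - \<zeta>)"
        using K2 h \<zeta>' n(1) by (intro mult_left_mono powr_mono2) auto
      also have "\<dots> = 2 powr (g1 - \<zeta>) * K2 * (l powr (g1 - \<zeta>) * (hx + hy))"
        using l by (simp add: powr_mult mult_ac)
      also have "\<dots> \<le> K * (l powr (g1 - \<zeta>) * (hx + hy))"
      proof (intro mult_right_mono)
        have "2 powr (g1 - \<zeta>) * K2 \<le> 2 powr (g1 + B) * K2"
          using B[OF \<zeta>'(1)] K2 by (intro mult_right_mono powr_mono) auto
        then show "2 powr (g1 - \<zeta>) * K2 \<le> K" using K(3) by linarith
      qed (use h in auto)
      finally show ?thesis by (simp add: mult.assoc)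
    next
      case False
      have W: "wnorm g l \<tau> \<le> 8 powr B * wnorm g (1 / 2) \<tau>" for \<tau>
        unfolding wnorm_def sum_distrib_left
      proof (intro sum_mono)
        fix \<beta> assume \<beta>: "\<beta> \<in> ?A"
        have "(2 * l) powr \<beta> \<le> (2 * l) powr B" using False B[OF \<beta>] by (intro powr_mono) auto
        also have "\<dots> \<le> 8 powr B" using False l B0 by (intro powr_mono2) auto
        finally have "(1 / 2) powr \<beta> * (2 * l) powr \<beta> \<le> (1 / 2) powr \<beta> * 8 powr B"
          by (intro mult_left_mono) auto
        then have "l powr \<beta> \<le> 8 powr B * (1 / 2) powr \<beta>"
          using l by (simp add: powr_mult[symmetric] mult.commute)
        then show "l powr \<beta> * comp_norm RS \<beta> \<tau> \<le> 8 powr B * ((1 / 2) powr \<beta> * comp_norm RS \<beta> \<tau>)"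
          using comp_norm_nonneg[OF hom_belowD(1)[OF \<beta>]] by (simp add: mult.assoc[symmetric] mult_right_mono)
      qed
      have "wnorm g l ?w \<le> wnorm g l (?P (F x)) + C1 * wnorm g l (?P (F y))"
        using pmem l xy by (intro order_trans[OF wnorm_diff] add_left_mono C1) auto
      also have "\<dots> \<le> 8 powr B * (K3 * hx) + C1 * (8 powr B * (K3 * hy))"
        using C1(1) by (intro add_mono mult_left_mono order_trans[OF W] size[OF F GX] size[OF F GY]) auto
      also have "\<dots> \<le> 8 powr B * (K3 + C1 * K3) * (hx + hy)"
      proof -
        have "0 \<le> 8 powr B * (K3 * hy) + C1 * (8 powr B * (K3 * hx))" using K3 C1(1) h by simp
        then show ?thesis by (simp add: algebra_simps)
      qed
      finally have "l powr (- \<zeta>) * wnorm g l ?w \<le> l powr (- \<zeta>) * (8 powr B * (K3 + C1 * K3) * (hx + hy))"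
        by (intro mult_left_mono) auto
      then have "comp_norm RS \<zeta> ?w \<le> l powr (- \<zeta>) * (8 powr B * (K3 + C1 * K3) * (hx + hy))"
        using comp_norm_le_wnorm[OF \<zeta>'(1) l(1), of ?w] by linarith
      also have "\<dots> = l powr (- g1) * (8 powr B * (K3 + C1 * K3)) * (l powr (g1 - \<zeta>) * (hx + hy))"
        using l powr_add[of l "- g1" "g1 - \<zeta>"] by (simp add: mult_ac)
      also have "\<dots> \<le> K * (l powr (g1 - \<zeta>) * (hx + hy))"
      proof (intro mult_right_mono)
        have "l powr (- g1) \<le> (1 / 2) powr (- g1)"
          using False g l by (intro powr_mono2') auto
        then have "l powr (- g1) * (8 powr B * (K3 + C1 * K3)) \<le> 2 powr g1 * (8 powr B * (K3 + C1 * K3))"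
          unfolding half using K3 C1(1) by (intro mult_right_mono) auto
        then show "l powr (- g1) * (8 powr B * (K3 + C1 * K3)) \<le> K" using K(4) by linarith
      qed (use h in auto)
      finally show ?thesis by (simp add: mult.assoc)
    qed
    then have "ennreal (comp_norm RS \<zeta> ?w) \<le> ennreal (K * l powr (g1 - \<zeta>) * (hx + hy))"
      by (rule ennreal_leI)
    also have "\<dots> = ennreal (K * l powr (g1 - \<zeta>)) * (H x + H y)"
      unfolding h using K(1) h by (intro ennreal_mult_add[symmetric]) auto
    finally show ?thesis .
  qed
  show ?thesis
  proof (rule that[OF K(1)], intro ballI allI impI conjI)
    fix F H \<zeta> x assume *: "borel_field g F" "averages_dominated p (g - g1) (sharp g F) H"
      "\<zeta> \<in> hom_below RS g1" "sharp g F x < top"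
    show "ennreal (comp_norm RS \<zeta> (F x)) \<le> ennreal K * H x"
      using 1[OF *(1,2,4,3)] .
    fix y l assume "sharp g F y < top" "0 < l" "l \<le> 4" "scaled_norm s (x - y) \<le> l"
    from 2[OF *(1,2,4) this(1) *(3) this(2-4)]
    show "ennreal (comp_norm RS \<zeta> (proj_below RS g1 (F x) - \<Gamma> x y (proj_below RS g1 (F y))))
        \<le> ennreal (K * l powr (g1 - \<zeta>)) * (H x + H y)" .
  qed
qed

section \<open>Comparison with the norm of the modelled distribution\<close>

definition F_density :: "real \<Rightarrow> (real^'d \<Rightarrow> 'v) \<Rightarrow> real \<Rightarrow> real^'d \<Rightarrow> real \<Rightarrow> ennreal"
  where "F_density g f \<zeta> x l =
    (\<integral>\<^sup>+h\<in>scaled_ball s 0 (4 * l). ennreal (increment RS M \<zeta> f x h / l powr (g - \<zeta>)) \<partial>lebesgue)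
      / emeasure lebesgue (scaled_ball s (0::real^'d) (4 * l))"

lemma F_norm_eq: "F_norm s RS M g p q f =
    (SUP \<zeta>\<in>hom_below RS g. Lp_norm lebesgue (ennreal p) (\<lambda>x. ennreal (comp_norm RS \<zeta> (f x)))) +
    (SUP \<zeta>\<in>hom_below RS g. Lp_norm lebesgue (ennreal p) (\<lambda>x. Lp_norm log_measure q (F_density g f \<zeta> x)))"
  unfolding F_norm_def F_density_def ..

lemma Lp_comp_norm_le_F_norm:
  assumes "\<zeta> \<in> hom_below RS g"
  shows "Lp_norm lebesgue (ennreal p) (\<lambda>x. ennreal (comp_norm RS \<zeta> (f x))) \<le> F_norm s RS M g p q f"
  unfolding F_norm_eq by (rule add_increasing2[OF zero_le]) (rule SUP_upper[OF assms])

lemma Lp_density_le_F_norm: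
  assumes "\<zeta> \<in> hom_below RS g"
  shows "Lp_norm lebesgue (ennreal p) (\<lambda>x. Lp_norm log_measure q (F_density g f \<zeta> x)) \<le> F_norm s RS M g p q f"
  unfolding F_norm_eq by (rule add_increasing[OF zero_le]) (rule SUP_upper[OF assms])

lemma increment_nonneg: "\<zeta> \<in> hom_set RS \<Longrightarrow> 0 \<le> increment RS M \<zeta> f x h"
  unfolding increment_def by (rule comp_norm_nonneg)

text \<open>
  The factor \<open>l powr (g - \<zeta>)\<close> and the volume of the box leave the integral, which turns the
  dependence on \<open>l\<close> into a product of an explicit function and an increasing one.
\<close>

lemma F_density_eq:
  assumes "0 < l" "\<zeta> \<in> hom_set RS"
  shows "F_density g f \<zeta> x l = ennreal (1 / (2 ^ CARD('d) * (4 * l) ^ scaling_size s * l powr (g - \<zeta>))) *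
    (\<integral>\<^sup>+h. ennreal (increment RS M \<zeta> f x h) * indicator (scaled_ball s 0 (4 * l)) h \<partial>lborel)"
proof -
  have "(\<integral>\<^sup>+h\<in>scaled_ball s 0 (4 * l). ennreal (increment RS M \<zeta> f x h / l powr (g - \<zeta>)) \<partial>lebesgue)
      = (\<integral>\<^sup>+h. ennreal (1 / l powr (g - \<zeta>)) * (ennreal (increment RS M \<zeta> f x h) * indicator (scaled_ball s 0 (4 * l)) h) \<partial>lborel)"
    unfolding nn_integral_completion
    by (intro nn_integral_cong) (simp add: mult.assoc[symmetric] ennreal_mult'[symmetric])
  also have "\<dots> = ennreal (1 / l powr (g - \<zeta>)) *
      (\<integral>\<^sup>+h. ennreal (increment RS M \<zeta> f x h) * indicator (scaled_ball s 0 (4 * l)) h \<partial>lborel)"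
    using assms by (intro nn_integral_cmult_real) auto
  moreover have "emeasure lebesgue (scaled_ball s (0::real^'d) (4 * l)) = ennreal (2 ^ CARD('d) * (4 * l) ^ scaling_size s)"
    using assms scaling by (simp add: emeasure_scaled_ball)
  ultimately show ?thesis
    using assms by (simp add: F_density_def divide_ennreal_real mult.assoc[symmetric] ennreal_mult'[symmetric])
qed

lemma increment_representative:
  assumes N: "N \<in> null_sets lborel" and x: "x \<notin> N"
  shows "AE h in lborel. increment RS M \<zeta> (\<lambda>x. if x \<in> N then 0 else f x) x h = increment RS M \<zeta> f x h"
  using AE_translate_not_in[OF N, of x] by eventually_elim (use x in \<open>simp add: increment_def\<close>)

text \<open>
  Doubling the scale decreases the density at most by a constant factor, since the integral increases: on
  \<open>{1 / 2\<^sup>n..2 / 2\<^sup>n}\<close> it is at least a fixed multiple of the \<open>n\<close>-th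
  term of the oscillation. This interval has mass at least 1/2 under the logarithmic measure, so a norm with
  any exponent \<open>q\<close> dominates the supremum.
\<close>

lemma osc_le_Lp_density:
  assumes \<zeta>: "\<zeta> \<in> hom_below RS g" and q: "1 \<le> q" and N: "N \<in> null_sets lborel" and x: "x \<notin> N"
  shows "osc g (\<lambda>x. if x \<in> N then 0 else f x) \<zeta> x
    \<le> ennreal (2 * (2 ^ CARD('d) * 8 ^ scaling_size s * 2 powr (g - \<zeta>))) * Lp_norm log_measure q (F_density g f \<zeta> x)"
  unfolding osc_def
proof (intro SUP_least)
  fix n :: nat assume "n \<in> {1..}"
  then have n: "1 \<le> n" by simp
  let ?N = "scaling_size s" and ?L = "1 / (2::real) ^ n"
  define c where "c = 1 / (2 ^ CARD('d) * 8 ^ ?N * 2 powr (g - \<zeta>))"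
  have c: "0 < c" by (simp add: c_def)
  have \<zeta>': "\<zeta> \<in> hom_set RS" "\<zeta> < g" using hom_belowD[OF \<zeta>] by auto
  let ?I = "\<lambda>f. \<integral>\<^sup>+h. ennreal (increment RS M \<zeta> f x h) * indicator (scaled_ball s 0 (4 / 2 ^ n)) h \<partial>lborel"
  let ?T = "ennreal (2 ^ (n * ?N) * 2 powr (real n * (g - \<zeta>))) * ?I f"
  have "ennreal c * ?T \<le> F_density g f \<zeta> x l" if l: "l \<in> {1 / 2 ^ n..2 / 2 ^ n}" for l
  proof -
    have l0: "0 < l" using l by (auto intro: less_le_trans[rotated])
    have "c * (2 ^ (n * ?N) * 2 powr (real n * (g - \<zeta>))) = 1 / (2 ^ CARD('d) * (4 * (2 * ?L)) ^ ?N * (2 * ?L) powr (g - \<zeta>))"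
    proof -
      have "(2 * ?L) powr (g - \<zeta>) = 2 powr (g - \<zeta>) * ?L powr (g - \<zeta>)" by (subst powr_mult) auto
      also have "?L powr (g - \<zeta>) = 1 / 2 powr (real n * (g - \<zeta>))"
        unfolding half_power_powr_eq_powr by (simp add: powr_minus_divide)
      finally have 1: "(2 * ?L) powr (g - \<zeta>) = 2 powr (g - \<zeta>) / 2 powr (real n * (g - \<zeta>))" by simp
      have 2: "(4 * (2 * ?L)) ^ ?N = 8 ^ ?N / 2 ^ (n * ?N)"
        by (simp add: power_divide power_mult)
      show ?thesis unfolding 1 2 c_def by simp
    qed
    also have "\<dots> \<le> 1 / (2 ^ CARD('d) * (4 * l) ^ ?N * l powr (g - \<zeta>))"
      using l l0 \<zeta>' by (intro divide_left_mono mult_mono power_mono powr_mono2 mult_pos_pos) (auto simp: field_simps)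
    finally have le: "c * (2 ^ (n * ?N) * 2 powr (real n * (g - \<zeta>))) \<le> 1 / (2 ^ CARD('d) * (4 * l) ^ ?N * l powr (g - \<zeta>))" .
    have "ennreal c * ?T = ennreal (c * (2 ^ (n * ?N) * 2 powr (real n * (g - \<zeta>)))) * ?I f"
      using c by (simp add: ennreal_mult' mult.assoc)
    also have "\<dots> \<le> ennreal (1 / (2 ^ CARD('d) * (4 * l) ^ ?N * l powr (g - \<zeta>))) *
        (\<integral>\<^sup>+h. ennreal (increment RS M \<zeta> f x h) * indicator (scaled_ball s 0 (4 * l)) h \<partial>lborel)"
      using l by (intro mult_mono ennreal_leI le nn_integral_mono)
        (auto simp: indicator_def mem_scaled_ball)
    also have "\<dots> = F_density g f \<zeta> x l" by (rule F_density_eq[OF l0 \<zeta>'(1), symmetric])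
    finally show ?thesis .
  qed
  from Lp_norm_ge_on_set[OF emeasure_log_measure_dyadic[OF n] q this]
  have "ennreal (2 / c) * (ennreal (1 / 2) * (ennreal c * ?T)) \<le> ennreal (2 / c) * Lp_norm log_measure q (F_density g f \<zeta> x)"
    by (intro mult_left_mono) auto
  moreover have "ennreal (2 / c) * (ennreal (1 / 2) * (ennreal c * ?T)) = ?T"
  proof -
    have "ennreal (2 / c) * ennreal (1 / 2) * ennreal c = ennreal (2 / c * (1 / 2) * c)"
      using c by (subst ennreal_mult'[symmetric], simp)+ simp
    also have "2 / c * (1 / 2) * c = 1" using c by simp
    finally have "ennreal (2 / c) * ennreal (1 / 2) * ennreal c = 1" by simp
    then have "(ennreal (2 / c) * ennreal (1 / 2) * ennreal c) * ?T = ?T" by simp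
    then show ?thesis by (simp only: mult.assoc)
  qed
  moreover have "?I (\<lambda>x. if x \<in> N then 0 else f x) = ?I f"
    by (intro nn_integral_cong_AE) (use increment_representative[OF N x, of \<zeta> f] in \<open>auto elim: eventually_mono\<close>)
  ultimately show "ennreal (2 ^ (n * ?N) * 2 powr (real n * (g - \<zeta>))) * ?I (\<lambda>x. if x \<in> N then 0 else f x)
      \<le> ennreal (2 * (2 ^ CARD('d) * 8 ^ ?N * 2 powr (g - \<zeta>))) * Lp_norm log_measure q (F_density g f \<zeta> x)"
    by (simp add: c_def)
qed

lemma Lp_sharp_le_F_norm:
  assumes g: "0 < g" and p: "1 \<le> p" and q: "1 \<le> q"
  obtains C where "0 < C" "\<And>f N. N \<in> null_sets lborel \<Longrightarrow> borel_field g (\<lambda>x. if x \<in> N then 0 else f x) \<Longrightarrow>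
    Lp_norm lborel (ennreal p) (sharp g (\<lambda>x. if x \<in> N then 0 else f x)) \<le> ennreal C * F_norm s RS M g p q f"
proof -
  let ?A = "hom_below RS g"
  define c where "c \<zeta> = 2 * (2 ^ CARD('d) * 8 ^ scaling_size s * 2 powr (g - \<zeta>))" for \<zeta>
  have c: "0 < c \<zeta>" for \<zeta> by (simp add: c_def)
  have c4: "0 \<le> 4 * (1 + c \<zeta>)" for \<zeta> using c[of \<zeta>] by simp
  define C where "C = 4 ^ card ?A * (\<Sum>\<zeta>\<in>?A. 4 * (1 + c \<zeta>)) + 1"
  have C: "0 < C" unfolding C_def by (intro add_nonneg_pos mult_nonneg_nonneg sum_nonneg c4) auto
  have "Lp_norm lborel (ennreal p) (sharp g (\<lambda>x. if x \<in> N then 0 else f x)) \<le> ennreal C * F_norm s RS M g p q f"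
    if N: "N \<in> null_sets lborel" and F: "borel_field g (\<lambda>x. if x \<in> N then 0 else f x)" for f N
  proof -
    let ?F = "\<lambda>x. if x \<in> N then 0 else f x" and ?n = "F_norm s RS M g p q f"
    have m: "(\<lambda>x. ennreal (comp_norm RS \<zeta> (?F x))) \<in> borel_measurable lborel" "osc g ?F \<zeta> \<in> borel_measurable lborel"
      if "\<zeta> \<in> ?A" for \<zeta>
      using measurable_comp_norm[OF F that] measurable_osc[OF F that g] by auto
    have notN: "AE x in lborel. x \<notin> N" using N by (rule AE_not_in)
    have "Lp_norm lborel (ennreal p) (sharp g ?F)
        \<le> 4 ^ card ?A * (\<Sum>\<zeta>\<in>?A. Lp_norm lborel (ennreal p) (\<lambda>x. ennreal (comp_norm RS \<zeta> (?F x)) + osc g ?F \<zeta> x))"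
      unfolding sharp_def[abs_def] using m p finite_hom_below by (intro Lp_norm_sum_le borel_measurable_add) auto
    also have "\<dots> \<le> 4 ^ card ?A * (\<Sum>\<zeta>\<in>?A. ennreal (4 * (1 + c \<zeta>)) * ?n)"
    proof (intro mult_left_mono sum_mono)
      fix \<zeta> assume \<zeta>: "\<zeta> \<in> ?A"
      have "Lp_norm lborel (ennreal p) (\<lambda>x. ennreal (comp_norm RS \<zeta> (?F x)) + osc g ?F \<zeta> x)
          \<le> 4 * (Lp_norm lborel (ennreal p) (\<lambda>x. ennreal (comp_norm RS \<zeta> (?F x))) + Lp_norm lborel (ennreal p) (osc g ?F \<zeta>))"
        using m[OF \<zeta>] p by (intro Lp_norm_add_le) auto
      also have "\<dots> \<le> 4 * (?n + ennreal (c \<zeta>) * ?n)"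
      proof (intro mult_left_mono add_mono)
        have "Lp_norm lborel (ennreal p) (\<lambda>x. ennreal (comp_norm RS \<zeta> (?F x))) \<le> Lp_norm lborel (ennreal p) (\<lambda>x. ennreal (comp_norm RS \<zeta> (f x)))"
          using notN p by (intro Lp_norm_mono_AE) (auto elim: eventually_mono)
        also have "\<dots> \<le> ?n" using Lp_comp_norm_le_F_norm[OF \<zeta>, of p f q] p by (simp add: Lp_norm_lebesgue)
        finally show "Lp_norm lborel (ennreal p) (\<lambda>x. ennreal (comp_norm RS \<zeta> (?F x))) \<le> ?n" .
        have "Lp_norm lborel (ennreal p) (osc g ?F \<zeta>) \<le> Lp_norm lborel (ennreal p) (\<lambda>x. ennreal (c \<zeta>) * Lp_norm log_measure q (F_density g f \<zeta> x))"
          using notN p unfolding c_def by (intro Lp_norm_mono_AE) (auto elim!: eventually_mono intro!: osc_le_Lp_density[OF \<zeta> q N])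
        also have "\<dots> = ennreal (c \<zeta>) * Lp_norm lborel (ennreal p) (\<lambda>x. Lp_norm log_measure q (F_density g f \<zeta> x))"
          using c p by (intro Lp_norm_cmult) auto
        also have "\<dots> \<le> ennreal (c \<zeta>) * ?n"
          using Lp_density_le_F_norm[OF \<zeta>, of p q f] p by (intro mult_left_mono) (simp_all add: Lp_norm_lebesgue)
        finally show "Lp_norm lborel (ennreal p) (osc g ?F \<zeta>) \<le> ennreal (c \<zeta>) * ?n" .
      qed auto
      also have "\<dots> = ennreal (4 * (1 + c \<zeta>)) * ?n"
        using c[of \<zeta>] by (simp add: ennreal_mult' distrib_right distrib_left mult.assoc less_imp_le)
      finally show "Lp_norm lborel (ennreal p) (\<lambda>x. ennreal (comp_norm RS \<zeta> (?F x)) + osc g ?F \<zeta> x) \<le> ennreal (4 * (1 + c \<zeta>)) * ?n" .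
    qed auto
    also have "\<dots> = ennreal (4 ^ card ?A * (\<Sum>\<zeta>\<in>?A. 4 * (1 + c \<zeta>))) * ?n"
    proof -
      have "(\<Sum>\<zeta>\<in>?A. ennreal (4 * (1 + c \<zeta>))) = ennreal (\<Sum>\<zeta>\<in>?A. 4 * (1 + c \<zeta>))"
        by (intro sum_ennreal c4)
      moreover have "(4::ennreal) ^ card ?A = ennreal (4 ^ card ?A)" by (simp add: ennreal_power[symmetric])
      ultimately show ?thesis
        by (simp only: sum_distrib_right[symmetric] mult.assoc[symmetric]) (simp only: ennreal_mult'[OF zero_le_power[OF zero_le_numeral]])
    qed
    also have "\<dots> \<le> ennreal C * ?n"
      unfolding C_def by (intro mult_right_mono ennreal_leI) auto
    finally show ?thesis .
  qed
  then show ?thesis using C by (rule that[rotated])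
qed

text \<open>
  Off the null set \<open>N\<close>, the truncation of \<open>f\<close> to order \<open>g\<close> is Hoelder
  continuous of order \<open>g\<close> with respect to \<open>\<Gamma>\<close>, with a local constant
  \<open>H\<close>; this is Hajlasz' description of Sobolev spaces carried over to modelled distributions.
\<close>

definition hajlasz_majorant :: "real \<Rightarrow> (real^'d \<Rightarrow> 'v) \<Rightarrow> (real^'d \<Rightarrow> ennreal) \<Rightarrow> (real^'d) set \<Rightarrow> bool"
  where "hajlasz_majorant g f H N \<longleftrightarrow>
    (\<forall>\<zeta>\<in>hom_below RS g. \<forall>x. x \<notin> N \<longrightarrow> ennreal (comp_norm RS \<zeta> (f x)) \<le> H x \<and>
      (\<forall>h l. x + h \<notin> N \<longrightarrow> 0 < l \<longrightarrow> l \<le> 4 \<longrightarrow> scaled_norm s h \<le> l \<longrightarrow>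
        ennreal (increment RS M \<zeta> (\<lambda>x. proj_below RS g (f x)) x h)
          \<le> ennreal (l powr (g - \<zeta>)) * (H x + H (x + h))))"

text \<open>
  The passage from integrability \<open>p'\<close> to \<open>p\<close> takes place here: the sharp function is
  in \<open>L\<^bsup>p'\<^esup>\<close>, its majorant \<open>H\<close> from
  \<open>dyadic_average_majorant\<close> is in \<open>L\<^sup>p\<close>, and the loss \<open>2 powr (m * (g -
  g1))\<close> is what \<open>chain_approximation\<close> can afford.
\<close>

lemma F_space_hajlasz:
  assumes g: "0 < g1" "g1 < g" and ng: "g1 \<notin> hom_set RS" and p: "1 \<le> p'" "p' \<le> p" and q: "1 \<le> q"
    and sob: "real (scaling_size s) * (1 / p' - 1 / p) < g - g1"
  obtains C where "0 < C" "\<And>f. f \<in> F_space s RS M g p' q \<Longrightarrow>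
    \<exists>H\<in>borel_measurable borel. \<exists>N\<in>null_sets lborel.
      Lp_norm lborel (ennreal p) H \<le> ennreal C * F_norm s RS M g p' q f \<and>
      hajlasz_majorant g1 f H N"
proof -
  have g0: "0 < g" using g by simp
  obtain K where K: "0 < K"
    "\<And>F H. borel_field g F \<Longrightarrow> averages_dominated p' (g - g1) (sharp g F) H \<Longrightarrow>
      \<forall>\<zeta>\<in>hom_below RS g1. \<forall>x. sharp g F x < top \<longrightarrow> ennreal (comp_norm RS \<zeta> (F x)) \<le> ennreal K * H x \<and>
        (\<forall>y l. sharp g F y < top \<longrightarrow> 0 < l \<longrightarrow> l \<le> 4 \<longrightarrow> scaled_norm s (x - y) \<le> l \<longrightarrow>
          ennreal (comp_norm RS \<zeta> (proj_below RS g1 (F x) - \<Gamma> x y (proj_below RS g1 (F y))))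
            \<le> ennreal (K * l powr (g1 - \<zeta>)) * (H x + H y))"
    by (rule hajlasz_estimate[OF g ng p(1)]) blast
  obtain C1 where C1: "0 < C1" "\<And>f N. N \<in> null_sets lborel \<Longrightarrow> borel_field g (\<lambda>x. if x \<in> N then 0 else f x) \<Longrightarrow>
    Lp_norm lborel (ennreal p') (sharp g (\<lambda>x. if x \<in> N then 0 else f x)) \<le> ennreal C1 * F_norm s RS M g p' q f"
    by (rule Lp_sharp_le_F_norm[OF g0 p(1) q]) blast
  have "\<exists>C>0. \<forall>D\<in>borel_measurable borel. \<exists>H\<in>borel_measurable borel.
     averages_dominated p' (g - g1) D H \<and>
     Lp_norm lborel (ennreal p) H \<le> ennreal C * Lp_norm lborel (ennreal p') D"
    unfolding averages_dominated_def
    by (rule dyadic_average_majorant[OF scaling p zero_less_one sob])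
  then obtain C2 where C2: "0 < C2" "\<forall>D\<in>borel_measurable borel. \<exists>H\<in>borel_measurable borel.
     averages_dominated p' (g - g1) D H \<and>
     Lp_norm lborel (ennreal p) H \<le> ennreal C2 * Lp_norm lborel (ennreal p') D"
    by blast
  have "\<exists>H\<in>borel_measurable borel. \<exists>N\<in>null_sets lborel.
      Lp_norm lborel (ennreal p) H \<le> ennreal (K * (C2 * C1)) * F_norm s RS M g p' q f \<and>
      hajlasz_majorant g1 f H N"
    if f: "f \<in> F_space s RS M g p' q" for f
  proof -
    have "strongly_measurable RS g f" "\<And>x. f x \<in> hspace_below RS g" and fin: "F_norm s RS M g p' q f < \<infinity>"
      using f by (auto simp: F_space_def)
    then obtain N0 where N0: "N0 \<in> null_sets lborel" and F: "borel_field g (\<lambda>x. if x \<in> N0 then 0 else f x)"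
      by (rule_tac borel_representative)
    let ?F = "\<lambda>x. if x \<in> N0 then 0 else f x"
    note Cs = C1(2)[OF N0 F]
    have [measurable]: "sharp g ?F \<in> borel_measurable borel" by (rule measurable_sharp[OF F g0])
    obtain H where [measurable]: "H \<in> borel_measurable borel" and dom: "averages_dominated p' (g - g1) (sharp g ?F) H"
      and H: "Lp_norm lborel (ennreal p) H \<le> ennreal C2 * Lp_norm lborel (ennreal p') (sharp g ?F)"
      using bspec[OF C2(2) \<open>sharp g ?F \<in> _\<close>] by blast
    have "enn_powr (Lp_norm lborel (ennreal p') (sharp g ?F)) p' < top"
    proof -
      have "Lp_norm lborel (ennreal p') (sharp g ?F) < top"
        using fin by (intro order.strict_trans1[OF Cs]) (auto simp: ennreal_mult_less_top)
      then show ?thesis by (cases "Lp_norm lborel (ennreal p') (sharp g ?F)") auto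
    qed
    then have "(\<integral>\<^sup>+x. enn_powr (sharp g ?F x) p' \<partial>lborel) \<noteq> \<infinity>"
      using p by (simp add: Lp_norm_powr)
    then have "AE x in lborel. enn_powr (sharp g ?F x) p' \<noteq> \<infinity>"
      by (intro nn_integral_PInf_AE) auto
    then have "AE x in lborel. sharp g ?F x < top"
      by eventually_elim (auto simp: less_top[symmetric])
    moreover have "AE x in lborel. x \<notin> N0" using N0 by (rule AE_not_in)
    ultimately have "AE x in lborel. sharp g ?F x < top \<and> x \<notin> N0" by eventually_elim auto
    then obtain N where N: "N \<in> null_sets lborel" "\<And>x. x \<notin> N \<Longrightarrow> sharp g ?F x < top \<and> x \<notin> N0"
      by (rule AE_E3) auto
    have "Lp_norm lborel (ennreal p) (\<lambda>x. ennreal K * H x) = ennreal K * Lp_norm lborel (ennreal p) H"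
      using K(1) p by (intro Lp_norm_cmult) auto
    also have "\<dots> \<le> ennreal K * (ennreal C2 * (ennreal C1 * F_norm s RS M g p' q f))"
      by (intro mult_left_mono order_trans[OF H] Cs) auto
    also have "\<dots> = ennreal (K * (C2 * C1)) * F_norm s RS M g p' q f"
      using K(1) C1(1) C2(1) by (simp add: ennreal_mult' mult.assoc)
    finally have Lp: "Lp_norm lborel (ennreal p) (\<lambda>x. ennreal K * H x) \<le> ennreal (K * (C2 * C1)) * F_norm s RS M g p' q f" .
    have "ennreal (comp_norm RS \<zeta> (f x)) \<le> ennreal K * H x" if "\<zeta> \<in> hom_below RS g1" "x \<notin> N" for \<zeta> x
    proof -
      have "ennreal (comp_norm RS \<zeta> (?F x)) \<le> ennreal K * H x"
        using K(2)[OF F dom] that(1) N(2)[OF that(2)] by blast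
      then show ?thesis using N(2)[OF that(2)] by simp
    qed
    moreover have "ennreal (increment RS M \<zeta> (\<lambda>x. proj_below RS g1 (f x)) x h) \<le> ennreal (l powr (g1 - \<zeta>)) * (ennreal K * H x + ennreal K * H (x + h))"
      if "\<zeta> \<in> hom_below RS g1" "x \<notin> N" "x + h \<notin> N" "0 < l" "l \<le> 4" "scaled_norm s h \<le> l" for \<zeta> x h l
    proof -
      have "ennreal (increment RS M \<zeta> (\<lambda>x. proj_below RS g1 (f x)) x h) \<le> ennreal (K * l powr (g1 - \<zeta>)) * (H (x + h) + H x)"
      proof -
        have xh: "sharp g ?F x < top" "sharp g ?F (x + h) < top" "x \<notin> N0" "x + h \<notin> N0"
          using N(2)[OF that(2)] N(2)[OF that(3)] by auto
        have "scaled_norm s (x + h - x) \<le> l" using that(6) by simp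
        with K(2)[OF F dom] that(1,4,5) xh(1,2)
        have "ennreal (comp_norm RS \<zeta> (proj_below RS g1 (?F (x + h)) - \<Gamma> (x + h) x (proj_below RS g1 (?F x))))
            \<le> ennreal (K * l powr (g1 - \<zeta>)) * (H (x + h) + H x)"
          by blast
        then show ?thesis using xh(3,4) by (simp add: increment_def)
      qed
      also have "\<dots> = ennreal (l powr (g1 - \<zeta>)) * (ennreal K * H x + ennreal K * H (x + h))"
        using K(1) by (simp add: ennreal_mult' distrib_left mult_ac add.commute)
      finally show ?thesis .
    qed
    ultimately show ?thesis
      using Lp N(1) unfolding hajlasz_majorant_def
      by (intro bexI[of _ "\<lambda>x. ennreal K * H x"] bexI[of _ N] conjI) auto
  qed
  then show ?thesis using K(1) C1(1) C2(1) by (intro that[of "K * (C2 * C1)"]) auto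
qed

end

section \<open>Auxiliary estimates for the embeddings\<close>

lemma measurable_log_measure:
  "f \<in> borel_measurable borel \<Longrightarrow> f \<in> borel_measurable log_measure"
  unfolding log_measure_def measurable_density_eq1
  by (intro measurable_restrict_space1 measurable_completion) auto

lemma measurable_log_measure_powr [measurable]: "(\<lambda>l. l powr a) \<in> borel_measurable log_measure"
  by (rule measurable_log_measure) measurable

lemma measurable_scaled_measure:
  "f \<in> borel_measurable borel \<Longrightarrow> f \<in> borel_measurable (scaled_measure s)"
  unfolding scaled_measure_def measurable_density_eq1
  by (intro measurable_restrict_space1 measurable_completion) auto

text \<open>
  A gain \<open>l powr e\<close> makes every exponent \<open>r\<close> in the scale variable equally good.
  Measurability of \<open>J\<close> matters for \<open>r = \<infinity>\<close>, where the essential supremum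
  of a non-measurable function is infinite.
\<close>

lemma Lp_norm_log_measure_powr:
  assumes e: "0 < e" and r: "1 \<le> r"
  obtains C where "0 < C" "\<And>J A. J \<in> borel_measurable log_measure \<Longrightarrow>
    (\<And>l. l \<in> {0<..1} \<Longrightarrow> J l \<le> ennreal (l powr e) * A) \<Longrightarrow> Lp_norm log_measure r J \<le> ennreal C * A"
proof (cases r)
  case top
  have "Lp_norm log_measure r J \<le> ennreal 1 * A"
    if J: "J \<in> borel_measurable log_measure" and le: "\<And>l. l \<in> {0<..1} \<Longrightarrow> J l \<le> ennreal (l powr e) * A" for J A
  proof -
    have "J l \<le> A" if "l \<in> space log_measure" for l
    proof -
      have "J l \<le> ennreal (l powr e) * A" using that by (intro le) simp
      also have "\<dots> \<le> ennreal 1 * A"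
        using that e by (intro mult_right_mono ennreal_leI powr_le1) auto
      finally show ?thesis by simp
    qed
    then have "esssup log_measure J \<le> A" using J by (intro esssup_I) auto
    then show ?thesis using top by simp
  qed
  then show ?thesis by (intro that[of 1]) auto
next
  case (real t)
  with r have t: "1 \<le> t" by simp
  define C where "C = (1 / (e * t)) powr (1 / t)"
  have "Lp_norm log_measure r J \<le> ennreal C * A"
    if le: "\<And>l. l \<in> {0<..1} \<Longrightarrow> J l \<le> ennreal (l powr e) * A" for J A
  proof -
    have "(\<integral>\<^sup>+l. enn_powr (J l) t \<partial>log_measure) \<le> (\<integral>\<^sup>+l. enn_powr A t * ennreal (l powr (e * t)) \<partial>log_measure)"
    proof (intro nn_integral_mono)
      fix l assume "l \<in> space log_measure"
      then have "enn_powr (J l) t \<le> enn_powr (ennreal (l powr e) * A) t"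
        using t by (intro enn_powr_mono le) auto
      then show "enn_powr (J l) t \<le> enn_powr A t * ennreal (l powr (e * t))"
        using t by (simp add: enn_powr_mult powr_powr mult.commute)
    qed
    also have "\<dots> = enn_powr A t * (\<integral>\<^sup>+l. ennreal (l powr (e * t)) \<partial>log_measure)"
      by (intro nn_integral_cmult) auto
    also have "\<dots> \<le> enn_powr A t * ennreal (1 / (e * t))"
      using e t by (intro mult_left_mono nn_integral_log_measure_powr) auto
    finally have "enn_powr (\<integral>\<^sup>+l. enn_powr (J l) t \<partial>log_measure) (1 / t) \<le> enn_powr (enn_powr A t * ennreal (1 / (e * t))) (1 / t)"
      using t by (intro enn_powr_mono) auto
    also have "\<dots> = A * ennreal C"
      using t e by (simp add: enn_powr_mult enn_powr_powr C_def)
    finally show ?thesis using real t by (simp add: Lp_norm_real mult.commute)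
  qed
  moreover have "0 < C" using e t by (simp add: C_def)
  ultimately show ?thesis by (intro that[of C]) auto
qed

lemma nn_integral_translate:
  fixes x :: "real^'d::finite" and H :: "real^'d \<Rightarrow> ennreal"
  assumes [measurable]: "H \<in> borel_measurable borel"
  shows "(\<integral>\<^sup>+h. H (x + h) \<partial>lborel) = (\<integral>\<^sup>+y. H y \<partial>lborel)"
proof -
  have "(\<integral>\<^sup>+y. H y \<partial>lborel) = (\<integral>\<^sup>+y. H y \<partial>distr lborel borel ((+) x))"
    by (simp only: lborel_distr_plus)
  also have "\<dots> = (\<integral>\<^sup>+h. H (x + h) \<partial>lborel)"
    by (intro nn_integral_distr) auto
  finally show ?thesis by simp
qed

text \<open>
  Hoelder's inequality on a box: it is \<open>weighted_power_mean\<close> for the measure whose density is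
  \<open>2 ^ (m * N)\<close> times the indicator of the box, with \<open>N\<close> the homogeneous dimension.
  The mass of this measure does not depend on \<open>m\<close>.
\<close>

lemma local_mean_le:
  fixes s :: "'d::finite \<Rightarrow> nat" and H :: "real^'d \<Rightarrow> ennreal"
  assumes s: "scaling s" and [measurable]: "H \<in> borel_measurable borel" and p: "1 < p" and c: "0 < c"
    and le: "ennreal (2 ^ (m * scaling_size s)) *
      (\<integral>\<^sup>+y. enn_powr (H y) p * indicator (scaled_ball s x (c / 2 ^ m)) y \<partial>lborel) \<le> enn_powr R p"
  shows "ennreal (2 ^ (m * scaling_size s)) *
      (\<integral>\<^sup>+y. H y * indicator (scaled_ball s x (c / 2 ^ m)) y \<partial>lborel)
    \<le> ennreal (2 ^ CARD('d) * c ^ scaling_size s + 1) * R"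
proof -
  let ?N = "scaling_size s" and ?Q = "scaled_ball s x (c / 2 ^ m)"
  let ?w = "\<lambda>y. ennreal (2 ^ (m * ?N)) * indicator ?Q y"
  have [measurable]: "?Q \<in> sets borel" using s by simp
  let ?M = "density lborel ?w"
  have int: "(\<integral>\<^sup>+y. f y \<partial>?M) = ennreal (2 ^ (m * ?N)) * (\<integral>\<^sup>+y. f y * indicator ?Q y \<partial>lborel)"
    if [measurable]: "f \<in> borel_measurable borel" for f
    by (subst nn_integral_density, simp_all add: nn_integral_cmult mult.assoc mult.commute[of "indicator _ _"])
  have mass: "(\<integral>\<^sup>+y. ennreal 1 \<partial>?M) \<le> ennreal (2 ^ CARD('d) * c ^ ?N)"
  proof -
    have "(\<integral>\<^sup>+y. ennreal 1 \<partial>?M) = ennreal (2 ^ (m * ?N)) * ennreal (2 ^ CARD('d) * (c / 2 ^ m) ^ ?N)"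
      using s c by (subst int) (simp_all add: emeasure_scaled_ball)
    also have "\<dots> = ennreal (2 ^ (m * ?N) * (2 ^ CARD('d) * (c / 2 ^ m) ^ ?N))"
      by (simp add: ennreal_mult')
    also have "2 ^ (m * ?N) * (2 ^ CARD('d) * (c / 2 ^ m) ^ ?N) = 2 ^ CARD('d) * c ^ ?N"
      by (simp add: power_divide power_mult)
    finally show ?thesis by simp
  qed
  have "(\<integral>\<^sup>+y. ennreal 1 * enn_powr (H y) 1 \<partial>?M)
      \<le> ennreal (2 ^ CARD('d) * c ^ ?N + 1) * enn_powr (\<integral>\<^sup>+y. enn_powr (H y) p \<partial>?M) (1 / p)"
    using mass c p by (intro weighted_power_mean) auto
  also have "\<dots> \<le> ennreal (2 ^ CARD('d) * c ^ ?N + 1) * enn_powr (enn_powr R p) (1 / p)"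
    using le p by (intro mult_left_mono enn_powr_mono) (auto simp: int)
  finally show ?thesis using p by (simp add: int enn_powr_powr)
qed

context reg_model
begin

lemma strongly_measurable_proj_below:
  fixes f :: "real^'d \<Rightarrow> 'v"
  assumes "g \<le> g'" "strongly_measurable RS g' f"
  shows "strongly_measurable RS g (\<lambda>x. proj_below RS g (f x))"
  unfolding strongly_measurable_def
proof
  fix \<zeta> assume \<zeta>: "\<zeta> \<in> hom_below RS g"
  then have "\<zeta> \<in> hom_below RS g'" using assms(1) by (auto simp: hom_below_def)
  with assms(2) obtain u :: "nat \<Rightarrow> real^'d \<Rightarrow> 'v" where
    "\<forall>n. simple_function lebesgue (u n) \<and> range (u n) \<subseteq> hspace RS \<zeta>"
    "AE x in lebesgue. (\<lambda>n. hnorm RS \<zeta> (u n x - proj RS \<zeta> (f x))) \<longlonglongrightarrow> 0"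
    unfolding strongly_measurable_def by blast
  then show "\<exists>u::nat \<Rightarrow> real^'d \<Rightarrow> 'v. (\<forall>n. simple_function lebesgue (u n) \<and> range (u n) \<subseteq> hspace RS \<zeta>) \<and>
      (AE x in lebesgue. (\<lambda>n. hnorm RS \<zeta> (u n x - proj RS \<zeta> (proj_below RS g (f x)))) \<longlonglongrightarrow> 0)"
    using \<zeta> by (intro exI[of _ u]) (simp add: proj_proj_below)
qed

text \<open>
  Homogeneities are locally finite, so some order \<open>g1\<close> slightly above \<open>g\<close> defines
  the same truncation. The difference \<open>g1 - g\<close> is the gain in the scale that the embeddings
  spend.
\<close>

lemma homogeneity_gap:
  assumes g: "g \<notin> hom_set RS" and b: "g < b"
  obtains g1 where "g < g1" "g1 < b" "g1 \<notin> hom_set RS" "hom_below RS g1 = hom_below RS g"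
    "proj_below RS g1 = proj_below RS g"
proof -
  \<comment> \<open>\<open>m\<close> is the smallest homogeneity above \<open>g\<close>, or \<open>b\<close>.\<close>
  define m where "m = Min (insert b (hom_set RS \<inter> {g..b}))"
  have fin: "finite (insert b (hom_set RS \<inter> {g..b}))"
    using reg_structure by (simp add: is_regularity_structure_def)
  have gm: "g < m" unfolding m_def using fin g b by (subst Min_gr_iff) (auto simp: less_le)
  have mb: "m \<le> b" unfolding m_def using fin by simp
  have m: "m \<le> z" if "z \<in> hom_set RS" "g \<le> z" "z \<le> b" for z
    unfolding m_def using fin that by (intro Min_le) auto
  define g1 where "g1 = (g + m) / 2"
  have g1: "g < g1" "g1 < m" using gm by (auto simp: g1_def)
  have no: "z \<notin> hom_set RS" if "g \<le> z" "z \<le> g1" for z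
    using m[of z] that g1 mb by force
  have eq: "hom_below RS g1 = hom_below RS g"
    using no g1 by (auto simp: hom_below_def) (meson not_le less_imp_le)
  show ?thesis
    using g1 mb no[of g1] eq by (intro that[of g1]) (auto simp: proj_below_def[abs_def])
qed

lemma measurable_F_density:
  assumes sm: "strongly_measurable RS g f" and f: "\<And>x. f x \<in> hspace_below RS g" and g: "0 < g"
  obtains N where "N \<in> null_sets lborel"
    "\<And>x \<zeta> g'. x \<notin> N \<Longrightarrow> \<zeta> \<in> hom_below RS g \<Longrightarrow> F_density g' f \<zeta> x \<in> borel_measurable log_measure"
proof -
  obtain N where N: "N \<in> null_sets lborel" "borel_field g (\<lambda>x. if x \<in> N then 0 else f x)"
    using borel_representative[OF sm f] by blast
  let ?F = "\<lambda>x. if x \<in> N then 0 else f x"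
  have [measurable]: "scaled_norm s \<in> borel_measurable borel"
    using scaling by (rule borel_measurable_scaled_norm)
  have "F_density g' f \<zeta> x \<in> borel_measurable log_measure" if x: "x \<notin> N" and \<zeta>: "\<zeta> \<in> hom_below RS g" for x \<zeta> g'
  proof -
    have [measurable]: "increment RS M \<zeta> ?F x \<in> borel_measurable borel"
    proof -
      have "(\<lambda>h. case_prod (increment RS M \<zeta> ?F) (x, h)) \<in> borel_measurable borel"
        by (intro measurable_compose[OF _ measurable_increment[OF N(2) \<zeta> g]]) auto
      then show ?thesis by simp
    qed
    have ind: "indicator (scaled_ball s 0 (4 * l)) h = (indicator {..0} (scaled_norm s h - 4 * l) :: ennreal)" for h l
      by (simp add: mem_scaled_ball indicator_def)
    let ?I = "\<lambda>l. \<integral>\<^sup>+h. ennreal (increment RS M \<zeta> ?F x h) * indicator (scaled_ball s 0 (4 * l)) h \<partial>lborel"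
    have "?I \<in> borel_measurable borel" unfolding ind by measurable
    then have meas: "(\<lambda>l. ennreal (1 / (2 ^ CARD('d) * (4 * l) ^ scaling_size s * l powr (g' - \<zeta>))) * ?I l) \<in> borel_measurable log_measure"
      by (intro measurable_log_measure borel_measurable_times_ennreal) auto
    have eq: "F_density g' f \<zeta> x l = ennreal (1 / (2 ^ CARD('d) * (4 * l) ^ scaling_size s * l powr (g' - \<zeta>))) * ?I l"
      if "l \<in> space log_measure" for l
    proof -
      have "?I l = (\<integral>\<^sup>+h. ennreal (increment RS M \<zeta> f x h) * indicator (scaled_ball s 0 (4 * l)) h \<partial>lborel)"
        by (intro nn_integral_cong_AE) (use increment_representative[OF N(1) x, of \<zeta> f] in \<open>auto elim: eventually_mono\<close>)
      then show ?thesis using that hom_belowD(1)[OF \<zeta>] by (simp add: F_density_eq)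
    qed
    show ?thesis using meas by (subst measurable_cong[OF eq])
  qed
  then show ?thesis using N(1) by (rule that[rotated])
qed

lemma F_space_memI:
  assumes "g \<le> g'" "f \<in> F_space s RS M g' p' q'" "F_norm s RS M g p q (\<lambda>x. proj_below RS g (f x)) \<le> ennreal C * F_norm s RS M g' p' q' f"
  shows "(\<lambda>x. proj_below RS g (f x)) \<in> F_space s RS M g p q"
  using assms strongly_measurable_proj_below[OF assms(1)] proj_below_mem
  by (auto simp: F_space_def ennreal_mult_less_top intro: order.strict_trans1)

section \<open>Lowering the order and the exponent of the scale variable\<close>

text \<open>
  Truncation changes the increment by the transport of the removed part, whose homogeneities exceed
  \<open>g1\<close>; transported to component \<open>\<zeta>\<close> over a distance of order
  \<open>l\<close>, it is of order \<open>l powr (g1 - \<zeta>)\<close>.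
\<close>

lemma truncation_increment_le:
  assumes g: "0 < g" "g \<le> g'" and gap: "g < g1" "hom_below RS g1 = hom_below RS g" "g1 \<notin> hom_set RS" "g1 < g'"
  obtains C where "0 < C" "\<And>f x h l \<zeta>. (\<And>x. f x \<in> hspace_below RS g') \<Longrightarrow> 0 < l \<Longrightarrow> l \<le> 1 \<Longrightarrow>
    scaled_norm s h \<le> 4 * l \<Longrightarrow> \<zeta> \<in> hom_below RS g \<Longrightarrow>
    increment RS M \<zeta> (\<lambda>x. proj_below RS g (f x)) x h
      \<le> increment RS M \<zeta> f x h + C * l powr (g1 - \<zeta>) * (\<Sum>\<beta>\<in>hom_below RS g'. comp_norm RS \<beta> (f x))"
proof -
  let ?A = "hom_below RS g'"
  have sub: "hom_below RS g \<subseteq> ?A" using g by (auto simp: hom_below_def)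
  have g'0: "0 < g'" using g by simp
  obtain C1 where C1: "1 \<le> C1" "\<And>x y l \<tau>. 0 < l \<Longrightarrow> l \<le> 4 \<Longrightarrow> scaled_norm s (x - y) \<le> l \<Longrightarrow>
    \<tau> \<in> hspace_below RS g' \<Longrightarrow> wnorm g' l (\<Gamma> x y \<tau>) \<le> C1 * wnorm g' l \<tau>"
    by (rule wnorm_Gamma[OF g'0]) blast
  define \<kappa> where "\<kappa> = (\<Sum>\<beta>\<in>?A. 4 powr (\<beta> - g1))"
  define \<kappa>' where "\<kappa>' = (\<Sum>\<beta>\<in>?A. 4 powr (g1 - \<beta>))"
  have \<kappa>0: "0 \<le> \<kappa>" "0 \<le> \<kappa>'" by (auto simp: \<kappa>_def \<kappa>'_def sum_nonneg)
  have \<kappa>: "4 powr (\<beta> - g1) \<le> \<kappa>" "4 powr (g1 - \<beta>) \<le> \<kappa>'" if "\<beta> \<in> ?A" for \<beta>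
    unfolding \<kappa>_def \<kappa>'_def using that finite_hom_below
    by (auto intro!: member_le_sum[of \<beta> _ "\<lambda>\<beta>. 4 powr (\<beta> - g1)"] member_le_sum[of \<beta> _ "\<lambda>\<beta>. 4 powr (g1 - \<beta>)"])
  let ?C = "\<kappa>' * C1 * \<kappa> + 1"
  have "increment RS M \<zeta> (\<lambda>x. proj_below RS g (f x)) x h
      \<le> increment RS M \<zeta> f x h + ?C * l powr (g1 - \<zeta>) * (\<Sum>\<beta>\<in>?A. comp_norm RS \<beta> (f x))"
    if f: "\<And>x. f x \<in> hspace_below RS g'" and l: "0 < l" "l \<le> 1" and h: "scaled_norm s h \<le> 4 * l"
      and \<zeta>: "\<zeta> \<in> hom_below RS g" for f x h l \<zeta>
  proof -
    let ?S = "\<Sum>\<beta>\<in>?A. comp_norm RS \<beta> (f x)" and ?P = "proj_below RS g"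
    have S0: "0 \<le> ?S" using comp_norm_nonneg hom_belowD(1) by (intro sum_nonneg) auto
    have \<zeta>': "\<zeta> \<in> hom_set RS" "\<zeta> \<in> ?A" using \<zeta> sub hom_belowD(1) by auto
    define \<tau> where "\<tau> = f x - ?P (f x)"
    have \<tau>: "\<tau> \<in> hspace_below RS g'"
      unfolding \<tau>_def using f proj_below_mem[of g] hspace_below_mono[OF g(2)]
      by (intro subspace_diff[OF subspace_hspace_below]) auto
    have "increment RS M \<zeta> (\<lambda>x. ?P (f x)) x h = comp_norm RS \<zeta> ((f (x + h) - \<Gamma> (x + h) x (f x)) + \<Gamma> (x + h) x \<tau>)"
      using \<zeta> unfolding increment_def comp_norm_def
      by (simp add: proj_simps Gamma_simps proj_proj_below \<tau>_def)
    also have "\<dots> \<le> increment RS M \<zeta> f x h + comp_norm RS \<zeta> (\<Gamma> (x + h) x \<tau>)"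
      unfolding increment_def by (rule comp_norm_add[OF \<zeta>'(1)])
    also have "comp_norm RS \<zeta> (\<Gamma> (x + h) x \<tau>) \<le> ?C * l powr (g1 - \<zeta>) * ?S"
    proof -
      have "wnorm g' (4 * l) \<tau> \<le> (\<Sum>\<beta>\<in>?A. (4 * l) powr g1 * \<kappa> * comp_norm RS \<beta> (f x))"
        unfolding wnorm_def
      proof (intro sum_mono)
        fix \<beta> assume \<beta>: "\<beta> \<in> ?A"
        have nn: "0 \<le> comp_norm RS \<beta> (f x)" by (intro comp_norm_nonneg hom_belowD(1)[OF \<beta>])
        show "(4 * l) powr \<beta> * comp_norm RS \<beta> \<tau> \<le> (4 * l) powr g1 * \<kappa> * comp_norm RS \<beta> (f x)"
        proof (cases "\<beta> \<in> hom_below RS g")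
          case True
          then have "comp_norm RS \<beta> \<tau> = 0"
            using hom_belowD(1)[OF \<beta>] by (intro comp_norm_proj_eq_0) (simp_all add: \<tau>_def proj_simps proj_proj_below)
          then show ?thesis using nn \<kappa>0 by simp
        next
          case False
          then have "comp_norm RS \<beta> \<tau> = comp_norm RS \<beta> (f x)"
            by (simp add: comp_norm_def \<tau>_def proj_simps proj_proj_below)
          moreover have "(4 * l) powr \<beta> \<le> (4 * l) powr g1 * \<kappa>"
          proof -
            have "g1 < \<beta>" using False \<beta> gap unfolding hom_below_def by force
            then have "(4 * l) powr (\<beta> - g1) \<le> 4 powr (\<beta> - g1)"
              using l by (intro powr_mono2) auto
            then have "(4 * l) powr g1 * (4 * l) powr (\<beta> - g1) \<le> (4 * l) powr g1 * \<kappa>"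
              using \<kappa>(1)[OF \<beta>] by (intro mult_left_mono) auto
            then show ?thesis by (simp add: powr_add[symmetric])
          qed
          ultimately show ?thesis using nn by (simp add: mult_right_mono)
        qed
      qed
      also have "\<dots> = (4 * l) powr g1 * \<kappa> * ?S" by (simp add: sum_distrib_left)
      finally have "C1 * wnorm g' (4 * l) \<tau> \<le> C1 * ((4 * l) powr g1 * \<kappa> * ?S)"
        using C1(1) by (intro mult_left_mono) auto
      moreover have "wnorm g' (4 * l) (\<Gamma> (x + h) x \<tau>) \<le> C1 * wnorm g' (4 * l) \<tau>"
        using l h by (intro C1 \<tau>) auto
      ultimately have "(4 * l) powr (- \<zeta>) * wnorm g' (4 * l) (\<Gamma> (x + h) x \<tau>) \<le> (4 * l) powr (- \<zeta>) * (C1 * ((4 * l) powr g1 * \<kappa> * ?S))"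
        by (intro mult_left_mono) auto
      then have "comp_norm RS \<zeta> (\<Gamma> (x + h) x \<tau>) \<le> (4 * l) powr (- \<zeta>) * (C1 * ((4 * l) powr g1 * \<kappa> * ?S))"
        using comp_norm_le_wnorm[OF \<zeta>'(2), of "4 * l" "\<Gamma> (x + h) x \<tau>"] l by linarith
      also have "\<dots> = ((4 * l) powr (- \<zeta>) * (4 * l) powr g1) * (C1 * \<kappa> * ?S)" by (simp add: mult_ac)
      also have "(4 * l) powr (- \<zeta>) * (4 * l) powr g1 = 4 powr (g1 - \<zeta>) * l powr (g1 - \<zeta>)"
        using l by (subst powr_add[symmetric]) (simp add: powr_mult)
      also have "4 powr (g1 - \<zeta>) * l powr (g1 - \<zeta>) * (C1 * \<kappa> * ?S) \<le> \<kappa>' * l powr (g1 - \<zeta>) * (C1 * \<kappa> * ?S)"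
        using \<kappa>(2)[OF \<zeta>'(2)] C1(1) \<kappa>0 S0 by (intro mult_right_mono) auto
      also have "\<dots> \<le> ?C * l powr (g1 - \<zeta>) * ?S"
        using S0 by (simp add: algebra_simps)
      finally show ?thesis .
    qed
    finally show ?thesis by simp
  qed
  moreover have "0 < ?C" using C1(1) \<kappa>0 by (intro add_nonneg_pos) auto
  ultimately show ?thesis by (intro that[of ?C]) auto
qed

lemma truncation_density_le:
  assumes g: "0 < g" "g \<le> g'" and gap: "g < g1" "hom_below RS g1 = hom_below RS g" "g1 \<notin> hom_set RS" "g1 < g'"
  obtains C where "0 < C" "\<And>f x l \<zeta>. (\<And>x. f x \<in> hspace_below RS g') \<Longrightarrow> 0 < l \<Longrightarrow> l \<le> 1 \<Longrightarrow> \<zeta> \<in> hom_below RS g \<Longrightarrow>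
    F_density g (\<lambda>x. proj_below RS g (f x)) \<zeta> x l
      \<le> ennreal (l powr (g1 - g)) * F_density g' f \<zeta> x l
        + ennreal (l powr (g1 - g)) * (ennreal C * (\<Sum>\<beta>\<in>hom_below RS g'. ennreal (comp_norm RS \<beta> (f x))))"
proof -
  let ?A = "hom_below RS g'" and ?N = "scaling_size s"
  obtain C where C: "0 < C" "\<And>f x h l \<zeta>. (\<And>x. f x \<in> hspace_below RS g') \<Longrightarrow> 0 < l \<Longrightarrow> l \<le> 1 \<Longrightarrow>
    scaled_norm s h \<le> 4 * l \<Longrightarrow> \<zeta> \<in> hom_below RS g \<Longrightarrow>
    increment RS M \<zeta> (\<lambda>x. proj_below RS g (f x)) x h
      \<le> increment RS M \<zeta> f x h + C * l powr (g1 - \<zeta>) * (\<Sum>\<beta>\<in>?A. comp_norm RS \<beta> (f x))"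
    by (rule truncation_increment_le[OF g gap]) blast
  have "F_density g (\<lambda>x. proj_below RS g (f x)) \<zeta> x l
      \<le> ennreal (l powr (g1 - g)) * F_density g' f \<zeta> x l
        + ennreal (l powr (g1 - g)) * (ennreal C * (\<Sum>\<beta>\<in>?A. ennreal (comp_norm RS \<beta> (f x))))"
    if f: "\<And>x. f x \<in> hspace_below RS g'" and l: "0 < l" "l \<le> 1" and \<zeta>: "\<zeta> \<in> hom_below RS g" for f x l \<zeta>
  proof -
    define S where "S = (\<Sum>\<beta>\<in>?A. comp_norm RS \<beta> (f x))"
    have S0: "0 \<le> S" unfolding S_def using comp_norm_nonneg hom_belowD(1) by (intro sum_nonneg) auto
    have S: "(\<Sum>\<beta>\<in>?A. ennreal (comp_norm RS \<beta> (f x))) = ennreal S"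
      unfolding S_def using comp_norm_nonneg hom_belowD(1) by (intro sum_ennreal) auto
    have \<zeta>': "\<zeta> \<in> hom_set RS" using hom_belowD(1)[OF \<zeta>] .
    let ?Q = "scaled_ball s (0::real^'d) (4 * l)"
    define V where "V = 2 ^ CARD('d) * (4 * l) ^ ?N"
    have V: "0 < V" using l by (simp add: V_def)
    have [measurable]: "?Q \<in> sets borel" using scaling by simp
    let ?I = "\<integral>\<^sup>+h. ennreal (increment RS M \<zeta> f x h) * indicator ?Q h \<partial>lborel"
    have "(\<integral>\<^sup>+h. ennreal (increment RS M \<zeta> (\<lambda>x. proj_below RS g (f x)) x h) * indicator ?Q h \<partial>lborel)
        \<le> (\<integral>\<^sup>+h. ennreal (increment RS M \<zeta> f x h) * indicator ?Q h + ennreal (C * l powr (g1 - \<zeta>) * S) * indicator ?Q h \<partial>lborel)"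
    proof (intro nn_integral_mono)
      fix h
      show "ennreal (increment RS M \<zeta> (\<lambda>x. proj_below RS g (f x)) x h) * indicator ?Q h
        \<le> ennreal (increment RS M \<zeta> f x h) * indicator ?Q h + ennreal (C * l powr (g1 - \<zeta>) * S) * indicator ?Q h"
      proof (cases "h \<in> ?Q")
        case True
        then have "scaled_norm s h \<le> 4 * l" by (simp add: mem_scaled_ball)
        have "increment RS M \<zeta> (\<lambda>x. proj_below RS g (f x)) x h \<le> increment RS M \<zeta> f x h + C * l powr (g1 - \<zeta>) * S"
          unfolding S_def by (rule C(2)[OF f l \<open>scaled_norm s h \<le> 4 * l\<close> \<zeta>])
        then have "ennreal (increment RS M \<zeta> (\<lambda>x. proj_below RS g (f x)) x h) \<le> ennreal (increment RS M \<zeta> f x h + C * l powr (g1 - \<zeta>) * S)"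
          by (rule ennreal_leI)
        also have "\<dots> = ennreal (increment RS M \<zeta> f x h) + ennreal (C * l powr (g1 - \<zeta>) * S)"
          using increment_nonneg[OF \<zeta>'] C(1) S0 by (intro ennreal_plus) auto
        finally show ?thesis using True by simp
      qed simp
    qed
    also have "\<dots> \<le> ?I + (\<integral>\<^sup>+h. ennreal (C * l powr (g1 - \<zeta>) * S) * indicator ?Q h \<partial>lborel)"
      by (intro nn_integral_add_le) auto
    also have "(\<integral>\<^sup>+h. ennreal (C * l powr (g1 - \<zeta>) * S) * indicator ?Q h \<partial>lborel) = ennreal (C * l powr (g1 - \<zeta>) * S * V)"
      using l scaling V C(1) S0 by (simp add: nn_integral_cmult_indicator emeasure_scaled_ball V_def ennreal_mult'[symmetric])
    finally have I: "(\<integral>\<^sup>+h. ennreal (increment RS M \<zeta> (\<lambda>x. proj_below RS g (f x)) x h) * indicator ?Q h \<partial>lborel)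
        \<le> ?I + ennreal (C * l powr (g1 - \<zeta>) * S * V)" .
    have "F_density g (\<lambda>x. proj_below RS g (f x)) \<zeta> x l \<le> ennreal (1 / (V * l powr (g - \<zeta>))) * (?I + ennreal (C * l powr (g1 - \<zeta>) * S * V))"
      unfolding F_density_eq[OF l(1) \<zeta>'] V_def[symmetric] by (intro mult_left_mono I) auto
    also have "\<dots> = ennreal (1 / (V * l powr (g - \<zeta>))) * ?I + ennreal (l powr (g1 - g)) * (ennreal C * ennreal S)"
    proof -
      have "1 / (V * l powr (g - \<zeta>)) * (C * l powr (g1 - \<zeta>) * S * V) = (l powr (g1 - \<zeta>) / l powr (g - \<zeta>)) * (C * S)"
        using V by (simp add: field_simps)
      also have "l powr (g1 - \<zeta>) / l powr (g - \<zeta>) = l powr (g1 - g)"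
        by (simp add: powr_diff[symmetric])
      finally show ?thesis
        using V C(1) S0 by (simp add: distrib_left ennreal_mult'[symmetric])
    qed
    also have "ennreal (1 / (V * l powr (g - \<zeta>))) * ?I \<le> ennreal (l powr (g1 - g)) * F_density g' f \<zeta> x l"
    proof -
      have "1 / (V * l powr (g - \<zeta>)) = l powr (g' - g) * (1 / (V * l powr (g' - \<zeta>)))"
      proof -
        have "l powr (g' - \<zeta>) = l powr (g' - g) * l powr (g - \<zeta>)" by (simp add: powr_add[symmetric])
        then show ?thesis using l V by simp
      qed
      also have "\<dots> \<le> l powr (g1 - g) * (1 / (V * l powr (g' - \<zeta>)))"
        using l gap V by (intro mult_right_mono powr_mono') auto
      finally have "ennreal (1 / (V * l powr (g - \<zeta>))) * ?I \<le> ennreal (l powr (g1 - g) * (1 / (V * l powr (g' - \<zeta>)))) * ?I"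
        by (intro mult_right_mono ennreal_leI) auto
      also have "\<dots> = ennreal (l powr (g1 - g)) * F_density g' f \<zeta> x l"
        unfolding F_density_eq[OF l(1) \<zeta>'] V_def[symmetric]
        by (subst ennreal_mult') (simp_all add: mult.assoc)
      finally show ?thesis .
    qed
    finally show ?thesis by (simp add: S add_right_mono)
  qed
  then show ?thesis using C(1) by (rule that[rotated])
qed

text \<open>
  Both terms of \<open>truncation_density_le\<close> carry the factor \<open>l powr e\<close> with \<open>e >
  0\<close>. In the first one Hoelder's inequality turns the exponent \<open>q'\<close> into \<open>q\<close>,
  because \<open>l powr e\<close> is integrable to every power under the logarithmic measure; in the second
  one the factor is all that depends on \<open>l\<close>.
\<close>

lemma embedding_smaller_q:
  assumes g: "0 < g" "g < g'" and ng: "g \<notin> hom_set RS" and p: "1 \<le> p" and q: "1 \<le> q" "q < q'"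
  shows "continuous_embedding (\<lambda>f x. proj_below RS g (f x))
     (F_space s RS M g' p q') (F_norm s RS M g' p q') (F_space s RS M g p q) (F_norm s RS M g p q)"
proof -
  let ?A = "hom_below RS g'"
  obtain g1 where gap: "g < g1" "g1 < g'" "g1 \<notin> hom_set RS" "hom_below RS g1 = hom_below RS g"
    by (rule homogeneity_gap[OF ng g(2)]) blast
  have gg: "g \<le> g'" using g by simp
  have sub: "hom_below RS g \<subseteq> ?A" using g by (auto simp: hom_below_def)
  define e where "e = g1 - g"
  have e: "0 < e" using gap by (simp add: e_def)
  obtain t where t: "q = ennreal t" "1 \<le> t" using q by (cases q) (auto simp: less_top[symmetric])
  obtain C1 where C1: "0 < C1" "\<And>f x l \<zeta>. (\<And>x. f x \<in> hspace_below RS g') \<Longrightarrow> 0 < l \<Longrightarrow> l \<le> 1 \<Longrightarrow> \<zeta> \<in> hom_below RS g \<Longrightarrow>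
    F_density g (\<lambda>x. proj_below RS g (f x)) \<zeta> x l
      \<le> ennreal (l powr (g1 - g)) * F_density g' f \<zeta> x l
        + ennreal (l powr (g1 - g)) * (ennreal C1 * (\<Sum>\<beta>\<in>?A. ennreal (comp_norm RS \<beta> (f x))))"
    by (rule truncation_density_le[OF g(1) gg gap(1,4,3,2)]) blast
  obtain C2 where C2: "0 < C2" "\<And>J A. J \<in> borel_measurable log_measure \<Longrightarrow>
    (\<And>l. l \<in> {0<..1} \<Longrightarrow> J l \<le> ennreal (l powr e) * A) \<Longrightarrow> Lp_norm log_measure q J \<le> ennreal C2 * A"
    by (rule Lp_norm_log_measure_powr[OF e q(1)]) blast
  define C3 where "C3 = (1 / (e * t) + 1) powr (1 / t)"
  have "0 < 1 / (e * t) + 1" using e t by (intro add_pos_pos) auto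
  then have C3: "0 < C3" unfolding C3_def by (subst powr_gt_zero) linarith
  define C4 where "C4 = 4 * max C3 (C2 * C1)"
  have C4: "0 < C4" using C3 by (simp add: C4_def less_max_iff_disj)
  define C where "C = 1 + 4 * C4 * (1 + 4 ^ card ?A * real (card ?A))"
  have "(\<lambda>x. proj_below RS g (f x)) \<in> F_space s RS M g p q \<and>
      F_norm s RS M g p q (\<lambda>x. proj_below RS g (f x)) \<le> ennreal C * F_norm s RS M g' p q' f"
    if f: "f \<in> F_space s RS M g' p q'" for f
  proof -
    let ?n = "F_norm s RS M g' p q' f" and ?J = "\<lambda>x. proj_below RS g (f x)"
    have fb: "\<And>x. f x \<in> hspace_below RS g'" and sm: "strongly_measurable RS g' f"
      using f by (auto simp: F_space_def)
    obtain N where N: "N \<in> null_sets lborel" and F: "borel_field g' (\<lambda>x. if x \<in> N then 0 else f x)"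
      using borel_representative[OF sm fb] by blast
    let ?F = "\<lambda>x. if x \<in> N then 0 else f x"
    have notN: "AE x in lborel. x \<notin> N" using N by (rule AE_not_in)
    let ?S = "\<lambda>x. \<Sum>\<beta>\<in>?A. ennreal (comp_norm RS \<beta> (?F x))"
    have m: "(\<lambda>x. ennreal (comp_norm RS \<beta> (?F x))) \<in> borel_measurable lborel" if "\<beta> \<in> ?A" for \<beta>
      using measurable_comp_norm[OF F that] by simp
    have mS: "?S \<in> borel_measurable lborel" using m by (intro borel_measurable_sum) auto
    have LS: "Lp_norm lborel (ennreal p) ?S \<le> ennreal (4 ^ card ?A * real (card ?A)) * ?n"
    proof -
      have "Lp_norm lborel (ennreal p) ?S \<le> 4 ^ card ?A * (\<Sum>\<beta>\<in>?A. Lp_norm lborel (ennreal p) (\<lambda>x. ennreal (comp_norm RS \<beta> (?F x))))"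
        using m p finite_hom_below by (intro Lp_norm_sum_le) auto
      also have "\<dots> \<le> 4 ^ card ?A * (\<Sum>\<beta>\<in>?A. ?n)"
      proof (intro mult_left_mono sum_mono)
        fix \<beta> assume \<beta>: "\<beta> \<in> ?A"
        have "Lp_norm lborel (ennreal p) (\<lambda>x. ennreal (comp_norm RS \<beta> (?F x))) \<le> Lp_norm lborel (ennreal p) (\<lambda>x. ennreal (comp_norm RS \<beta> (f x)))"
          using notN p by (intro Lp_norm_mono_AE) (auto elim: eventually_mono)
        also have "\<dots> \<le> ?n" using Lp_comp_norm_le_F_norm[OF \<beta>, of p f q'] p by (simp add: Lp_norm_lebesgue)
        finally show "Lp_norm lborel (ennreal p) (\<lambda>x. ennreal (comp_norm RS \<beta> (?F x))) \<le> ?n" .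
      qed auto
      also have "\<dots> = ennreal (4 ^ card ?A * real (card ?A)) * ?n"
        by (simp add: ennreal_mult' ennreal_power[symmetric] ennreal_of_nat_eq_real_of_nat mult.assoc)
      finally show ?thesis .
    qed
    have comp: "Lp_norm lebesgue (ennreal p) (\<lambda>x. ennreal (comp_norm RS \<zeta> (?J x))) \<le> ?n" if \<zeta>: "\<zeta> \<in> hom_below RS g" for \<zeta>
      using Lp_comp_norm_le_F_norm[OF subsetD[OF sub \<zeta>], of p f q'] \<zeta> by (simp add: comp_norm_proj_below)
    have dens: "Lp_norm lebesgue (ennreal p) (\<lambda>x. Lp_norm log_measure q (F_density g ?J \<zeta> x))
        \<le> ennreal (4 * C4 * (1 + 4 ^ card ?A * real (card ?A))) * ?n" if \<zeta>: "\<zeta> \<in> hom_below RS g" for \<zeta>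
    proof -
      let ?L = "\<lambda>x. Lp_norm log_measure q' (F_density g' f \<zeta> x)"
      have pt: "Lp_norm log_measure q (F_density g ?J \<zeta> x) \<le> ennreal C4 * (?L x + ?S x)" if x: "x \<notin> N" for x
      proof -
        let ?A' = "ennreal C1 * ?S x"
        have m2: "(\<lambda>l. ennreal (l powr e) * ?A') \<in> borel_measurable log_measure" by measurable
        have "Lp_norm log_measure q (F_density g ?J \<zeta> x)
            \<le> Lp_norm log_measure (ennreal t) (\<lambda>l. ennreal (l powr e) * F_density g' f \<zeta> x l + ennreal (l powr e) * ?A')"
          unfolding t(1)
        proof (intro Lp_norm_mono_AE AE_I2)
          fix l assume l: "l \<in> space log_measure"
          then have "F_density g (\<lambda>x. proj_below RS g (f x)) \<zeta> x l
              \<le> ennreal (l powr (g1 - g)) * F_density g' f \<zeta> x l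
                + ennreal (l powr (g1 - g)) * (ennreal C1 * (\<Sum>\<beta>\<in>?A. ennreal (comp_norm RS \<beta> (f x))))"
            by (intro C1(2)[OF fb _ _ \<zeta>]) auto
          then show "F_density g ?J \<zeta> x l \<le> ennreal (l powr e) * F_density g' f \<zeta> x l + ennreal (l powr e) * ?A'"
            using x by (simp add: e_def)
        qed (use t in auto)
        also have "\<dots> \<le> 4 * (Lp_norm log_measure (ennreal t) (\<lambda>l. ennreal (l powr e) * F_density g' f \<zeta> x l)
              + Lp_norm log_measure (ennreal t) (\<lambda>l. ennreal (l powr e) * ?A'))"
          using m2 t by (intro Lp_norm_add_le) auto
        also have "\<dots> \<le> 4 * (ennreal C3 * ?L x + ennreal C2 * ?A')"
        proof (intro mult_left_mono add_mono)
          have "(\<integral>\<^sup>+l. ennreal ((l powr e) powr t) \<partial>log_measure) \<le> ennreal (1 / (e * t))"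
            using nn_integral_log_measure_powr[of "e * t"] e t by (simp add: powr_powr)
          then show "Lp_norm log_measure (ennreal t) (\<lambda>l. ennreal (l powr e) * F_density g' f \<zeta> x l) \<le> ennreal C3 * ?L x"
            unfolding C3_def using e t q by (intro Lp_norm_weighted_le) (auto intro!: powr_le1)
          show "Lp_norm log_measure (ennreal t) (\<lambda>l. ennreal (l powr e) * ?A') \<le> ennreal C2 * ?A'"
            unfolding t(1)[symmetric] by (intro C2(2) m2) auto
        qed auto
        also have "\<dots> \<le> ennreal C4 * (?L x + ?S x)"
        proof -
          have "ennreal C3 * ?L x \<le> ennreal (max C3 (C2 * C1)) * ?L x" "ennreal (C2 * C1) * ?S x \<le> ennreal (max C3 (C2 * C1)) * ?S x"
            by (intro mult_right_mono ennreal_leI; simp)+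
          moreover have "ennreal C2 * ?A' = ennreal (C2 * C1) * ?S x"
            using C2(1) C1(1) by (simp add: ennreal_mult' mult.assoc)
          ultimately have "4 * (ennreal C3 * ?L x + ennreal C2 * ?A') \<le> 4 * (ennreal (max C3 (C2 * C1)) * ?L x + ennreal (max C3 (C2 * C1)) * ?S x)"
            by (simp only:) (intro mult_left_mono add_mono; simp)
          also have "\<dots> = ennreal C4 * (?L x + ?S x)"
            unfolding C4_def by (simp add: ennreal_mult' distrib_left mult.assoc)
          finally show ?thesis .
        qed
        finally show ?thesis .
      qed
      have "Lp_norm lebesgue (ennreal p) (\<lambda>x. Lp_norm log_measure q (F_density g ?J \<zeta> x))
          \<le> Lp_norm lborel (ennreal p) (\<lambda>x. ennreal C4 * (?L x + ?S x))"
        using p notN by (subst Lp_norm_lebesgue) (auto intro!: Lp_norm_mono_AE elim!: eventually_mono intro: pt)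
      also have "\<dots> = ennreal C4 * Lp_norm lborel (ennreal p) (\<lambda>x. ?L x + ?S x)"
        using C4 p by (intro Lp_norm_cmult) auto
      also have "\<dots> \<le> ennreal C4 * (4 * (Lp_norm lborel (ennreal p) ?L + Lp_norm lborel (ennreal p) ?S))"
        using mS p by (intro mult_left_mono Lp_norm_add_le) auto
      also have "\<dots> \<le> ennreal C4 * (4 * (?n + ennreal (4 ^ card ?A * real (card ?A)) * ?n))"
        using Lp_density_le_F_norm[OF subsetD[OF sub \<zeta>], of p q' f] p
        by (intro mult_left_mono add_mono LS) (simp_all add: Lp_norm_lebesgue)
      also have "\<dots> = ennreal (4 * C4 * (1 + 4 ^ card ?A * real (card ?A))) * ?n"
        using C4 by (simp add: ennreal_mult' distrib_right distrib_left mult_ac)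
      finally show ?thesis .
    qed
    have "F_norm s RS M g p q ?J \<le> ?n + ennreal (4 * C4 * (1 + 4 ^ card ?A * real (card ?A))) * ?n"
      unfolding F_norm_eq[of g] by (intro add_mono SUP_least comp dens)
    also have "\<dots> = ennreal C * ?n"
      unfolding C_def using C4 by (subst ennreal_plus) (auto simp: distrib_right)
    finally have le: "F_norm s RS M g p q ?J \<le> ennreal C * ?n" .
    then show ?thesis using F_space_memI[OF gg f] by blast
  qed
  then show ?thesis unfolding continuous_embedding_def by blast
qed

section \<open>Sobolev embeddings\<close>

text \<open>
  Integrating the pointwise estimate over the box of radius \<open>4 * l\<close> leaves \<open>H x\<close> and
  the mean of \<open>H\<close> over that box. The function \<open>K\<close> dominates these means for all
  \<open>l\<close> up to \<open>l powr (- e)\<close>, half of the available gain \<open>g1 - g = 2 *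
  e\<close>.
\<close>

lemma density_le_of_hajlasz:
  assumes H: "H \<in> borel_measurable borel" and p: "1 < p" and e: "0 < e" "g1 - g = 2 * e"
    and maj: "\<And>m. ennreal (2 ^ (m * scaling_size s)) *
         (\<integral>\<^sup>+y. enn_powr (H y) p * indicator (scaled_ball s x (4 / 2 ^ m)) y \<partial>lborel)
       \<le> enn_powr (ennreal (2 powr (real m * e)) * K x) p"
    and N: "N \<in> null_sets lborel" and \<zeta>: "\<zeta> \<in> hom_set RS" "\<zeta> < g1"
    and haj: "\<And>h l. x + h \<notin> N \<Longrightarrow> 0 < l \<Longrightarrow> l \<le> 4 \<Longrightarrow> scaled_norm s h \<le> l \<Longrightarrow>
      ennreal (increment RS M \<zeta> u x h) \<le> ennreal (l powr (g1 - \<zeta>)) * (H x + H (x + h))"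
    and l: "0 < l" "l \<le> 1"
  shows "F_density g u \<zeta> x l
    \<le> ennreal (l powr e) * (ennreal (4 powr (g1 - \<zeta>) * (2 ^ CARD('d) * 4 ^ scaling_size s + 1)) * (H x + K x))"
proof -
  let ?N = "scaling_size s" and ?Q = "\<lambda>x. scaled_ball s (x::real^'d) (4 * l)"
  define V where "V = 2 ^ CARD('d) * (4 * l) ^ ?N"
  define V1 where "V1 = 2 ^ CARD('d) * 4 ^ ?N + (1::real)"
  have V: "0 < V" using l by (simp add: V_def)
  have V1: "1 \<le> V1" by (simp add: V1_def)
  note [measurable] = H
  have bm[measurable]: "scaled_ball s y r \<in> sets borel" for y :: "real^'d" and r using scaling by simp
  obtain m where m: "1 / 2 ^ Suc m < l" "l \<le> 1 / 2 ^ m" by (rule dyadic_bracket[OF l])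
  let ?R = "\<integral>\<^sup>+y. H y * indicator (?Q x) y \<partial>lborel"
  have R: "?R \<le> ennreal (V * V1 * l powr (- e)) * K x"
  proof -
    have "ennreal (2 ^ (m * ?N)) * (\<integral>\<^sup>+y. H y * indicator (scaled_ball s x (4 / 2 ^ m)) y \<partial>lborel)
        \<le> ennreal V1 * (ennreal (2 powr (real m * e)) * K x)"
      unfolding V1_def by (rule local_mean_le[OF scaling H p _ maj]) simp
    moreover have "?R \<le> (\<integral>\<^sup>+y. H y * indicator (scaled_ball s x (4 / 2 ^ m)) y \<partial>lborel)"
      using m(2) by (intro nn_integral_mono) (auto simp: indicator_def mem_scaled_ball)
    ultimately have "ennreal (2 ^ (m * ?N)) * ?R \<le> ennreal V1 * (ennreal (2 powr (real m * e)) * K x)"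
      by (meson mult_left_mono order_trans zero_le)
    then have "ennreal (1 / 2 ^ (m * ?N)) * (ennreal (2 ^ (m * ?N)) * ?R) \<le> ennreal (1 / 2 ^ (m * ?N)) * (ennreal V1 * (ennreal (2 powr (real m * e)) * K x))"
      by (intro mult_left_mono) auto
    then have "?R \<le> ennreal (1 / 2 ^ (m * ?N) * V1 * 2 powr (real m * e)) * K x"
      using V1 by (simp add: mult.assoc[symmetric] ennreal_mult'[symmetric])
    also have "\<dots> \<le> ennreal (V * V1 * l powr (- e)) * K x"
    proof (intro mult_right_mono ennreal_leI mult_mono)
      have "1 / (2::real) ^ (m * ?N) = (1 / 2 ^ m) ^ ?N" by (simp add: power_mult power_one_over)
      also have "\<dots> \<le> (4 * l) ^ ?N" using m(1) l by (intro power_mono) auto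
      also have "\<dots> = 1 * (4 * l) ^ ?N" by simp
      also have "\<dots> \<le> V" unfolding V_def using l by (intro mult_right_mono) (auto simp: one_le_power)
      finally show "1 / 2 ^ (m * ?N) \<le> V" .
      have "2 powr (real m * e) = (1 / 2 ^ m) powr (- e)"
        by (simp add: half_power_powr_eq_powr)
      also have "\<dots> \<le> l powr (- e)" using m(2) l e by (intro powr_mono2') auto
      finally show "2 powr (real m * e) \<le> l powr (- e)" .
    qed (use V V1 in auto)
    finally show ?thesis .
  qed
  have tr: "(\<integral>\<^sup>+h. H (x + h) * indicator (?Q 0) h \<partial>lborel) = ?R"
  proof -
    have "(\<integral>\<^sup>+h. H (x + h) * indicator (?Q 0) h \<partial>lborel) = (\<integral>\<^sup>+h. H (x + h) * indicator (?Q x) (x + h) \<partial>lborel)"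
      by (intro nn_integral_cong) (simp add: indicator_def mem_scaled_ball)
    also have "\<dots> = ?R" by (rule nn_integral_translate) auto
    finally show ?thesis .
  qed
  let ?c = "(4 * l) powr (g1 - \<zeta>)"
  have "(\<integral>\<^sup>+h. ennreal (increment RS M \<zeta> u x h) * indicator (?Q 0) h \<partial>lborel)
      \<le> (\<integral>\<^sup>+h. ennreal ?c * (H x * indicator (?Q 0) h + H (x + h) * indicator (?Q 0) h) \<partial>lborel)"
  proof (intro nn_integral_mono_AE)
    show "AE h in lborel. ennreal (increment RS M \<zeta> u x h) * indicator (?Q 0) h
        \<le> ennreal ?c * (H x * indicator (?Q 0) h + H (x + h) * indicator (?Q 0) h)"
      using AE_translate_not_in[OF N, of x]
    proof eventually_elim
      case (elim h)
      show ?case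
      proof (cases "h \<in> ?Q 0")
        case True
        then have "scaled_norm s h \<le> 4 * l" by (simp add: mem_scaled_ball)
        then show ?thesis using haj[OF elim, of "4 * l"] l True by simp
      qed simp
    qed
  qed
  also have "\<dots> = ennreal ?c * (H x * ennreal V + ?R)"
  proof -
    have "(\<integral>\<^sup>+h. H x * indicator (?Q 0) h + H (x + h) * indicator (?Q 0) h \<partial>lborel) = H x * ennreal V + ?R"
      using l by (subst nn_integral_add) (auto simp: nn_integral_cmult_indicator emeasure_scaled_ball[OF scaling] V_def tr)
    then show ?thesis by (subst nn_integral_cmult) auto
  qed
  also have "\<dots> \<le> ennreal ?c * (ennreal (V * V1 * l powr (- e)) * H x + ennreal (V * V1 * l powr (- e)) * K x)"
  proof (intro mult_left_mono add_mono R)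
    have "1 \<le> l powr (- e)"
      using powr_mono2'[of "- e" l 1] l e by simp
    then have "V * 1 * 1 \<le> V * V1 * l powr (- e)"
      using V V1 by (intro mult_mono) auto
    then have "ennreal V * H x \<le> ennreal (V * V1 * l powr (- e)) * H x"
      by (intro mult_right_mono ennreal_leI) auto
    then show "H x * ennreal V \<le> ennreal (V * V1 * l powr (- e)) * H x"
      by (simp add: mult.commute)
  qed auto
  also have "\<dots> = ennreal (?c * (V * V1 * l powr (- e))) * (H x + K x)"
    by (simp add: ennreal_mult' distrib_left mult.assoc)
  finally have I: "(\<integral>\<^sup>+h. ennreal (increment RS M \<zeta> u x h) * indicator (?Q 0) h \<partial>lborel)
      \<le> ennreal (?c * (V * V1 * l powr (- e))) * (H x + K x)" .
  have "F_density g u \<zeta> x l \<le> ennreal (1 / (V * l powr (g - \<zeta>))) * (ennreal (?c * (V * V1 * l powr (- e))) * (H x + K x))"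
    unfolding F_density_eq[OF l(1) \<zeta>(1)] V_def[symmetric] by (intro mult_left_mono I) auto
  also have "\<dots> = ennreal (1 / (V * l powr (g - \<zeta>)) * (?c * (V * V1 * l powr (- e)))) * (H x + K x)"
    using V by (simp add: ennreal_mult'[symmetric] mult.assoc[symmetric])
  also have "1 / (V * l powr (g - \<zeta>)) * (?c * (V * V1 * l powr (- e))) = l powr e * (4 powr (g1 - \<zeta>) * V1)"
  proof -
    have c: "?c = 4 powr (g1 - \<zeta>) * l powr (g1 - \<zeta>)" using l by (subst powr_mult) auto
    have "l powr (g1 - \<zeta>) * l powr (- e) = l powr (g - \<zeta>) * l powr e"
      using e(2) by (simp add: powr_add[symmetric] algebra_simps)
    moreover have "1 / (V * l powr (g - \<zeta>)) * (?c * (V * V1 * l powr (- e))) = 1 / (V * l powr (g - \<zeta>)) * (4 powr (g1 - \<zeta>) * V * V1 * (l powr (g1 - \<zeta>) * l powr (- e)))"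
      unfolding c by (simp only: mult_ac)
    ultimately have "1 / (V * l powr (g - \<zeta>)) * (?c * (V * V1 * l powr (- e))) = 1 / (V * l powr (g - \<zeta>)) * (4 powr (g1 - \<zeta>) * V * V1 * (l powr (g - \<zeta>) * l powr e))"
      by (simp only:)
    also have "\<dots> = l powr e * (4 powr (g1 - \<zeta>) * V1)" using V l by simp
    finally show ?thesis .
  qed
  finally show ?thesis
    unfolding V1_def by (simp add: ennreal_mult' mult.assoc)
qed

text \<open>
  \<open>F_space_hajlasz\<close> at an order \<open>g1\<close> slightly above \<open>g\<close> with the same
  truncation.
\<close>

lemma sobolev_majorant:
  assumes g: "0 < g" "g < g' - real (scaling_size s) * (1 / p' - 1 / p)" and ng: "g \<notin> hom_set RS"
    and p: "1 \<le> p'" "p' < p" and q: "1 \<le> q"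
  obtains g1 C where "g < g1" "0 < C" "\<And>f. f \<in> F_space s RS M g' p' q \<Longrightarrow>
    \<exists>H N. H \<in> borel_measurable borel \<and> N \<in> null_sets lborel \<and>
      Lp_norm lborel (ennreal p) H \<le> ennreal C * F_norm s RS M g' p' q f \<and>
      (\<forall>\<zeta>\<in>hom_below RS g.
        Lp_norm lebesgue (ennreal p) (\<lambda>x. ennreal (comp_norm RS \<zeta> (proj_below RS g (f x))))
          \<le> ennreal C * F_norm s RS M g' p' q f \<and>
        (\<forall>x h l. x \<notin> N \<longrightarrow> x + h \<notin> N \<longrightarrow> 0 < l \<longrightarrow> l \<le> 4 \<longrightarrow> scaled_norm s h \<le> l \<longrightarrow>
          ennreal (increment RS M \<zeta> (\<lambda>x. proj_below RS g (f x)) x h)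
            \<le> ennreal (l powr (g1 - \<zeta>)) * (H x + H (x + h))))"
proof -
  have \<sigma>: "0 \<le> real (scaling_size s) * (1 / p' - 1 / p)"
    using p by (intro mult_nonneg_nonneg) (auto simp: field_simps)
  obtain g1 where gap: "g < g1" "g1 < g' - real (scaling_size s) * (1 / p' - 1 / p)" "g1 \<notin> hom_set RS"
    "hom_below RS g1 = hom_below RS g" "proj_below RS g1 = proj_below RS g"
    by (rule homogeneity_gap[OF ng g(2)]) blast
  have g1: "0 < g1" "g1 < g'" using gap g \<sigma> by linarith+
  have pp: "p' \<le> p" and sob: "real (scaling_size s) * (1 / p' - 1 / p) < g' - g1" using gap p by simp_all
  obtain C where C: "0 < C" "\<And>f. f \<in> F_space s RS M g' p' q \<Longrightarrow>
    \<exists>H\<in>borel_measurable borel. \<exists>N\<in>null_sets lborel.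
      Lp_norm lborel (ennreal p) H \<le> ennreal C * F_norm s RS M g' p' q f \<and> hajlasz_majorant g1 f H N"
    by (rule F_space_hajlasz[OF g1 gap(3) p(1) pp q sob]) blast
  show ?thesis
  proof (rule that[OF gap(1) C(1)])
    fix f assume "f \<in> F_space s RS M g' p' q"
    from C(2)[OF this] obtain H N where H: "H \<in> borel_measurable borel" and N: "N \<in> null_sets lborel"
      and LH: "Lp_norm lborel (ennreal p) H \<le> ennreal C * F_norm s RS M g' p' q f"
      and maj: "hajlasz_majorant g1 f H N" by blast
    have "Lp_norm lebesgue (ennreal p) (\<lambda>x. ennreal (comp_norm RS \<zeta> (proj_below RS g (f x))))
        \<le> ennreal C * F_norm s RS M g' p' q f" if \<zeta>: "\<zeta> \<in> hom_below RS g" for \<zeta>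
    proof -
      have "AE x in lborel. ennreal (comp_norm RS \<zeta> (proj_below RS g (f x))) \<le> H x"
        using AE_not_in[OF N]
        by eventually_elim (use maj \<zeta> in \<open>simp add: hajlasz_majorant_def gap(4) comp_norm_proj_below\<close>)
      then have "Lp_norm lebesgue (ennreal p) (\<lambda>x. ennreal (comp_norm RS \<zeta> (proj_below RS g (f x)))) \<le> Lp_norm lborel (ennreal p) H"
        using p by (subst Lp_norm_lebesgue) (auto intro!: Lp_norm_mono_AE)
      then show ?thesis using LH by (rule order_trans)
    qed
    then show "\<exists>H N. H \<in> borel_measurable borel \<and> N \<in> null_sets lborel \<and>
      Lp_norm lborel (ennreal p) H \<le> ennreal C * F_norm s RS M g' p' q f \<and>
      (\<forall>\<zeta>\<in>hom_below RS g.
        Lp_norm lebesgue (ennreal p) (\<lambda>x. ennreal (comp_norm RS \<zeta> (proj_below RS g (f x))))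
          \<le> ennreal C * F_norm s RS M g' p' q f \<and>
        (\<forall>x h l. x \<notin> N \<longrightarrow> x + h \<notin> N \<longrightarrow> 0 < l \<longrightarrow> l \<le> 4 \<longrightarrow> scaled_norm s h \<le> l \<longrightarrow>
          ennreal (increment RS M \<zeta> (\<lambda>x. proj_below RS g (f x)) x h)
            \<le> ennreal (l powr (g1 - \<zeta>)) * (H x + H (x + h))))"
      using H N LH maj unfolding hajlasz_majorant_def gap(4,5)
      by (intro exI[of _ H] exI[of _ N]) blast
  qed
qed

text \<open>
  The second application of \<open>dyadic_average_majorant\<close>, with equal exponents, takes the place of
  the maximal function of \<open>H\<close>.
\<close>

lemma embedding_sobolev_F:
  assumes g: "0 < g" "g < g' - real (scaling_size s) * (1 / p' - 1 / p)" and ng: "g \<notin> hom_set RS"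
    and p: "1 \<le> p'" "p' < p" and q: "1 \<le> q" and r: "1 \<le> r"
  shows "continuous_embedding (\<lambda>f x. proj_below RS g (f x))
     (F_space s RS M g' p' q) (F_norm s RS M g' p' q) (F_space s RS M g p r) (F_norm s RS M g p r)"
proof -
  let ?A = "hom_below RS g"
  have "0 \<le> real (scaling_size s) * (1 / p' - 1 / p)"
    using p by (intro mult_nonneg_nonneg) (auto simp: field_simps)
  then have gg: "g \<le> g'" using g by linarith
  obtain g1 C1 where gap: "g < g1" and C1: "0 < C1" "\<And>f. f \<in> F_space s RS M g' p' q \<Longrightarrow>
    \<exists>H N. H \<in> borel_measurable borel \<and> N \<in> null_sets lborel \<and>
      Lp_norm lborel (ennreal p) H \<le> ennreal C1 * F_norm s RS M g' p' q f \<and>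
      (\<forall>\<zeta>\<in>?A.
        Lp_norm lebesgue (ennreal p) (\<lambda>x. ennreal (comp_norm RS \<zeta> (proj_below RS g (f x))))
          \<le> ennreal C1 * F_norm s RS M g' p' q f \<and>
        (\<forall>x h l. x \<notin> N \<longrightarrow> x + h \<notin> N \<longrightarrow> 0 < l \<longrightarrow> l \<le> 4 \<longrightarrow> scaled_norm s h \<le> l \<longrightarrow>
          ennreal (increment RS M \<zeta> (\<lambda>x. proj_below RS g (f x)) x h)
            \<le> ennreal (l powr (g1 - \<zeta>)) * (H x + H (x + h))))"
    by (rule sobolev_majorant[OF g ng p q]) blast
  have p1: "1 \<le> p" "1 < p" using p by auto
  define e where "e = (g1 - g) / 2"
  have e: "0 < e" "g1 - g = 2 * e" using gap by (auto simp: e_def)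
  have "real (scaling_size s) * (1 / p - 1 / p) < e" using e by simp
  from dyadic_average_majorant[OF scaling p1(1) order_refl _ this, of 4]
  obtain C2 where C2: "0 < C2" "\<forall>D\<in>borel_measurable borel. \<exists>H\<in>borel_measurable borel.
     (\<forall>(x::real^'d) m. ennreal (2 ^ (m * scaling_size s)) *
         (\<integral>\<^sup>+y. enn_powr (D y) p * indicator (scaled_ball s x (4 / 2 ^ m)) y \<partial>lborel)
       \<le> enn_powr (ennreal (2 powr (real m * e)) * H x) p) \<and>
     Lp_norm lborel (ennreal p) H \<le> ennreal C2 * Lp_norm lborel (ennreal p) D"
    by auto
  obtain C3 where C3: "0 < C3" "\<And>J A. J \<in> borel_measurable log_measure \<Longrightarrow>
    (\<And>l. l \<in> {0<..1} \<Longrightarrow> J l \<le> ennreal (l powr e) * A) \<Longrightarrow> Lp_norm log_measure r J \<le> ennreal C3 * A"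
    by (rule Lp_norm_log_measure_powr[OF e(1) r]) blast
  define \<kappa> where "\<kappa> = (\<Sum>\<zeta>\<in>?A. 4 powr (g1 - \<zeta>)) * (2 ^ CARD('d) * 4 ^ scaling_size s + 1) + 1"
  have \<kappa>: "0 < \<kappa>" unfolding \<kappa>_def by (intro add_nonneg_pos mult_nonneg_nonneg sum_nonneg) auto
  have \<kappa>': "4 powr (g1 - \<zeta>) * (2 ^ CARD('d) * 4 ^ scaling_size s + 1) \<le> \<kappa>" if "\<zeta> \<in> ?A" for \<zeta>
  proof -
    have "4 powr (g1 - \<zeta>) \<le> (\<Sum>\<zeta>\<in>?A. 4 powr (g1 - \<zeta>))"
      using that finite_hom_below by (intro member_le_sum[of \<zeta> _ "\<lambda>\<zeta>. 4 powr (g1 - \<zeta>)"]) auto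
    then have "4 powr (g1 - \<zeta>) * (2 ^ CARD('d) * 4 ^ scaling_size s + 1) \<le> (\<Sum>\<zeta>\<in>?A. 4 powr (g1 - \<zeta>)) * (2 ^ CARD('d) * 4 ^ scaling_size s + 1)"
      by (intro mult_right_mono) auto
    then show ?thesis by (simp add: \<kappa>_def)
  qed
  define C4 where "C4 = C3 * \<kappa>"
  have C4: "0 < C4" using C3 \<kappa> by (simp add: C4_def)
  define C where "C = C1 + 4 * C4 * (1 + C2) * C1"
  have "(\<lambda>x. proj_below RS g (f x)) \<in> F_space s RS M g p r \<and>
      F_norm s RS M g p r (\<lambda>x. proj_below RS g (f x)) \<le> ennreal C * F_norm s RS M g' p' q f"
    if f: "f \<in> F_space s RS M g' p' q" for f
  proof -
    let ?n = "F_norm s RS M g' p' q f" and ?J = "\<lambda>x. proj_below RS g (f x)"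
    have sm: "strongly_measurable RS g' f" using f by (simp add: F_space_def)
    obtain H N where H: "H \<in> borel_measurable borel" and N: "N \<in> null_sets lborel"
      and LH: "Lp_norm lborel (ennreal p) H \<le> ennreal C1 * ?n"
      and comp: "\<And>\<zeta>. \<zeta> \<in> ?A \<Longrightarrow> Lp_norm lebesgue (ennreal p) (\<lambda>x. ennreal (comp_norm RS \<zeta> (?J x))) \<le> ennreal C1 * ?n"
      and iH: "\<And>\<zeta> x h l. \<zeta> \<in> ?A \<Longrightarrow> x \<notin> N \<Longrightarrow> x + h \<notin> N \<Longrightarrow> 0 < l \<Longrightarrow> l \<le> 4 \<Longrightarrow> scaled_norm s h \<le> l \<Longrightarrow>
          ennreal (increment RS M \<zeta> ?J x h) \<le> ennreal (l powr (g1 - \<zeta>)) * (H x + H (x + h))"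
      using C1(2)[OF f] by blast
    obtain K where K: "K \<in> borel_measurable borel" and maj: "\<And>x m. ennreal (2 ^ (m * scaling_size s)) *
         (\<integral>\<^sup>+y. enn_powr (H y) p * indicator (scaled_ball s x (4 / 2 ^ m)) y \<partial>lborel)
       \<le> enn_powr (ennreal (2 powr (real m * e)) * K x) p"
      and LK: "Lp_norm lborel (ennreal p) K \<le> ennreal C2 * Lp_norm lborel (ennreal p) H"
      using bspec[OF C2(2) H] by blast
    obtain N2 where N2: "N2 \<in> null_sets lborel"
      "\<And>x \<zeta> g'. x \<notin> N2 \<Longrightarrow> \<zeta> \<in> ?A \<Longrightarrow> F_density g' ?J \<zeta> x \<in> borel_measurable log_measure"
      by (rule measurable_F_density[OF strongly_measurable_proj_below[OF gg sm] proj_below_mem g(1)]) blast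
    have notN: "AE x in lborel. x \<notin> N" and notN2: "AE x in lborel. x \<notin> N2"
      using N N2(1) by (auto intro: AE_not_in)
    have dens: "Lp_norm lebesgue (ennreal p) (\<lambda>x. Lp_norm log_measure r (F_density g ?J \<zeta> x))
        \<le> ennreal (4 * C4 * (1 + C2) * C1) * ?n" if \<zeta>: "\<zeta> \<in> ?A" for \<zeta>
    proof -
      have pt: "Lp_norm log_measure r (F_density g ?J \<zeta> x) \<le> ennreal C4 * (H x + K x)" if x: "x \<notin> N" "x \<notin> N2" for x
      proof -
        have "Lp_norm log_measure r (F_density g ?J \<zeta> x) \<le> ennreal C3 * (ennreal \<kappa> * (H x + K x))"
        proof (rule C3(2)[OF N2(2)[OF x(2) \<zeta>]])
          fix l :: real assume l: "l \<in> {0<..1}"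
          have "F_density g ?J \<zeta> x l
            \<le> ennreal (l powr e) * (ennreal (4 powr (g1 - \<zeta>) * (2 ^ CARD('d) * 4 ^ scaling_size s + 1)) * (H x + K x))"
            using l hom_belowD[OF \<zeta>] gap x
            by (intro density_le_of_hajlasz[OF H p1(2) e maj N]) (auto intro: iH[OF \<zeta>])
          also have "\<dots> \<le> ennreal (l powr e) * (ennreal \<kappa> * (H x + K x))"
            by (intro mult_left_mono mult_right_mono ennreal_leI \<kappa>' \<zeta>) auto
          finally show "F_density g ?J \<zeta> x l \<le> ennreal (l powr e) * (ennreal \<kappa> * (H x + K x))" .
        qed
        then show ?thesis using C3(1) by (simp add: C4_def ennreal_mult' mult.assoc)
      qed
      have "AE x in lborel. Lp_norm log_measure r (F_density g ?J \<zeta> x) \<le> ennreal C4 * (H x + K x)"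
        using notN notN2 by eventually_elim (rule pt)
      then have "Lp_norm lebesgue (ennreal p) (\<lambda>x. Lp_norm log_measure r (F_density g ?J \<zeta> x))
          \<le> Lp_norm lborel (ennreal p) (\<lambda>x. ennreal C4 * (H x + K x))"
        using p1 by (subst Lp_norm_lebesgue) (auto intro!: Lp_norm_mono_AE)
      also have "\<dots> = ennreal C4 * Lp_norm lborel (ennreal p) (\<lambda>x. H x + K x)"
        using C4 p1 by (intro Lp_norm_cmult) auto
      also have "\<dots> \<le> ennreal C4 * (4 * (Lp_norm lborel (ennreal p) H + Lp_norm lborel (ennreal p) K))"
        using K p1 by (intro mult_left_mono Lp_norm_add_le) auto
      also have "\<dots> \<le> ennreal C4 * (4 * (ennreal C1 * ?n + ennreal C2 * (ennreal C1 * ?n)))"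
        by (intro mult_left_mono add_mono LH order_trans[OF LK]) auto
      also have "\<dots> = ennreal (4 * C4 * (1 + C2) * C1) * ?n"
        using C4 C1(1) C2(1) by (simp add: ennreal_mult' distrib_right distrib_left mult_ac)
      finally show ?thesis .
    qed
    have "F_norm s RS M g p r ?J \<le> ennreal C1 * ?n + ennreal (4 * C4 * (1 + C2) * C1) * ?n"
      unfolding F_norm_eq[of g] by (intro add_mono SUP_least comp dens)
    also have "\<dots> = ennreal C * ?n"
      unfolding C_def using C4 C1(1) C2(1) by (subst ennreal_plus) (auto simp: distrib_right)
    finally have le: "F_norm s RS M g p r ?J \<le> ennreal C * ?n" .
    then show ?thesis using F_space_memI[OF gg f] by blast
  qed
  then show ?thesis unfolding continuous_embedding_def by blast
qed

text \<open>
  The pointwise estimate bounds the \<open>L\<^sup>p\<close> norm of the increment in direction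
  \<open>h\<close> by \<open>scaled_norm s h powr (g1 - \<zeta>)\<close> times that of \<open>H\<close>, which
  exceeds the order required by the Besov norm by \<open>e = g1 - g\<close>; this power makes the integral
  over \<open>h\<close> finite.
\<close>

lemma embedding_sobolev_B:
  assumes g: "0 < g" "g < g' - real (scaling_size s) * (1 / p' - 1 / p)" and ng: "g \<notin> hom_set RS"
    and p: "1 \<le> p'" "p' < p" and q: "1 \<le> q"
  shows "continuous_embedding (\<lambda>f x. proj_below RS g (f x))
     (F_space s RS M g' p' q) (F_norm s RS M g' p' q)
     (B_space s RS M g (ennreal p) (ennreal p')) (B_norm s RS M g (ennreal p) (ennreal p'))"
proof -
  let ?A = "hom_below RS g"
  have "0 \<le> real (scaling_size s) * (1 / p' - 1 / p)"
    using p by (intro mult_nonneg_nonneg) (auto simp: field_simps)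
  then have gg: "g \<le> g'" using g by linarith
  obtain g1 C1 where gap: "g < g1" and C1: "0 < C1" "\<And>f. f \<in> F_space s RS M g' p' q \<Longrightarrow>
    \<exists>H N. H \<in> borel_measurable borel \<and> N \<in> null_sets lborel \<and>
      Lp_norm lborel (ennreal p) H \<le> ennreal C1 * F_norm s RS M g' p' q f \<and>
      (\<forall>\<zeta>\<in>?A.
        Lp_norm lebesgue (ennreal p) (\<lambda>x. ennreal (comp_norm RS \<zeta> (proj_below RS g (f x))))
          \<le> ennreal C1 * F_norm s RS M g' p' q f \<and>
        (\<forall>x h l. x \<notin> N \<longrightarrow> x + h \<notin> N \<longrightarrow> 0 < l \<longrightarrow> l \<le> 4 \<longrightarrow> scaled_norm s h \<le> l \<longrightarrow>
          ennreal (increment RS M \<zeta> (\<lambda>x. proj_below RS g (f x)) x h)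
            \<le> ennreal (l powr (g1 - \<zeta>)) * (H x + H (x + h))))"
    by (rule sobolev_majorant[OF g ng p q]) blast
  have p1: "1 \<le> p" using p by auto
  define e where "e = g1 - g"
  have e: "0 < e" using gap by (auto simp: e_def)
  obtain C2 where C2: "0 \<le> C2" "(\<integral>\<^sup>+h. ennreal (scaled_norm s h powr (e * p')) \<partial>scaled_measure s) \<le> ennreal C2"
    using nn_integral_scaled_measure_powr[OF scaling, of "e * p'"] e p by auto
  define C where "C = C1 + C2 powr (1 / p') * 8 * C1"
  have "(\<lambda>x. proj_below RS g (f x)) \<in> B_space s RS M g (ennreal p) (ennreal p') \<and>
      B_norm s RS M g (ennreal p) (ennreal p') (\<lambda>x. proj_below RS g (f x)) \<le> ennreal C * F_norm s RS M g' p' q f"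
    if f: "f \<in> F_space s RS M g' p' q" for f
  proof -
    let ?n = "F_norm s RS M g' p' q f" and ?J = "\<lambda>x. proj_below RS g (f x)"
    have sm: "strongly_measurable RS g' f" and fin: "?n < \<infinity>" using f by (auto simp: F_space_def)
    obtain H N where H[measurable]: "H \<in> borel_measurable borel" and N: "N \<in> null_sets lborel"
      and LH: "Lp_norm lborel (ennreal p) H \<le> ennreal C1 * ?n"
      and comp: "\<And>\<zeta>. \<zeta> \<in> ?A \<Longrightarrow> Lp_norm lebesgue (ennreal p) (\<lambda>x. ennreal (comp_norm RS \<zeta> (?J x))) \<le> ennreal C1 * ?n"
      and iH: "\<And>\<zeta> x h l. \<zeta> \<in> ?A \<Longrightarrow> x \<notin> N \<Longrightarrow> x + h \<notin> N \<Longrightarrow> 0 < l \<Longrightarrow> l \<le> 4 \<Longrightarrow> scaled_norm s h \<le> l \<Longrightarrow>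
          ennreal (increment RS M \<zeta> ?J x h) \<le> ennreal (l powr (g1 - \<zeta>)) * (H x + H (x + h))"
      using C1(2)[OF f] by blast
    have notN: "AE x in lborel. x \<notin> N" using N by (rule AE_not_in)
    let ?B = "8 * (ennreal C1 * ?n)"
    have slice: "Lp_norm lebesgue (ennreal p) (\<lambda>x. ennreal (increment RS M \<zeta> ?J x h / scaled_norm s h powr (g - \<zeta>)))
        \<le> ennreal (scaled_norm s h powr e) * ?B" if \<zeta>: "\<zeta> \<in> ?A" and h: "scaled_norm s h \<le> 1" for \<zeta> h
    proof (cases "h = 0")
      case True
      then show ?thesis
        using p1 scaling by (simp add: Lp_norm_real)
    next
      case False
      let ?t = "scaled_norm s h"
      have t: "0 < ?t" using False by (rule scaled_norm_pos[OF scaling])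
      have "AE x in lborel. h + x \<notin> N" by (rule AE_translate_not_in[OF N])
      with notN have "AE x in lborel. ennreal (increment RS M \<zeta> ?J x h / ?t powr (g - \<zeta>)) \<le> ennreal (?t powr e) * (H x + H (h + x))"
      proof eventually_elim
        case (elim x)
        have "ennreal (increment RS M \<zeta> ?J x h / ?t powr (g - \<zeta>)) = ennreal (1 / ?t powr (g - \<zeta>)) * ennreal (increment RS M \<zeta> ?J x h)"
          by (simp add: ennreal_mult'[symmetric])
        also have "\<dots> \<le> ennreal (1 / ?t powr (g - \<zeta>)) * (ennreal (?t powr (g1 - \<zeta>)) * (H x + H (x + h)))"
          using t h elim by (intro mult_left_mono iH[OF \<zeta>]) (auto simp: add.commute)
        also have "\<dots> = ennreal (1 / ?t powr (g - \<zeta>) * ?t powr (g1 - \<zeta>)) * (H x + H (x + h))"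
          by (subst ennreal_mult') (simp_all add: mult.assoc)
        also have "1 / ?t powr (g - \<zeta>) * ?t powr (g1 - \<zeta>) = ?t powr e"
          using t by (simp add: e_def powr_diff)
        finally show ?case by (simp add: add.commute)
      qed
      then have "Lp_norm lebesgue (ennreal p) (\<lambda>x. ennreal (increment RS M \<zeta> ?J x h / ?t powr (g - \<zeta>)))
          \<le> Lp_norm lborel (ennreal p) (\<lambda>x. ennreal (?t powr e) * (H x + H (h + x)))"
        using p1 by (subst Lp_norm_lebesgue) (auto intro!: Lp_norm_mono_AE)
      also have "\<dots> = ennreal (?t powr e) * Lp_norm lborel (ennreal p) (\<lambda>x. H x + H (h + x))"
        using t p1 by (intro Lp_norm_cmult) auto
      also have "\<dots> \<le> ennreal (?t powr e) * (4 * (Lp_norm lborel (ennreal p) H + Lp_norm lborel (ennreal p) (\<lambda>x. H (h + x))))"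
        using p1 by (intro mult_left_mono Lp_norm_add_le) auto
      also have "Lp_norm lborel (ennreal p) (\<lambda>x. H (h + x)) = Lp_norm lborel (ennreal p) H"
        using p1 nn_integral_translate[of "\<lambda>y. enn_powr (H y) p" h] by (simp add: Lp_norm_real)
      also have "ennreal (?t powr e) * (4 * (Lp_norm lborel (ennreal p) H + Lp_norm lborel (ennreal p) H))
          \<le> ennreal (?t powr e) * (4 * (ennreal C1 * ?n + ennreal C1 * ?n))"
        by (intro mult_left_mono add_mono LH) auto
      also have "\<dots> = ennreal (?t powr e) * ?B"
      proof -
        have "4 * (a + a) = 8 * a" for a :: ennreal
          by (simp add: mult_2[symmetric] mult.assoc[symmetric])
        then show ?thesis by simp
      qed
      finally show ?thesis .
    qed
    have sp: "space (scaled_measure s) = scaled_ball s (0::real^'d) 1"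
      by (simp add: scaled_measure_def)
    have incr: "Lp_norm (scaled_measure s) (ennreal p') (\<lambda>h. Lp_norm lebesgue (ennreal p) (\<lambda>x.
       ennreal (increment RS M \<zeta> ?J x h / scaled_norm s h powr (g - \<zeta>)))) \<le> ennreal (C2 powr (1 / p') * 8 * C1) * ?n" if \<zeta>: "\<zeta> \<in> ?A" for \<zeta>
    proof -
      have [measurable]: "(\<lambda>h. scaled_norm s h powr a) \<in> borel_measurable (scaled_measure s)" for a
      proof -
        have [measurable]: "scaled_norm s \<in> borel_measurable borel"
          using scaling by (rule borel_measurable_scaled_norm)
        show ?thesis by (rule measurable_scaled_measure) measurable
      qed
      have "Lp_norm (scaled_measure s) (ennreal p') (\<lambda>h. Lp_norm lebesgue (ennreal p) (\<lambda>x.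
          ennreal (increment RS M \<zeta> ?J x h / scaled_norm s h powr (g - \<zeta>))))
          \<le> Lp_norm (scaled_measure s) (ennreal p') (\<lambda>h. ennreal (scaled_norm s h powr e) * ?B)"
        using p by (intro Lp_norm_mono_AE AE_I2 slice \<zeta>) (auto simp: sp mem_scaled_ball)
      also have "\<dots> = enn_powr (\<integral>\<^sup>+h. ennreal (scaled_norm s h powr (e * p')) * enn_powr ?B p' \<partial>scaled_measure s) (1 / p')"
        using p by (simp add: Lp_norm_real enn_powr_mult powr_powr)
      also have "\<dots> = enn_powr ((\<integral>\<^sup>+h. ennreal (scaled_norm s h powr (e * p')) \<partial>scaled_measure s) * enn_powr ?B p') (1 / p')"
        by (subst nn_integral_multc) auto
      also have "\<dots> \<le> enn_powr (ennreal C2 * enn_powr ?B p') (1 / p')"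
        using p by (intro enn_powr_mono mult_right_mono C2) auto
      also have "\<dots> = ennreal (C2 powr (1 / p')) * ?B"
        using p C2(1) by (subst enn_powr_mult) (auto simp: enn_powr_powr)
      also have "\<dots> = ennreal (C2 powr (1 / p') * 8 * C1) * ?n"
        by (simp add: ennreal_mult' mult.assoc)
      finally show ?thesis .
    qed
    have "B_norm s RS M g (ennreal p) (ennreal p') ?J \<le> ennreal C1 * ?n + ennreal (C2 powr (1 / p') * 8 * C1) * ?n"
      unfolding B_norm_def by (intro add_mono SUP_least comp incr)
    also have "\<dots> = ennreal C * ?n"
      unfolding C_def using C1(1) by (subst ennreal_plus) (auto simp: distrib_right)
    finally have le: "B_norm s RS M g (ennreal p) (ennreal p') ?J \<le> ennreal C * ?n" .
    also have "\<dots> < \<infinity>" using fin by (auto simp: ennreal_mult_less_top)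
    finally show ?thesis
      using le strongly_measurable_proj_below[OF gg sm] proj_below_mem by (auto simp: B_space_def)
  qed
  then show ?thesis unfolding continuous_embedding_def by blast
qed

end

theorem proposition4p1:
  fixes s :: "'d::finite \<Rightarrow> nat"
    and RS :: "'v::real_vector regularity_structure"
    and M :: "('d, 'v) model"
    and \<gamma> \<gamma>' p p' :: real
    and q q' r :: ennreal
  assumes "scaling s"
    and "is_regularity_structure RS"
    and "is_model s RS M"
    and "0 < \<gamma>" and "\<gamma> \<le> \<gamma>'"
    and "\<gamma> \<notin> hom_set RS" and "\<gamma>' \<notin> hom_set RS"
    and "1 \<le> q" and "1 \<le> q'" and "1 \<le> r"
    and "1 \<le> p" and "1 \<le> p'"
  shows "(q < q' \<and> \<gamma> < \<gamma>' \<longrightarrow>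
            continuous_embedding (\<lambda>f x. proj_below RS \<gamma> (f x))
              (F_space s RS M \<gamma>' p q') (F_norm s RS M \<gamma>' p q')
              (F_space s RS M \<gamma> p q) (F_norm s RS M \<gamma> p q))
       \<and> (p' < p \<and> \<gamma> < \<gamma>' - real (scaling_size s) * (1 / p' - 1 / p) \<longrightarrow>
            continuous_embedding (\<lambda>f x. proj_below RS \<gamma> (f x))
              (F_space s RS M \<gamma>' p' q) (F_norm s RS M \<gamma>' p' q)
              (F_space s RS M \<gamma> p r) (F_norm s RS M \<gamma> p r))
       \<and> (p' < p \<and> \<gamma> < \<gamma>' - real (scaling_size s) * (1 / p' - 1 / p) \<longrightarrow>
            continuous_embedding (\<lambda>f x. proj_below RS \<gamma> (f x))
              (F_space s RS M \<gamma>' p' q) (F_norm s RS M \<gamma>' p' q)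
              (B_space s RS M \<gamma> (ennreal p) (ennreal p')) (B_norm s RS M \<gamma> (ennreal p) (ennreal p')))"
proof -
  interpret reg_model RS s M
    by unfold_locales (use assms in auto)
  show ?thesis
    using assms by (auto intro: embedding_smaller_q embedding_sobolev_F embedding_sobolev_B)
qed

end
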